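(* There is a universal constant $C>0$ such that the following holds. Let $n\ge 1$, let $\varepsilon\in(0,1/2)$, and let $\psi:\mathbb{R}^n\to\mathbb{R}$ be a norm. Then there exists a $k$-junta norm $\phi:\mathbb{R}^n\to\mathbb{R}$ with $$k\le \exp\left(C\,\frac{\log(1/\varepsilon)}{\varepsilon^4}\right)$$ such that $$\Pr_{g\sim N(0,I_n)}\left[1-\varepsilon\le \frac{\psi(g)}{\phi(g)}\le 1+\varepsilon\right]\ge 1-\varepsilon.$$
   Context: $N(0,I_n)$ is the standard Gaussian distribution on $\mathbb{R}^n$. A function $\phi:\mathbb{R}^n\to\mathbb{R}$ is called a $k$-junta norm if there is a linear subspace $E\subseteq\mathbb{R}^n$ with $\dim(E)\le k$ and a norm $\nu:E\to\mathbb{R}$ such that $\phi(x)=\nu(\pi_E x)$ for all $x\in\mathbb{R}^n$, where $\pi_E:\mathbb{R}^n\to E$ is the orthogonal projection onto $E$. *)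

theory Defs
  imports "HOL-Probability.Probability" "HOL-Library.Function_Algebras"
begin

text \<open>
  The dimension has to range inside the scope of a universal constant, so vectors of length
  \<open>n\<close> are functions \<open>nat \<Rightarrow> real\<close> that vanish from index \<open>n\<close> on. The pointwise vector space
  structure makes the generic \<^const>\<open>subspace\<close>, \<^const>\<open>span\<close> and \<^const>\<open>dim\<close> available.
\<close>

instantiation "fun" :: (type, real_vector) real_vector
begin

definition scaleR_fun :: "real \<Rightarrow> ('a \<Rightarrow> 'b) \<Rightarrow> 'a \<Rightarrow> 'b" where
  "scaleR_fun c f = (\<lambda>x. c *\<^sub>R f x)"

instance
  by standard (simp_all add: scaleR_fun_def fun_eq_iff algebra_simps)

end

lemma scaleR_fun_apply [simp]: "(c *\<^sub>R f) x = c *\<^sub>R f x"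
  by (simp add: scaleR_fun_def)

definition Rn :: "nat \<Rightarrow> (nat \<Rightarrow> real) set" where
  "Rn n = {x. \<forall>i\<ge>n. x i = 0}"

definition dot :: "nat \<Rightarrow> (nat \<Rightarrow> real) \<Rightarrow> (nat \<Rightarrow> real) \<Rightarrow> real" where
  "dot n x y = (\<Sum>i<n. x i * y i)"

definition is_norm_on :: "'a::real_vector set \<Rightarrow> ('a \<Rightarrow> real) \<Rightarrow> bool" where
  "is_norm_on E \<nu> \<longleftrightarrow>
     (\<forall>x\<in>E. 0 \<le> \<nu> x \<and> (\<nu> x = 0 \<longleftrightarrow> x = 0)) \<and>
     (\<forall>c. \<forall>x\<in>E. \<nu> (c *\<^sub>R x) = \<bar>c\<bar> * \<nu> x) \<and>
     (\<forall>x\<in>E. \<forall>y\<in>E. \<nu> (x + y) \<le> \<nu> x + \<nu> y)"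

definition orth_proj :: "nat \<Rightarrow> (nat \<Rightarrow> real) set \<Rightarrow> (nat \<Rightarrow> real) \<Rightarrow> (nat \<Rightarrow> real)" where
  "orth_proj n E x = (THE p. p \<in> E \<and> (\<forall>z\<in>E. dot n (x - p) z = 0))"

definition junta_norm :: "nat \<Rightarrow> nat \<Rightarrow> ((nat \<Rightarrow> real) \<Rightarrow> real) \<Rightarrow> bool" where
  "junta_norm n k \<phi> \<longleftrightarrow>
     (\<exists>E \<nu>. subspace E \<and> E \<subseteq> Rn n \<and> dim E \<le> k \<and> is_norm_on E \<nu> \<and>
            (\<forall>x\<in>Rn n. \<phi> x = \<nu> (orth_proj n E x)))"

text \<open>
  \<^const>\<open>PiM\<close> over \<open>{..<n}\<close> lives on functions that are \<^const>\<open>undefined\<close> outside \<open>{..<n}\<close>; the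
  pushforward replaces this padding by \<open>0\<close>. The Borel sets refer to the product topology.
\<close>

definition std_gaussian :: "nat \<Rightarrow> (nat \<Rightarrow> real) measure" where
  "std_gaussian n =
     distr (PiM {..<n} (\<lambda>_. density lborel std_normal_density))
           (restrict_space borel (Rn n))
           (\<lambda>x i. if i < n then x i else 0)"

lemma space_std_gaussian [simp]: "space (std_gaussian n) = Rn n"
  by (simp add: std_gaussian_def space_restrict_space)

lemma measurable_zero_pad:
  "(\<lambda>x i. if i < n then x i else 0)
     \<in> PiM {..<n} (\<lambda>_. density lborel std_normal_density) \<rightarrow>\<^sub>M restrict_space borel (Rn n)"
proof (rule measurable_restrict_space2)
  show "(\<lambda>x i. if i < n then x i else (0::real))
      \<in> borel_measurable (PiM {..<n} (\<lambda>_. density lborel std_normal_density))"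
  proof (rule measurable_coordinatewise_then_product)
    fix i :: nat
    show "(\<lambda>x. if i < n then x i else (0::real))
      \<in> borel_measurable (PiM {..<n} (\<lambda>_. density lborel std_normal_density))"
    proof (cases "i < n")
      case True
      then have "(\<lambda>x. x i) \<in> PiM {..<n} (\<lambda>_. density lborel std_normal_density)
          \<rightarrow>\<^sub>M density lborel std_normal_density"
        by (intro measurable_component_singleton) auto
      then show ?thesis using True by simp
    qed simp
  qed
qed (auto simp: Rn_def)

lemma prob_space_std_gaussian: "prob_space (std_gaussian n)"
proof -
  have 1: "prob_space (density lborel std_normal_density)"
    using prob_space_normal_density[of 1 0] by simp
  have "prob_space (PiM {..<n} (\<lambda>_. density lborel std_normal_density))"
    by (rule prob_space_PiM) (rule 1)
  then show ?thesis
    unfolding std_gaussian_def by (rule prob_space.prob_space_distr) (rule measurable_zero_pad)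
qed

lemma subspace_Rn: "subspace (Rn n)"
  by (auto simp: subspace_def Rn_def)

definition unit_vec :: "nat \<Rightarrow> nat \<Rightarrow> real" where
  "unit_vec j = (\<lambda>i. if i = j then 1 else 0)"

lemma sum_fun_apply: "(\<Sum>a\<in>A. f a) i = (\<Sum>a\<in>A. f a i)"
  for f :: "'c \<Rightarrow> 'd \<Rightarrow> 'e::comm_monoid_add"
  by (induction A rule: infinite_finite_induct) auto

lemma Rn_expand:
  assumes "x \<in> Rn n"
  shows "x = (\<Sum>j<n. x j *\<^sub>R unit_vec j)"
proof
  fix i
  show "x i = (\<Sum>j<n. x j *\<^sub>R unit_vec j) i"
    using assms by (auto simp: sum_fun_apply unit_vec_def Rn_def if_distrib cong: if_cong)
qed

lemma inj_unit_vec: "inj unit_vec"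
proof (rule injI)
  fix a b assume "unit_vec a = unit_vec b"
  then have "unit_vec a a = unit_vec b a" by simp
  then show "a = b" by (simp add: unit_vec_def split: if_splits)
qed

lemma span_unit_vec: "span (unit_vec ` {..<n}) = Rn n"
proof
  show "span (unit_vec ` {..<n}) \<subseteq> Rn n"
    by (rule span_minimal) (auto simp: subspace_Rn, auto simp: Rn_def unit_vec_def)
  show "Rn n \<subseteq> span (unit_vec ` {..<n})"
  proof
    fix x assume "x \<in> Rn n"
    then have "x = (\<Sum>j<n. x j *\<^sub>R unit_vec j)" by (rule Rn_expand)
    also have "\<dots> \<in> span (unit_vec ` {..<n})"
      by (intro span_sum span_scale span_base) auto
    finally show "x \<in> span (unit_vec ` {..<n})" .
  qed
qed

lemma independent_unit_vec: "independent (unit_vec ` {..<n})"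
proof (rule independent_if_scalars_zero)
  fix f :: "(nat \<Rightarrow> real) \<Rightarrow> real" and x
  assume 0: "(\<Sum>x\<in>unit_vec ` {..<n}. f x *\<^sub>R x) = 0" and "x \<in> unit_vec ` {..<n}"
  then obtain i where i: "i < n" "x = unit_vec i" by auto
  have "0 = (\<Sum>j<n. f (unit_vec j) *\<^sub>R unit_vec j) i"
    using 0 by (simp add: sum.reindex inj_on_subset[OF inj_unit_vec])
  also have "\<dots> = f (unit_vec i)"
    using i by (simp add: sum_fun_apply unit_vec_def if_distrib cong: if_cong)
  finally show "f x = 0" using i by simp
qed simp

lemma dim_Rn: "dim (Rn n) = n"
proof -
  have "dim (Rn n) = card (unit_vec ` {..<n})"
    by (metis span_unit_vec independent_unit_vec dim_span_eq_card_independent)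
  then show ?thesis by (simp add: card_image inj_on_subset[OF inj_unit_vec])
qed

lemma dot_algebra:
  "dot n (x + y) z = dot n x z + dot n y z" "dot n (x - y) z = dot n x z - dot n y z"
  "dot n z (x + y) = dot n z x + dot n z y" "dot n z (x - y) = dot n z x - dot n z y"
  "dot n (c *\<^sub>R x) z = c * dot n x z" "dot n z (c *\<^sub>R x) = c * dot n z x"
  by (simp_all add: dot_def algebra_simps sum.distrib sum_subtractf sum_distrib_left)

lemma dot_commute: "dot n x y = dot n y x"
  by (simp add: dot_def mult.commute)

lemma dot_self_eq_0:
  assumes "x \<in> Rn n" and "dot n x x = 0"
  shows "x = 0"
proof
  fix i
  have "\<forall>i\<in>{..<n}. x i * x i = 0"
    using assms(2) by (simp add: dot_def sum_nonneg_eq_0_iff)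
  then show "x i = 0 i"
    using assms(1) by (cases "i < n") (auto simp: Rn_def)
qed

lemma orth_proj_exists:
  assumes "finite B" "B \<subseteq> Rn n"
  shows "\<exists>p\<in>span B. \<forall>z\<in>span B. dot n (x - p) z = 0"
  using assms
proof (induction B arbitrary: x rule: finite_induct)
  case empty
  then show ?case by (simp add: dot_def)
next
  case (insert b B)
  obtain p where p: "p \<in> span B" "\<forall>z\<in>span B. dot n (x - p) z = 0"
    using insert by blast
  obtain q where q: "q \<in> span B" "\<forall>z\<in>span B. dot n (b - q) z = 0"
    using insert by blast
  define u where "u = b - q"
  have "span B \<subseteq> Rn n" using insert.prems by (intro span_minimal subspace_Rn) auto
  then have u: "u \<in> Rn n"
    unfolding u_def using q insert.prems by (intro subspace_diff subspace_Rn) auto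
  have sub: "span B \<subseteq> span (insert b B)" by (intro span_mono) auto
  have uin: "u \<in> span (insert b B)"
    unfolding u_def using q sub by (meson insertI1 span_base span_diff subsetD)
  define r where "r = p + (dot n x u / dot n u u) *\<^sub>R u"
  have pu: "dot n z u = 0" if "z \<in> span B" for z
    using q that dot_commute[of n z u] unfolding u_def by simp
  have "r \<in> span (insert b B)"
    unfolding r_def using p sub uin by (intro span_add span_scale) auto
  moreover have "dot n (x - r) z = 0" if z: "z \<in> span (insert b B)" for z
  proof -
    obtain c where c: "z - c *\<^sub>R b \<in> span B"
      using z span_breakdown_eq by blast
    define w where "w = z - c *\<^sub>R u"
    have "w = (z - c *\<^sub>R b) + c *\<^sub>R q" by (simp add: w_def u_def algebra_simps)
    then have w: "w \<in> span B"
      using c q by (simp add: span_add span_scale)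
    have 1: "dot n (x - r) w = 0"
      using p(2) w pu[OF w] dot_commute[of n u w] by (simp add: r_def dot_algebra)
    have 2: "dot n (x - r) u = 0"
    proof (cases "dot n u u = 0")
      case True
      then have "u = 0" using u dot_self_eq_0 by blast
      then show ?thesis by (simp add: dot_def)
    next
      case False
      then show ?thesis using pu[OF p(1)] by (simp add: r_def dot_algebra)
    qed
    have "z = w + c *\<^sub>R u" by (simp add: w_def)
    then show ?thesis using 1 2 by (simp only: dot_algebra)
  qed
  ultimately show ?case by blast
qed

lemma orth_proj_ex1:
  assumes "subspace E" "E \<subseteq> Rn n"
  shows "\<exists>!p. p \<in> E \<and> (\<forall>z\<in>E. dot n (x - p) z = 0)"
proof -
  obtain B where B: "B \<subseteq> E" "independent B" "E \<subseteq> span B"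
    using maximal_independent_subset by blast
  have "finite B"
    using independent_span_bound[of "unit_vec ` {..<n}" B] B assms span_unit_vec by auto
  moreover have "span B = E"
    using B assms(1) by (simp add: span_minimal subset_antisym)
  ultimately obtain p where p: "p \<in> E" "\<forall>z\<in>E. dot n (x - p) z = 0"
    using orth_proj_exists[of B n x] B assms by auto
  have "p' = p" if "p' \<in> E" "\<forall>z\<in>E. dot n (x - p') z = 0" for p'
  proof -
    have d: "p' - p \<in> E" using that p assms by (simp add: subspace_diff)
    have "dot n (p' - p) (p' - p) = dot n (x - p) (p' - p) - dot n (x - p') (p' - p)"
      by (simp add: dot_algebra)
    then have "dot n (p' - p) (p' - p) = 0" using d p that by simp
    then have "p' - p = 0" using d assms dot_self_eq_0 by blast
    then show ?thesis by simp
  qed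
  with p show ?thesis by blast
qed

lemma orth_proj_in: "subspace E \<Longrightarrow> E \<subseteq> Rn n \<Longrightarrow> orth_proj n E x \<in> E"
  and orth_proj_orth:
    "subspace E \<Longrightarrow> E \<subseteq> Rn n \<Longrightarrow> z \<in> E \<Longrightarrow> dot n (x - orth_proj n E x) z = 0"
  using theI'[OF orth_proj_ex1, of E n x] unfolding orth_proj_def by blast+

end

theory Submission
  imports Defs
begin

text \<open>
  Normalize \<open>\<psi>\<close> by a quantile \<open>M\<close> of \<open>\<psi>(g)\<close>. As long as \<open>\<psi>\<close> exceeds \<open>\<delta> M\<close> times the Euclidean norm
  somewhere on the orthogonal complement of the directions chosen so far, a supporting functional there
  gives a new direction. The functionals obtained after \<open>m\<close> steps are triangular with diagonal at
  least \<open>\<delta> M\<close>, so the probability that all of them stay below \<open>2 M\<close> decays geometrically in \<open>m\<close>, which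
  bounds \<open>m\<close> by \<open>exp (O(1/\<delta>^2))\<close>. On the complement of the final span \<open>E\<close> the norm is
  \<open>\<delta> M\<close>-Lipschitz, so by Gaussian concentration \<open>\<psi>(g)\<close> hardly changes when the component of \<open>g\<close>
  orthogonal to \<open>E\<close> is replaced by a fixed typical vector \<open>z\<close>. To turn \<open>x \<mapsto> \<psi>(x\<^sub>E + z)\<close> into a norm, \<open>z\<close> is
  scaled by the Euclidean norm of \<open>exp (O(1/\<delta>^2))\<close> further coordinates, which is itself concentrated.
  The additive error is \<open>O(\<epsilon>^2 M)\<close> for \<open>\<delta>\<close> of order \<open>\<epsilon>^2 / sqrt (ln (1/\<epsilon>))\<close>, and it is a relative error
  \<open>\<epsilon>\<close> because \<open>\<psi>(g) \<ge> c \<epsilon> M\<close> with probability at least \<open>1 - \<epsilon>/2\<close>.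
\<close>

section \<open>Gaussian sequences and their rotations\<close>

text \<open>Simply dropping the part of \<open>g\<close> orthogonal to \<open>E\<close> fails: for
  the Euclidean norm in high dimension no direction is chosen at all, and the whole value of the
  norm sits in the orthogonal part. Hence \<open>z\<close> must be kept, and the homogeneity it
  destroys is repaired by a factor that is itself a seminorm of few coordinates and close to its
  typical value.

  Origin of the exponent 4: the small-ball bound costs one factor \<epsilon>, so relative error
  \<epsilon> needs additive error of order \<epsilon>^2 M. Three deviation events with tails of
  order exp (-r^2/8) must have total probability below a fraction of \<epsilon>, so r is of order
  sqrt (ln (1/\<epsilon>)) and \<delta> of order \<epsilon>^2/r. With q the probability that one
  Gaussian exceeds 2/\<delta>, both the number of chosen directions and the number of extra
  coordinates are O(1/q) = exp (O(1/\<delta>^2)).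

  If these dimensions together exceed n, then \<psi> itself is taken as the junta norm.\<close>

abbreviation N01 :: "real measure" where
  "N01 \<equiv> density lborel std_normal_density"

lemma prob_space_N01: "prob_space N01"
  using prob_space_normal_density[of 1 0] by simp

interpretation N01: prob_space N01
  by (rule prob_space_N01)

lemma nn_integral_N01:
  "f \<in> borel_measurable borel \<Longrightarrow> (\<integral>\<^sup>+x. f x \<partial>N01) = (\<integral>\<^sup>+x. ennreal (std_normal_density x) * f x \<partial>lborel)"
  by (subst nn_integral_density) auto

text \<open>One infinite product serves every dimension: functions of \<open>n\<close> variables
  ignore the coordinates from \<open>n\<close> on.\<close>

definition gaussian_seq :: "(nat \<Rightarrow> real) measure" where
  "gaussian_seq = PiM UNIV (\<lambda>_. N01)"

lemma sets_gaussian_seq [measurable_cong, simp]: "sets gaussian_seq = sets borel"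
proof -
  have "sets gaussian_seq = sets (PiM UNIV (\<lambda>_::nat. borel :: real measure))"
    unfolding gaussian_seq_def by (intro sets_PiM_cong) auto
  then show ?thesis by (simp add: sets_PiM_equal_borel)
qed

lemma space_gaussian_seq [simp]: "space gaussian_seq = UNIV"
  using sets_eq_imp_space_eq[OF sets_gaussian_seq] by simp

interpretation gprod: product_prob_space "\<lambda>_::nat. N01" UNIV
  by unfold_locales

interpretation G: prob_space gaussian_seq
  unfolding gaussian_seq_def by (rule gprod.prob_space_axioms)

lemma measurable_fun_upd_borel [measurable]:
  assumes [measurable]: "f \<in> M \<rightarrow>\<^sub>M borel" "g \<in> borel_measurable M"
  shows "(\<lambda>w. (f w)(i := g w)) \<in> M \<rightarrow>\<^sub>M (borel :: (nat \<Rightarrow> real) measure)"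
proof (rule measurable_coordinatewise_then_product)
  fix j
  have "(\<lambda>w. f w j) \<in> borel_measurable M"
    by (rule measurable_product_then_coordinatewise) (rule assms(1))
  then show "(\<lambda>w. ((f w)(i := g w)) j) \<in> borel_measurable M"
    by (cases "j = i") auto
qed

text \<open>Checked on cylinder sets. Refreshing one coordinate takes the place of splitting the
  product into that coordinate and the rest; the coordinatewise integrations below all go through
  it.\<close>

lemma gaussian_seq_distr_upd:
  "distr (gaussian_seq \<Otimes>\<^sub>M N01) borel (\<lambda>(x, t). x(i := t)) = gaussian_seq"
  unfolding gaussian_seq_def
proof (rule gprod.PiM_eq)
  interpret pair_sigma_finite gaussian_seq N01 ..
  show "sets (distr (Pi\<^sub>M UNIV (\<lambda>_. N01) \<Otimes>\<^sub>M N01) borel (\<lambda>(x, t). x(i := t))) = sets (Pi\<^sub>M UNIV (\<lambda>_. N01))"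
    using sets_gaussian_seq by (simp add: gaussian_seq_def)
  fix J :: "nat set" and F :: "nat \<Rightarrow> real set"
  assume J: "finite J" "J \<subseteq> UNIV" and F: "\<And>j. j \<in> J \<Longrightarrow> F j \<in> sets N01"
  have emb: "prod_emb UNIV (\<lambda>_. N01) K (Pi\<^sub>E K F) = {x. \<forall>j\<in>K. x j \<in> F j}" for K
    by (auto simp: prod_emb_def PiE_def extensional_def Pi_iff)
  have meas: "{x. \<forall>j\<in>K. x j \<in> F j} \<in> sets (borel :: (nat \<Rightarrow> real) measure)" if "K \<subseteq> J" for K
  proof -
    have "prod_emb UNIV (\<lambda>_. N01) K (Pi\<^sub>E K F) \<in> sets (PiM UNIV (\<lambda>_::nat. N01))"
      using J F that by (intro measurable_prod_emb sets_PiM_I_finite) (auto intro: finite_subset)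
    then show ?thesis unfolding emb using sets_gaussian_seq by (simp add: gaussian_seq_def)
  qed
  let ?J = "J - {i}"
  let ?T = "if i \<in> J then F i else UNIV"
  have T: "?T \<in> sets N01" using F by auto
  have pre: "(\<lambda>(x, t). x(i := t)) -` {x. \<forall>j\<in>J. x j \<in> F j} = {x. \<forall>j\<in>?J. x j \<in> F j} \<times> ?T"
    by (auto split: if_splits)
  have "emeasure (distr (gaussian_seq \<Otimes>\<^sub>M N01) borel (\<lambda>(x, t). x(i := t))) {x. \<forall>j\<in>J. x j \<in> F j}
      = emeasure (gaussian_seq \<Otimes>\<^sub>M N01) ({x. \<forall>j\<in>?J. x j \<in> F j} \<times> ?T)"
  proof -
    have "space (gaussian_seq \<Otimes>\<^sub>M N01) = UNIV" by (simp add: space_pair_measure)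
    moreover have "(\<lambda>(x, t). x(i := t)) \<in> gaussian_seq \<Otimes>\<^sub>M N01 \<rightarrow>\<^sub>M borel" by measurable
    ultimately show ?thesis
      using meas[of J] by (simp only: emeasure_distr pre Int_UNIV_right order_refl)
  qed
  also have "\<dots> = emeasure gaussian_seq {x. \<forall>j\<in>?J. x j \<in> F j} * emeasure N01 ?T"
    using meas[of ?J] T by (intro N01.emeasure_pair_measure_Times) auto
  also have "emeasure gaussian_seq {x. \<forall>j\<in>?J. x j \<in> F j} = (\<Prod>j\<in>?J. emeasure N01 (F j))"
    using gprod.emeasure_PiM_emb[of ?J F] J F unfolding emb by (simp add: gaussian_seq_def)
  also have "(\<Prod>j\<in>?J. emeasure N01 (F j)) * emeasure N01 ?T = (\<Prod>j\<in>J. emeasure N01 (F j))"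
    using J N01.emeasure_space_1
    by (cases "i \<in> J") (auto simp: prod.remove mult.commute)
  finally show "emeasure (distr (Pi\<^sub>M UNIV (\<lambda>_. N01) \<Otimes>\<^sub>M N01) borel (\<lambda>(x, t). x(i := t)))
        (prod_emb UNIV (\<lambda>_. N01) J (Pi\<^sub>E J F)) = (\<Prod>j\<in>J. emeasure N01 (F j))"
    unfolding emb gaussian_seq_def .
qed

lemma nn_integral_gaussian_seq_upd:
  assumes [measurable]: "f \<in> borel_measurable borel"
  shows "(\<integral>\<^sup>+x. f x \<partial>gaussian_seq) = (\<integral>\<^sup>+x. \<integral>\<^sup>+t. f (x(i := t)) \<partial>N01 \<partial>gaussian_seq)"
proof -
  have m: "(\<lambda>(x, t). x(i := t)) \<in> gaussian_seq \<Otimes>\<^sub>M N01 \<rightarrow>\<^sub>M borel"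
    by measurable
  have "(\<integral>\<^sup>+x. f x \<partial>gaussian_seq) = (\<integral>\<^sup>+x. f x \<partial>distr (gaussian_seq \<Otimes>\<^sub>M N01) borel (\<lambda>(x, t). x(i := t)))"
    by (simp only: gaussian_seq_distr_upd)
  also have "\<dots> = (\<integral>\<^sup>+p. f ((\<lambda>(x, t). x(i := t)) p) \<partial>(gaussian_seq \<Otimes>\<^sub>M N01))"
    by (rule nn_integral_distr[OF m]) simp
  also have "\<dots> = (\<integral>\<^sup>+x. \<integral>\<^sup>+t. f (x(i := t)) \<partial>N01 \<partial>gaussian_seq)"
    by (subst N01.nn_integral_fst[symmetric]) auto
  finally show ?thesis .
qed

text \<open>Invariance of the standard Gaussian law of the plane. It is phrased by iterated
  integrals because this is the shape that appears once a coordinate of each of two copies, or two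
  coordinates of one sequence, have been refreshed.\<close>

definition pres2 :: "(real \<times> real \<Rightarrow> real \<times> real) \<Rightarrow> bool" where
  "pres2 R \<longleftrightarrow> R \<in> borel \<Otimes>\<^sub>M borel \<rightarrow>\<^sub>M borel \<Otimes>\<^sub>M borel \<and>
     (\<forall>f::real \<times> real \<Rightarrow> ennreal. f \<in> borel_measurable (borel \<Otimes>\<^sub>M borel) \<longrightarrow>
       (\<integral>\<^sup>+a. \<integral>\<^sup>+b. f (R (a, b)) \<partial>N01 \<partial>N01) = (\<integral>\<^sup>+a. \<integral>\<^sup>+b. f (a, b) \<partial>N01 \<partial>N01))"

definition rot2 :: "real \<Rightarrow> real \<Rightarrow> real \<times> real \<Rightarrow> real \<times> real" where
  "rot2 c s = (\<lambda>(a, b). (c * a + s * b, c * b - s * a))"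

text \<open>For \<open>c \<noteq> 0\<close> the rotation is a product of two affine substitutions in
  a single variable each, whose Jacobian factors cancel; for \<open>c = 0\<close> it exchanges the
  variables up to signs.\<close>

lemma lborel_rotation:
  fixes g :: "real \<times> real \<Rightarrow> ennreal"
  assumes [measurable]: "g \<in> borel_measurable (borel \<Otimes>\<^sub>M borel)" and cs: "c^2 + s^2 = 1"
  shows "(\<integral>\<^sup>+a. \<integral>\<^sup>+b. g (c * a + s * b, c * b - s * a) \<partial>lborel \<partial>lborel)
       = (\<integral>\<^sup>+a. \<integral>\<^sup>+b. g (a, b) \<partial>lborel \<partial>lborel)"
proof -
  show ?thesis
  proof (cases "c = 0")
    case False
    have "(\<integral>\<^sup>+a. \<integral>\<^sup>+b. g (c * a + s * b, c * b - s * a) \<partial>lborel \<partial>lborel)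
        = (\<integral>\<^sup>+b. \<integral>\<^sup>+a. g (c * a + s * b, c * b - s * a) \<partial>lborel \<partial>lborel)"
      by (rule lborel_pair.Fubini') measurable
    also have "\<dots> = (\<integral>\<^sup>+b. (\<integral>\<^sup>+a. ennreal \<bar>1/c\<bar> * g (a, (b - s * a)/c) \<partial>lborel) \<partial>lborel)"
    proof (rule nn_integral_cong)
      fix b
      have e: "(b - s * (s * b + c * a))/c = c * b - s * a" for a
      proof -
        have "b - s * (s * b + c * a) = b * (c^2 + s^2) - s * (s * b + c * a)" using cs by simp
        also have "\<dots> = c * (c * b - s * a)" by (simp add: algebra_simps power2_eq_square)
        finally show ?thesis using False by simp
      qed
      have "(\<integral>\<^sup>+a. g (a, (b - s * a)/c) \<partial>lborel)
          = ennreal \<bar>c\<bar> * (\<integral>\<^sup>+a. g (s * b + c * a, (b - s * (s * b + c * a))/c) \<partial>lborel)"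
        using False by (intro nn_integral_real_affine) auto
      then show "(\<integral>\<^sup>+a. g (c * a + s * b, c * b - s * a) \<partial>lborel)
          = (\<integral>\<^sup>+a. ennreal \<bar>1/c\<bar> * g (a, (b - s * a)/c) \<partial>lborel)"
        unfolding e using False
        by (simp add: nn_integral_cmult mult.assoc[symmetric] ennreal_mult[symmetric] add.commute)
    qed
    also have "\<dots> = (\<integral>\<^sup>+a. (\<integral>\<^sup>+b. ennreal \<bar>1/c\<bar> * g (a, (b - s * a)/c) \<partial>lborel) \<partial>lborel)"
      by (rule lborel_pair.Fubini') measurable
    also have "\<dots> = (\<integral>\<^sup>+a. \<integral>\<^sup>+b. g (a, b) \<partial>lborel \<partial>lborel)"
    proof (rule nn_integral_cong)
      fix a
      have "(\<integral>\<^sup>+b. g (a, b) \<partial>lborel) = ennreal \<bar>1/c\<bar> * (\<integral>\<^sup>+b. g (a, (- (s * a)/c) + (1/c) * b) \<partial>lborel)"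
        using False by (intro nn_integral_real_affine) auto
      also have "\<dots> = (\<integral>\<^sup>+b. ennreal \<bar>1/c\<bar> * g (a, (b - s * a)/c) \<partial>lborel)"
        by (subst nn_integral_cmult[symmetric]) (auto simp: diff_divide_distrib)
      finally show "(\<integral>\<^sup>+b. ennreal \<bar>1/c\<bar> * g (a, (b - s * a)/c) \<partial>lborel) = (\<integral>\<^sup>+b. g (a, b) \<partial>lborel)"
        by simp
    qed
    finally show ?thesis .
  next
    case True
    then have s: "\<bar>s\<bar> = 1" using cs by (auto simp: power2_eq_1_iff)
    then have s0: "s \<noteq> 0" by auto
    have "(\<integral>\<^sup>+a. \<integral>\<^sup>+b. g (c * a + s * b, c * b - s * a) \<partial>lborel \<partial>lborel)
        = (\<integral>\<^sup>+a. \<integral>\<^sup>+b. g (b, - s * a) \<partial>lborel \<partial>lborel)"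
    proof (rule nn_integral_cong)
      fix a
      show "(\<integral>\<^sup>+b. g (c * a + s * b, c * b - s * a) \<partial>lborel) = (\<integral>\<^sup>+b. g (b, - s * a) \<partial>lborel)"
        using nn_integral_real_affine[of "\<lambda>b. g (b, - s * a)" s 0] s0 s True by simp
    qed
    also have "\<dots> = (\<integral>\<^sup>+b. \<integral>\<^sup>+a. g (b, - s * a) \<partial>lborel \<partial>lborel)"
      by (rule lborel_pair.Fubini') measurable
    also have "\<dots> = (\<integral>\<^sup>+a. \<integral>\<^sup>+b. g (a, b) \<partial>lborel \<partial>lborel)"
    proof (rule nn_integral_cong)
      fix b
      show "(\<integral>\<^sup>+a. g (b, - s * a) \<partial>lborel) = (\<integral>\<^sup>+a. g (b, a) \<partial>lborel)"
        using nn_integral_real_affine[of "\<lambda>a. g (b, a)" "- s" 0] s0 s by simp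
    qed
    finally show ?thesis .
  qed
qed

lemma nn_integral_N01_pair:
  fixes f :: "real \<times> real \<Rightarrow> ennreal"
  assumes [measurable]: "f \<in> borel_measurable (borel \<Otimes>\<^sub>M borel)"
  shows "(\<integral>\<^sup>+a. \<integral>\<^sup>+b. f (a, b) \<partial>N01 \<partial>N01)
    = (\<integral>\<^sup>+a. \<integral>\<^sup>+b. ennreal (std_normal_density a * std_normal_density b) * f (a, b) \<partial>lborel \<partial>lborel)"
proof -
  have "(\<integral>\<^sup>+a. \<integral>\<^sup>+b. f (a, b) \<partial>N01 \<partial>N01)
    = (\<integral>\<^sup>+a. ennreal (std_normal_density a) * (\<integral>\<^sup>+b. f (a, b) \<partial>N01) \<partial>lborel)"
    by (subst nn_integral_density) auto
  also have "\<dots> = (\<integral>\<^sup>+a. \<integral>\<^sup>+b. ennreal (std_normal_density a * std_normal_density b) * f (a, b) \<partial>lborel \<partial>lborel)"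
    by (intro nn_integral_cong)
       (simp add: nn_integral_density nn_integral_cmult[symmetric] ennreal_mult mult.assoc)
  finally show ?thesis .
qed

text \<open>The joint density depends only on \<open>a^2 + b^2\<close>, which reduces the claim to
  Lebesgue measure.\<close>

lemma pres2_rot2:
  assumes cs: "c^2 + s^2 = 1"
  shows "pres2 (rot2 c s)"
  unfolding pres2_def
proof (intro conjI allI impI)
  show R [measurable]: "rot2 c s \<in> borel \<Otimes>\<^sub>M borel \<rightarrow>\<^sub>M borel \<Otimes>\<^sub>M borel"
    unfolding rot2_def by measurable
  fix f :: "real \<times> real \<Rightarrow> ennreal" assume [measurable]: "f \<in> borel_measurable (borel \<Otimes>\<^sub>M borel)"
  let ?g = "\<lambda>p. ennreal (std_normal_density (fst p) * std_normal_density (snd p)) * f p"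
  have [measurable]: "?g \<in> borel_measurable (borel \<Otimes>\<^sub>M borel)"
    by measurable
  have dens: "std_normal_density (c * a + s * b) * std_normal_density (c * b - s * a)
      = std_normal_density a * std_normal_density b" for a b
  proof -
    have "(c * a + s * b)^2 + (c * b - s * a)^2 = (c^2 + s^2) * (a^2 + b^2)"
      by (simp add: power2_eq_square algebra_simps)
    then have "(c * a + s * b)^2 + (c * b - s * a)^2 = a^2 + b^2" using cs by simp
    then show ?thesis
      by (simp add: std_normal_density_def exp_add[symmetric] add_divide_distrib[symmetric])
  qed
  have "(\<integral>\<^sup>+a. \<integral>\<^sup>+b. f (rot2 c s (a, b)) \<partial>N01 \<partial>N01)
     = (\<integral>\<^sup>+a. \<integral>\<^sup>+b. ?g (c * a + s * b, c * b - s * a) \<partial>lborel \<partial>lborel)"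
    using nn_integral_N01_pair[of "\<lambda>p. f (rot2 c s p)"] measurable_compose[OF R, of f]
    by (simp add: rot2_def dens)
  also have "\<dots> = (\<integral>\<^sup>+a. \<integral>\<^sup>+b. ?g (a, b) \<partial>lborel \<partial>lborel)"
    by (rule lborel_rotation[OF _ cs]) simp
  also have "\<dots> = (\<integral>\<^sup>+a. \<integral>\<^sup>+b. f (a, b) \<partial>N01 \<partial>N01)"
    by (subst nn_integral_N01_pair) (auto intro: measurable_compose)
  finally show "(\<integral>\<^sup>+a. \<integral>\<^sup>+b. f (rot2 c s (a, b)) \<partial>N01 \<partial>N01) = (\<integral>\<^sup>+a. \<integral>\<^sup>+b. f (a, b) \<partial>N01 \<partial>N01)" .
qed

lemma pres2_swap: "pres2 (\<lambda>(a, b). (b, a))"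
  unfolding pres2_def
proof (intro conjI allI impI)
  show "(\<lambda>(a, b). (b, a)) \<in> (borel :: real measure) \<Otimes>\<^sub>M (borel :: real measure) \<rightarrow>\<^sub>M borel \<Otimes>\<^sub>M borel"
    by measurable
  fix f :: "real \<times> real \<Rightarrow> ennreal" assume [measurable]: "f \<in> borel_measurable (borel \<Otimes>\<^sub>M borel)"
  interpret pair_sigma_finite N01 N01 ..
  show "(\<integral>\<^sup>+a. \<integral>\<^sup>+b. f (case (a, b) of (a, b) \<Rightarrow> (b, a)) \<partial>N01 \<partial>N01) = (\<integral>\<^sup>+a. \<integral>\<^sup>+b. f (a, b) \<partial>N01 \<partial>N01)"
    unfolding prod.case by (rule Fubini') measurable
qed

lemma pres2_neg: "pres2 (\<lambda>(a, b). (a, - b))"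
  unfolding pres2_def
proof (intro conjI allI impI)
  show "(\<lambda>(a, b). (a, - b)) \<in> (borel :: real measure) \<Otimes>\<^sub>M (borel :: real measure) \<rightarrow>\<^sub>M borel \<Otimes>\<^sub>M borel"
    by measurable
  fix f :: "real \<times> real \<Rightarrow> ennreal" assume [measurable]: "f \<in> borel_measurable (borel \<Otimes>\<^sub>M borel)"
  have "(\<integral>\<^sup>+b. f (a, - b) \<partial>N01) = (\<integral>\<^sup>+b. f (a, b) \<partial>N01)" for a
  proof -
    have "(\<integral>\<^sup>+b. f (a, b) \<partial>N01) = (\<integral>\<^sup>+b. ennreal (std_normal_density b) * f (a, b) \<partial>lborel)"
      by (rule nn_integral_N01) measurable
    also have "\<dots> = ennreal \<bar>-1\<bar> * (\<integral>\<^sup>+b. ennreal (std_normal_density (0 + -1 * b)) * f (a, 0 + -1 * b) \<partial>lborel)"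
      by (rule nn_integral_real_affine) auto
    also have "\<dots> = (\<integral>\<^sup>+b. ennreal (std_normal_density b) * f (a, - b) \<partial>lborel)"
      by (simp add: std_normal_density_def)
    also have "\<dots> = (\<integral>\<^sup>+b. f (a, - b) \<partial>N01)"
      by (rule nn_integral_N01[symmetric]) measurable
    finally show ?thesis by simp
  qed
  then show "(\<integral>\<^sup>+a. \<integral>\<^sup>+b. f (case (a, b) of (a, b) \<Rightarrow> (a, - b)) \<partial>N01 \<partial>N01) = (\<integral>\<^sup>+a. \<integral>\<^sup>+b. f (a, b) \<partial>N01 \<partial>N01)"
    by simp
qed

text \<open>Acts on two coordinates of one sequence and produces changes of orthonormal basis. Its
  counterpart \<open>pair_map\<close> acts on equal coordinates of two independent copies and
  produces concentration.\<close>

definition upd2 :: "nat \<Rightarrow> nat \<Rightarrow> (real \<times> real \<Rightarrow> real \<times> real) \<Rightarrow> (nat \<Rightarrow> real) \<Rightarrow> (nat \<Rightarrow> real)" where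
  "upd2 i j R x = x(i := fst (R (x i, x j)), j := snd (R (x i, x j)))"

lemma measurable_seq_apply [measurable]:
  "f \<in> M \<rightarrow>\<^sub>M (borel :: (nat \<Rightarrow> real) measure) \<Longrightarrow> (\<lambda>w. f w i) \<in> borel_measurable M"
  by (rule measurable_product_then_coordinatewise)

lemma measurable_upd2:
  assumes "pres2 R"
  shows "upd2 i j R \<in> borel \<rightarrow>\<^sub>M borel"
proof -
  have [measurable]: "R \<in> borel \<Otimes>\<^sub>M borel \<rightarrow>\<^sub>M borel \<Otimes>\<^sub>M borel" using assms by (simp add: pres2_def)
  show ?thesis unfolding upd2_def by measurable
qed

lemma nn_integral_upd2:
  assumes R: "pres2 R" and [measurable]: "f \<in> borel_measurable borel" and ij: "i \<noteq> j"
  shows "(\<integral>\<^sup>+x. f (upd2 i j R x) \<partial>gaussian_seq) = (\<integral>\<^sup>+x. f x \<partial>gaussian_seq)"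
proof -
  have two: "(\<integral>\<^sup>+x. g x \<partial>gaussian_seq) = (\<integral>\<^sup>+x. \<integral>\<^sup>+a. \<integral>\<^sup>+b. g (x(i := a, j := b)) \<partial>N01 \<partial>N01 \<partial>gaussian_seq)"
    if [measurable]: "g \<in> borel_measurable borel" for g :: "(nat \<Rightarrow> real) \<Rightarrow> ennreal"
    by (subst nn_integral_gaussian_seq_upd[where i = j], simp)
       (subst nn_integral_gaussian_seq_upd[where i = i], measurable)
  have [measurable]: "upd2 i j R \<in> borel \<rightarrow>\<^sub>M borel" by (rule measurable_upd2[OF R])
  have "(\<integral>\<^sup>+x. f (upd2 i j R x) \<partial>gaussian_seq)
      = (\<integral>\<^sup>+x. \<integral>\<^sup>+a. \<integral>\<^sup>+b. f (upd2 i j R (x(i := a, j := b))) \<partial>N01 \<partial>N01 \<partial>gaussian_seq)"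
    by (rule two) measurable
  also have "\<dots> = (\<integral>\<^sup>+x. \<integral>\<^sup>+a. \<integral>\<^sup>+b. f (x(i := a, j := b)) \<partial>N01 \<partial>N01 \<partial>gaussian_seq)"
  proof (rule nn_integral_cong)
    fix x :: "nat \<Rightarrow> real"
    let ?h = "\<lambda>p. f (x(i := fst p, j := snd p))"
    have "?h \<in> borel_measurable (borel \<Otimes>\<^sub>M borel)" by measurable
    then have "(\<integral>\<^sup>+a. \<integral>\<^sup>+b. ?h (R (a, b)) \<partial>N01 \<partial>N01) = (\<integral>\<^sup>+a. \<integral>\<^sup>+b. ?h (a, b) \<partial>N01 \<partial>N01)"
      using R unfolding pres2_def by blast
    moreover have "upd2 i j R (x(i := a, j := b)) = x(i := fst (R (a, b)), j := snd (R (a, b)))" for a b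
      using ij by (auto simp: upd2_def fun_eq_iff)
    ultimately show "(\<integral>\<^sup>+a. \<integral>\<^sup>+b. f (upd2 i j R (x(i := a, j := b))) \<partial>N01 \<partial>N01)
        = (\<integral>\<^sup>+a. \<integral>\<^sup>+b. f (x(i := a, j := b)) \<partial>N01 \<partial>N01)" by simp
  qed
  also have "\<dots> = (\<integral>\<^sup>+x. f x \<partial>gaussian_seq)"
    by (rule two[symmetric]) measurable
  finally show ?thesis .
qed

section \<open>Two independent copies, rotated into each other\<close>

abbreviation gaussian_pair :: "((nat \<Rightarrow> real) \<times> (nat \<Rightarrow> real)) measure" where
  "gaussian_pair \<equiv> gaussian_seq \<Otimes>\<^sub>M gaussian_seq"

lemma space_gaussian_pair: "space gaussian_pair = UNIV"
  by (simp add: space_pair_measure)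

interpretation GG: pair_prob_space gaussian_seq gaussian_seq ..

interpretation GG: prob_space gaussian_pair
  by unfold_locales

lemma nn_integral_gaussian_pair:
  "f \<in> borel_measurable gaussian_pair \<Longrightarrow>
    (\<integral>\<^sup>+p. f p \<partial>gaussian_pair) = (\<integral>\<^sup>+x. \<integral>\<^sup>+y. f (x, y) \<partial>gaussian_seq \<partial>gaussian_seq)"
  by (simp add: G.nn_integral_fst)

definition pair_map :: "nat set \<Rightarrow> (real \<times> real \<Rightarrow> real \<times> real) \<Rightarrow>
    (nat \<Rightarrow> real) \<times> (nat \<Rightarrow> real) \<Rightarrow> (nat \<Rightarrow> real) \<times> (nat \<Rightarrow> real)" where
  "pair_map A R p =
     ((\<lambda>i. if i \<in> A then fst (R (fst p i, snd p i)) else fst p i),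
      (\<lambda>i. if i \<in> A then snd (R (fst p i, snd p i)) else snd p i))"

lemma measurable_seq_lambda:
  assumes "\<And>i. (\<lambda>w. f w i) \<in> borel_measurable M"
  shows "f \<in> M \<rightarrow>\<^sub>M (borel :: (nat \<Rightarrow> real) measure)"
  using assms by (rule measurable_coordinatewise_then_product)

lemma measurable_pair_map:
  assumes "pres2 R"
  shows "pair_map A R \<in> gaussian_pair \<rightarrow>\<^sub>M gaussian_pair"
proof -
  have [measurable]: "R \<in> borel \<Otimes>\<^sub>M borel \<rightarrow>\<^sub>M borel \<Otimes>\<^sub>M borel" using assms by (simp add: pres2_def)
  show ?thesis
    unfolding pair_map_def
    by (intro measurable_Pair; subst measurable_cong_sets[OF refl sets_gaussian_seq];
        intro measurable_seq_lambda; measurable)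
qed

lemma nn_integral_pair_map:
  assumes R: "pres2 R" and A: "finite A" and f: "f \<in> borel_measurable gaussian_pair"
  shows "(\<integral>\<^sup>+p. f (pair_map A R p) \<partial>gaussian_pair) = (\<integral>\<^sup>+p. f p \<partial>gaussian_pair)"
  using A f
proof (induction A arbitrary: f rule: finite_induct)
  case empty
  have "pair_map {} R p = p" for p by (simp add: pair_map_def)
  then show ?case by simp
next
  case (insert i A)
  note [measurable] = insert.prems
  have [measurable]: "pair_map B R \<in> gaussian_pair \<rightarrow>\<^sub>M gaussian_pair" for B by (rule measurable_pair_map[OF R])
  have two: "(\<integral>\<^sup>+p. g p \<partial>gaussian_pair)
      = (\<integral>\<^sup>+x. \<integral>\<^sup>+y. \<integral>\<^sup>+a. \<integral>\<^sup>+b. g (x(i := a), y(i := b)) \<partial>N01 \<partial>N01 \<partial>gaussian_seq \<partial>gaussian_seq)"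
    if [measurable]: "g \<in> borel_measurable gaussian_pair" for g :: "(nat \<Rightarrow> real) \<times> (nat \<Rightarrow> real) \<Rightarrow> ennreal"
  proof -
    interpret NG: pair_sigma_finite N01 gaussian_seq ..
    have "(\<integral>\<^sup>+p. g p \<partial>gaussian_pair) = (\<integral>\<^sup>+x. \<integral>\<^sup>+y. g (x, y) \<partial>gaussian_seq \<partial>gaussian_seq)"
      by (rule nn_integral_gaussian_pair) measurable
    also have "\<dots> = (\<integral>\<^sup>+x. \<integral>\<^sup>+a. \<integral>\<^sup>+y. g (x(i := a), y) \<partial>gaussian_seq \<partial>N01 \<partial>gaussian_seq)"
      by (subst nn_integral_gaussian_seq_upd[where i = i]) measurable
    also have "\<dots> = (\<integral>\<^sup>+x. \<integral>\<^sup>+a. \<integral>\<^sup>+y. \<integral>\<^sup>+b. g (x(i := a), y(i := b)) \<partial>N01 \<partial>gaussian_seq \<partial>N01 \<partial>gaussian_seq)"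
      by (rule nn_integral_cong, rule nn_integral_cong, rule nn_integral_gaussian_seq_upd) measurable
    also have "\<dots> = (\<integral>\<^sup>+x. \<integral>\<^sup>+y. \<integral>\<^sup>+a. \<integral>\<^sup>+b. g (x(i := a), y(i := b)) \<partial>N01 \<partial>N01 \<partial>gaussian_seq \<partial>gaussian_seq)"
      by (rule nn_integral_cong, rule NG.Fubini'[symmetric]) measurable
    finally show ?thesis .
  qed
  have step: "(\<integral>\<^sup>+p. g (pair_map {i} R p) \<partial>gaussian_pair) = (\<integral>\<^sup>+p. g p \<partial>gaussian_pair)"
    if [measurable]: "g \<in> borel_measurable gaussian_pair" for g :: "(nat \<Rightarrow> real) \<times> (nat \<Rightarrow> real) \<Rightarrow> ennreal"
  proof -
    have "(\<integral>\<^sup>+p. g (pair_map {i} R p) \<partial>gaussian_pair)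
      = (\<integral>\<^sup>+x. \<integral>\<^sup>+y. \<integral>\<^sup>+a. \<integral>\<^sup>+b. g (pair_map {i} R (x(i := a), y(i := b))) \<partial>N01 \<partial>N01 \<partial>gaussian_seq \<partial>gaussian_seq)"
      by (rule two) measurable
    also have "\<dots> = (\<integral>\<^sup>+x. \<integral>\<^sup>+y. \<integral>\<^sup>+a. \<integral>\<^sup>+b. g (x(i := a), y(i := b)) \<partial>N01 \<partial>N01 \<partial>gaussian_seq \<partial>gaussian_seq)"
    proof (rule nn_integral_cong, rule nn_integral_cong)
      fix x y :: "nat \<Rightarrow> real"
      let ?h = "\<lambda>p. g (x(i := fst p), y(i := snd p))"
      have "?h \<in> borel_measurable (borel \<Otimes>\<^sub>M borel)" by measurable
      then have "(\<integral>\<^sup>+a. \<integral>\<^sup>+b. ?h (R (a, b)) \<partial>N01 \<partial>N01) = (\<integral>\<^sup>+a. \<integral>\<^sup>+b. ?h (a, b) \<partial>N01 \<partial>N01)"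
        using R unfolding pres2_def by blast
      moreover have "pair_map {i} R (x(i := a), y(i := b)) = (x(i := fst (R (a, b))), y(i := snd (R (a, b))))" for a b
        by (auto simp: pair_map_def fun_eq_iff)
      ultimately show "(\<integral>\<^sup>+a. \<integral>\<^sup>+b. g (pair_map {i} R (x(i := a), y(i := b))) \<partial>N01 \<partial>N01)
        = (\<integral>\<^sup>+a. \<integral>\<^sup>+b. g (x(i := a), y(i := b)) \<partial>N01 \<partial>N01)" by simp
    qed
    also have "\<dots> = (\<integral>\<^sup>+p. g p \<partial>gaussian_pair)"
      by (rule two[symmetric]) measurable
    finally show ?thesis .
  qed
  have "pair_map (insert i A) R p = pair_map {i} R (pair_map A R p)" for p
    using insert.hyps by (auto simp: pair_map_def fun_eq_iff)
  then have "(\<integral>\<^sup>+p. f (pair_map (insert i A) R p) \<partial>gaussian_pair)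
      = (\<integral>\<^sup>+p. (\<lambda>p. f (pair_map {i} R p)) (pair_map A R p) \<partial>gaussian_pair)" by simp
  also have "\<dots> = (\<integral>\<^sup>+p. f (pair_map {i} R p) \<partial>gaussian_pair)"
    by (rule insert.IH) measurable
  also have "\<dots> = (\<integral>\<^sup>+p. f p \<partial>gaussian_pair)"
    by (rule step) measurable
  finally show ?case .
qed

section \<open>Exponential moments\<close>

lemma nn_integral_exp_N01: "(\<integral>\<^sup>+t. ennreal (exp (a * t)) \<partial>N01) = ennreal (exp (a^2 / 2))"
proof -
  have e: "std_normal_density t * exp (a * t) = exp (a^2 / 2) * normal_density a 1 t" for t
  proof -
    have "- (t^2) / 2 + a * t = a^2/2 + (- ((t - a)^2))/2"
      by (simp add: power2_eq_square field_simps)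
    then have "exp (- (t^2) / 2) * exp (a * t) = exp (a^2/2) * exp ((- ((t - a)^2))/2)"
      by (simp only: exp_add[symmetric])
    then show ?thesis by (simp add: normal_density_def)
  qed
  have "(\<integral>\<^sup>+t. ennreal (exp (a * t)) \<partial>N01) = (\<integral>\<^sup>+t. ennreal (std_normal_density t * exp (a * t)) \<partial>lborel)"
    by (subst nn_integral_N01) (auto simp: ennreal_mult)
  also have "\<dots> = (\<integral>\<^sup>+t. ennreal (exp (a^2 / 2)) * ennreal (normal_density a 1 t) \<partial>lborel)"
    by (simp add: e ennreal_mult)
  also have "\<dots> = ennreal (exp (a^2 / 2)) * (\<integral>\<^sup>+t. ennreal (normal_density a 1 t) \<partial>lborel)"
    by (rule nn_integral_cmult) auto
  also have "(\<integral>\<^sup>+t. ennreal (normal_density a 1 t) \<partial>lborel) = 1"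
    using prob_space.emeasure_space_1[OF prob_space_normal_density[of 1 a]]
    by (simp add: emeasure_density)
  finally show ?thesis by simp
qed

lemma nn_integral_exp_linear:
  assumes "finite A"
  shows "(\<integral>\<^sup>+x. ennreal (exp (\<Sum>i\<in>A. a i * x i)) \<partial>gaussian_seq) = ennreal (exp (\<Sum>i\<in>A. (a i)^2 / 2))"
  using assms
proof (induction A rule: finite_induct)
  case empty
  then show ?case using G.emeasure_space_1 by simp
next
  case (insert i A)
  have s: "(\<Sum>k\<in>A. a k * (x(i := t)) k) = (\<Sum>k\<in>A. a k * x k)" for x t
    using insert.hyps by (intro sum.cong) auto
  have "(\<integral>\<^sup>+x. ennreal (exp (\<Sum>i\<in>insert i A. a i * x i)) \<partial>gaussian_seq)
      = (\<integral>\<^sup>+x. \<integral>\<^sup>+t. ennreal (exp (\<Sum>k\<in>insert i A. a k * (x(i := t)) k)) \<partial>N01 \<partial>gaussian_seq)"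
    by (rule nn_integral_gaussian_seq_upd) measurable
  also have "\<dots> = (\<integral>\<^sup>+x. \<integral>\<^sup>+t. ennreal (exp (\<Sum>k\<in>A. a k * x k)) * ennreal (exp (a i * t)) \<partial>N01 \<partial>gaussian_seq)"
  proof -
    have "ennreal (exp (\<Sum>k\<in>insert i A. a k * (x(i := t)) k))
        = ennreal (exp (\<Sum>k\<in>A. a k * x k)) * ennreal (exp (a i * t))" for x t
    proof -
      have "(\<Sum>k\<in>insert i A. a k * (x(i := t)) k) = (\<Sum>k\<in>A. a k * x k) + a i * t"
        using insert.hyps s[of x t] by simp
      then show ?thesis by (simp only: exp_add ennreal_mult exp_ge_zero)
    qed
    then show ?thesis by (simp only:)
  qed
  also have "\<dots> = (\<integral>\<^sup>+x. ennreal (exp (\<Sum>k\<in>A. a k * x k)) * ennreal (exp ((a i)^2/2)) \<partial>gaussian_seq)"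
    by (subst nn_integral_cmult) (auto simp: nn_integral_exp_N01)
  also have "\<dots> = ennreal (exp (\<Sum>i\<in>A. (a i)^2 / 2)) * ennreal (exp ((a i)^2/2))"
    by (subst nn_integral_multc) (auto simp: insert.IH)
  finally show ?case
    using insert.hyps by (simp add: ennreal_mult[symmetric] exp_add[symmetric] add.commute)
qed

text \<open>Only finiteness matters. The bound grows with \<open>n\<close>, but in the rotation
  argument it is multiplied by a factor that can be made as small as desired by taking more
  steps.\<close>

lemma nn_integral_exp_abs_finite:
  "(\<integral>\<^sup>+x. ennreal (exp (\<Sum>i<n. \<bar>x i\<bar>)) \<partial>gaussian_seq) \<le> ennreal ((2 * exp (1/2)) ^ n)"
proof (induction n)
  case 0
  then show ?case using G.emeasure_space_1 by simp
next
  case (Suc n)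
  have 1: "(\<integral>\<^sup>+t. ennreal (exp \<bar>t\<bar>) \<partial>N01) \<le> ennreal (2 * exp (1/2))"
  proof -
    have "(\<integral>\<^sup>+t. ennreal (exp \<bar>t\<bar>) \<partial>N01) \<le> (\<integral>\<^sup>+t. ennreal (exp (1 * t)) + ennreal (exp (- 1 * t)) \<partial>N01)"
    proof (rule nn_integral_mono)
      fix t :: real
      have "exp \<bar>t\<bar> \<le> exp (1 * t) + exp (- 1 * t)" by (simp add: abs_if)
      then show "ennreal (exp \<bar>t\<bar>) \<le> ennreal (exp (1 * t)) + ennreal (exp (- 1 * t))"
        by (simp only: ennreal_plus[symmetric] exp_ge_zero ennreal_leI)
    qed
    also have "\<dots> = (\<integral>\<^sup>+t. ennreal (exp (1 * t)) \<partial>N01) + (\<integral>\<^sup>+t. ennreal (exp (- 1 * t)) \<partial>N01)"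
      by (rule nn_integral_add[of "\<lambda>t. ennreal (exp (1 * t))" N01 "\<lambda>t. ennreal (exp (- 1 * t))"]) simp_all
    also have "\<dots> = ennreal (exp (1^2/2)) + ennreal (exp ((- 1)^2/2))"
      by (simp only: nn_integral_exp_N01[of 1] nn_integral_exp_N01[of "- 1"])
    also have "\<dots> = ennreal (2 * exp (1/2))"
      using ennreal_plus[of "exp (1/2)" "exp (1/2)"] by simp
    finally show ?thesis .
  qed
  have "(\<integral>\<^sup>+x. ennreal (exp (\<Sum>i<Suc n. \<bar>x i\<bar>)) \<partial>gaussian_seq)
      = (\<integral>\<^sup>+x. \<integral>\<^sup>+t. ennreal (exp (\<Sum>k<Suc n. \<bar>(x(n := t)) k\<bar>)) \<partial>N01 \<partial>gaussian_seq)"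
    by (rule nn_integral_gaussian_seq_upd) measurable
  also have "\<dots> = (\<integral>\<^sup>+x. \<integral>\<^sup>+t. ennreal (exp (\<Sum>k<n. \<bar>x k\<bar>)) * ennreal (exp \<bar>t\<bar>) \<partial>N01 \<partial>gaussian_seq)"
    by (simp add: exp_add ennreal_mult)
  also have "\<dots> = (\<integral>\<^sup>+x. ennreal (exp (\<Sum>k<n. \<bar>x k\<bar>)) * (\<integral>\<^sup>+t. ennreal (exp \<bar>t\<bar>) \<partial>N01) \<partial>gaussian_seq)"
    by (subst nn_integral_cmult) auto
  also have "\<dots> = (\<integral>\<^sup>+x. ennreal (exp (\<Sum>k<n. \<bar>x k\<bar>)) \<partial>gaussian_seq) * (\<integral>\<^sup>+t. ennreal (exp \<bar>t\<bar>) \<partial>N01)"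
    by (rule nn_integral_multc) measurable
  also have "\<dots> \<le> ennreal ((2 * exp (1/2)) ^ n) * ennreal (2 * exp (1/2))"
    by (intro mult_mono Suc 1) auto
  finally show ?case by (simp add: ennreal_mult[symmetric] mult.commute)
qed

section \<open>Seminorms and supporting functionals\<close>

definition pad :: "nat \<Rightarrow> (nat \<Rightarrow> real) \<Rightarrow> (nat \<Rightarrow> real)" where
  "pad n x = (\<lambda>i. if i < n then x i else 0)"

text \<open>The last clause says that \<open>P\<close> reads only the first \<open>n\<close>
  coordinates, so that it can be evaluated at arbitrary sequences, in particular at samples of
  \<open>gaussian_seq\<close>.\<close>

definition seminorm :: "nat \<Rightarrow> ((nat \<Rightarrow> real) \<Rightarrow> real) \<Rightarrow> bool" where
  "seminorm n P \<longleftrightarrow> (\<forall>x y. P (x + y) \<le> P x + P y) \<and> (\<forall>c x. P (c *\<^sub>R x) = \<bar>c\<bar> * P x) \<and>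
     (\<forall>x. P (pad n x) = P x)"

lemma pad_in_Rn [simp]: "pad n x \<in> Rn n"
  by (simp add: pad_def Rn_def)

lemma pad_Rn: "x \<in> Rn n \<Longrightarrow> pad n x = x"
  by (auto simp: pad_def Rn_def fun_eq_iff)

lemma pad_add: "pad n (x + y) = pad n x + pad n y"
  and pad_scaleR: "pad n (c *\<^sub>R x) = c *\<^sub>R pad n x"
  and pad_pad [simp]: "pad n (pad n x) = pad n x"
  by (auto simp: pad_def fun_eq_iff)

context
  fixes n P assumes P: "seminorm n P"
begin

lemma seminorm_triangle: "P (x + y) \<le> P x + P y"
  and seminorm_scaleR: "P (c *\<^sub>R x) = \<bar>c\<bar> * P x"
  and seminorm_pad: "P (pad n x) = P x"
  using P by (auto simp: seminorm_def)

lemma seminorm_zero: "P 0 = 0"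
  using seminorm_scaleR[of 0 0] by simp

lemma seminorm_minus: "P (- x) = P x"
  using seminorm_scaleR[of "-1" x] by simp

lemma seminorm_nonneg: "0 \<le> P x"
  using seminorm_triangle[of x "- x"] seminorm_minus[of x] seminorm_zero by simp

lemma seminorm_diff: "P (x - y) \<le> P x + P y"
  using seminorm_triangle[of x "- y"] seminorm_minus[of y] by simp

lemma seminorm_abs_diff: "\<bar>P x - P y\<bar> \<le> P (x - y)"
  using seminorm_triangle[of "x - y" y] seminorm_triangle[of "y - x" x] seminorm_minus[of "x - y"]
  by (simp add: abs_le_iff)

lemma seminorm_sum: "P (\<Sum>i\<in>A. f i) \<le> (\<Sum>i\<in>A. P (f i))"
proof (induction A rule: infinite_finite_induct)
  case (insert a A)
  have "P (\<Sum>i\<in>insert a A. f i) \<le> P (f a) + P (sum f A)"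
    unfolding sum.insert[OF insert.hyps] by (rule seminorm_triangle)
  also have "\<dots> \<le> (\<Sum>i\<in>insert a A. P (f i))"
    using insert by simp
  finally show ?case .
qed (simp_all only: sum.infinite sum.empty seminorm_zero order_refl not_False_eq_True)

lemma seminorm_le_coords: "P x \<le> (\<Sum>i<n. \<bar>x i\<bar> * P (unit_vec i))"
proof -
  have "P x = P (\<Sum>i<n. pad n x i *\<^sub>R unit_vec i)"
    using Rn_expand[of "pad n x" n] seminorm_pad[of x] by simp
  also have "\<dots> \<le> (\<Sum>i<n. P (pad n x i *\<^sub>R unit_vec i))" by (rule seminorm_sum)
  also have "\<dots> = (\<Sum>i<n. \<bar>x i\<bar> * P (unit_vec i))"
    by (intro sum.cong) (auto simp: seminorm_scaleR pad_def)
  finally show ?thesis .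
qed

lemma continuous_seminorm: "continuous_on UNIV P"
  unfolding continuous_on_def
proof
  fix y :: "nat \<Rightarrow> real"
  let ?g = "\<lambda>x::nat \<Rightarrow> real. \<Sum>i<n. \<bar>x i - y i\<bar> * P (unit_vec i)"
  have "continuous_on UNIV ?g"
    by (intro continuous_intros continuous_on_product_coordinates)
  then have "(?g \<longlongrightarrow> ?g y) (at y within UNIV)" unfolding continuous_on_def by blast
  moreover have "?g y = 0" by simp
  ultimately have g: "(?g \<longlongrightarrow> 0) (at y within UNIV)" by (simp only:)
  have "\<bar>P x - P y\<bar> \<le> ?g x" for x
    using seminorm_abs_diff[of x y] seminorm_le_coords[of "x - y"] by simp
  then have "((\<lambda>x. P x - P y) \<longlongrightarrow> 0) (at y within UNIV)"
    by (intro Lim_null_comparison[OF _ g]) auto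
  then show "(P \<longlongrightarrow> P y) (at y within UNIV)" by (simp add: LIM_zero_iff)
qed

lemma measurable_seminorm: "P \<in> borel_measurable borel"
  by (rule borel_measurable_continuous_onI[OF continuous_seminorm])

end

section \<open>Hahn--Banach by finitely many reductions\<close>

definition sublinear :: "('a::real_vector \<Rightarrow> real) \<Rightarrow> bool" where
  "sublinear Q \<longleftrightarrow> (\<forall>x y. Q (x + y) \<le> Q x + Q y) \<and> (\<forall>c x. 0 \<le> c \<longrightarrow> Q (c *\<^sub>R x) = c * Q x)"

text \<open>The Hahn--Banach step: \<open>Q x = inf {P (x + t v) - t P v | t \<ge> 0}\<close> is linear along \<open>v\<close>.\<close>

lemma sublinear_reduce:
  fixes P :: "'a::real_vector \<Rightarrow> real"
  assumes P: "sublinear P"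
  shows "\<exists>Q. sublinear Q \<and> (\<forall>x. Q x \<le> P x) \<and> Q (- v) = - P v"
proof -
  have tri: "P (x + y) \<le> P x + P y" and hom: "0 \<le> c \<Longrightarrow> P (c *\<^sub>R x) = c * P x" for x y c
    using P by (auto simp: sublinear_def)
  have P0: "P 0 = 0" using hom[of 0 0] by simp
  define f where "f x t = P (x + t *\<^sub>R v) - t * P v" for x t
  define Q where "Q x = (INF t\<in>{0..}. f x t)" for x
  have lb: "- P (- x) \<le> f x t" if "0 \<le> t" for x t
    using tri[of "x + t *\<^sub>R v" "- x"] hom[OF that, of v] by (simp add: f_def)
  have bdd: "bdd_below (f x ` {0..})" for x
    by (rule bdd_belowI2[where m = "- P (- x)"]) (auto intro: lb)
  have Qle: "Q x \<le> f x t" if "0 \<le> t" for x t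
    unfolding Q_def by (rule cINF_lower[OF bdd]) (use that in auto)
  have Qge: "m \<le> Q x" if "\<And>t. 0 \<le> t \<Longrightarrow> m \<le> f x t" for m x
    unfolding Q_def by (rule cINF_greatest) (use that in auto)
  have QP: "Q x \<le> P x" for x using Qle[of 0 x] by (simp add: f_def)
  have Qlow: "- P (- x) \<le> Q x" for x by (rule Qge) (rule lb)
  have add: "Q (x + y) \<le> Q x + Q y" for x y
  proof -
    have "Q (x + y) \<le> f x s + f y t" if "0 \<le> s" "0 \<le> t" for s t
    proof -
      have "Q (x + y) \<le> f (x + y) (s + t)" using that by (intro Qle) auto
      also have "\<dots> \<le> f x s + f y t"
        using tri[of "x + s *\<^sub>R v" "y + t *\<^sub>R v"] by (simp add: f_def algebra_simps)
      finally show ?thesis .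
    qed
    then have "Q (x + y) - f x s \<le> Q y" if "0 \<le> s" for s
      using that by (intro Qge) (simp add: algebra_simps)
    then have "Q (x + y) - Q y \<le> Q x"
      by (intro Qge) (simp add: algebra_simps)
    then show ?thesis by simp
  qed
  have le: "Q (c *\<^sub>R x) \<le> c * Q x" if "0 < c" for c x
  proof -
    have "Q (c *\<^sub>R x) / c \<le> f x t" if "0 \<le> t" for t
    proof -
      have "Q (c *\<^sub>R x) \<le> f (c *\<^sub>R x) (c * t)" using \<open>0 < c\<close> that by (intro Qle) auto
      also have "\<dots> = c * f x t"
        using hom[of c "x + t *\<^sub>R v"] \<open>0 < c\<close> by (simp add: f_def algebra_simps)
      finally show ?thesis using \<open>0 < c\<close> by (simp add: divide_le_eq mult.commute)
    qed
    then have "Q (c *\<^sub>R x) / c \<le> Q x" by (rule Qge)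
    then show ?thesis using that by (simp add: divide_le_eq mult.commute)
  qed
  have "Q (c *\<^sub>R x) = c * Q x" if "0 \<le> c" for c x
  proof (cases "c = 0")
    case True
    have "Q 0 = 0" using QP[of 0] Qlow[of 0] P0 by simp
    then show ?thesis using True by simp
  next
    case False
    then have c: "0 < c" using that by simp
    have "Q x \<le> (1/c) * Q (c *\<^sub>R x)" using le[of "1/c" "c *\<^sub>R x"] c by simp
    then have "c * Q x \<le> Q (c *\<^sub>R x)" using c by (simp add: field_simps)
    then show ?thesis using le[OF c, of x] by simp
  qed
  with add have "sublinear Q" by (simp add: sublinear_def)
  moreover have "Q (- v) = - P v"
    using Qle[of 1 "- v"] Qlow[of "- v"] P0 by (simp add: f_def)
  ultimately show ?thesis using QP by blast
qed

lemma sublinear_opp: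
  assumes "sublinear Q" "Q (- v) \<le> - Q v"
  shows "Q (- v) = - Q v"
proof -
  have "Q (0 *\<^sub>R v) = 0 * Q v" using assms(1) unfolding sublinear_def by blast
  moreover have "Q (v + - v) \<le> Q v + Q (- v)" using assms(1) unfolding sublinear_def by blast
  ultimately show ?thesis using assms(2) by simp
qed

text \<open>Linearity along earlier vectors survives later reductions: these can only lower the
  values at \<open>w\<close> and \<open>- w\<close>, and the sum of the two values is nonnegative by
  subadditivity.\<close>

lemma sublinear_reduce_list:
  fixes P :: "'a::real_vector \<Rightarrow> real"
  assumes "sublinear P"
  shows "\<exists>Q. sublinear Q \<and> (\<forall>x. Q x \<le> P x) \<and> (\<forall>v\<in>set vs. Q (- v) = - Q v)"
proof (induction vs)
  case Nil
  then show ?case using assms by auto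
next
  case (Cons v vs)
  then obtain Q where Q: "sublinear Q" "\<And>x. Q x \<le> P x" "\<And>v. v \<in> set vs \<Longrightarrow> Q (- v) = - Q v" by blast
  obtain R where R: "sublinear R" "\<And>x. R x \<le> Q x" "R (- v) = - Q v"
    using sublinear_reduce[OF Q(1), of v] by blast
  have "R (- w) = - R w" if w: "w \<in> set (v # vs)" for w
  proof (rule sublinear_opp[OF R(1)])
    show "R (- w) \<le> - R w"
    proof (cases "w = v")
      case True
      then show ?thesis using R(2)[of v] R(3) by simp
    next
      case False
      then have "Q (- w) = - Q w" using w Q(3) by auto
      then show ?thesis using R(2)[of w] R(2)[of "- w"] by simp
    qed
  qed
  moreover have "R x \<le> P x" for x using R(2) Q(2) order_trans by blast
  ultimately show ?case using R(1) by blast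
qed

text \<open>The first reduction, along \<open>pad n x0\<close>, forces the value \<open>P x0\<close>
  at \<open>x0\<close>; the reductions along the unit vectors then make the functional linear on all
  of \<open>Rn n\<close>.\<close>

lemma seminorm_supporting_functional:
  assumes P: "seminorm n P"
  shows "\<exists>a. (\<forall>x. (\<Sum>i<n. a i * x i) \<le> P x) \<and> (\<Sum>i<n. a i * x0 i) = P x0"
proof -
  have sub: "sublinear P"
    using P by (auto simp: sublinear_def seminorm_def)
  obtain Q0 where Q0: "sublinear Q0" "\<And>x. Q0 x \<le> P x" "Q0 (- pad n x0) = - P (pad n x0)"
    using sublinear_reduce[OF sub, of "pad n x0"] by blast
  obtain Q where Q: "sublinear Q" "\<And>x. Q x \<le> Q0 x"
      and odd: "\<And>v. v \<in> set (map unit_vec [0..<n]) \<Longrightarrow> Q (- v) = - Q v"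
    using sublinear_reduce_list[OF Q0(1), of "map unit_vec [0..<n]"] by blast
  have tri: "Q (x + y) \<le> Q x + Q y" and hom: "0 \<le> c \<Longrightarrow> Q (c *\<^sub>R x) = c * Q x" for x y c
    using Q(1) by (auto simp: sublinear_def)
  have lin: "Q (\<Sum>i<k. x i *\<^sub>R unit_vec i) = (\<Sum>i<k. Q (unit_vec i) * x i)" if "k \<le> n" for k x
  proof -
    \<comment> \<open>An upper bound suffices: applied to \<open>- x\<close> it gives the lower
      bound, because the right-hand side is odd in the coefficients.\<close>
    have up: "Q (\<Sum>i<k. y i *\<^sub>R unit_vec i) \<le> (\<Sum>i<k. Q (unit_vec i) * y i)" for y
      using that
    proof (induction k)
      case 0
      have "Q 0 = 0" using hom[of 0 0] by simp
      then show ?case by (simp only: lessThan_0 sum.empty order_refl)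
    next
      case (Suc k)
      have "Q (y k *\<^sub>R unit_vec k) = y k * Q (unit_vec k)"
      proof (cases "0 \<le> y k")
        case False
        have "Q (y k *\<^sub>R unit_vec k) = Q ((- y k) *\<^sub>R (- unit_vec k))" by simp
        also have "\<dots> = (- y k) * Q (- unit_vec k)" using False by (intro hom) auto
        also have "Q (- unit_vec k) = - Q (unit_vec k)" using Suc.prems by (intro odd) auto
        finally show ?thesis by (simp only: minus_mult_minus)
      qed (rule hom)
      moreover have "Q (\<Sum>i<k. y i *\<^sub>R unit_vec i) \<le> (\<Sum>i<k. Q (unit_vec i) * y i)"
        by (rule Suc.IH) (use Suc.prems in simp)
      ultimately show ?case
        using tri[of "\<Sum>i<k. y i *\<^sub>R unit_vec i" "y k *\<^sub>R unit_vec k"]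
        unfolding sum.lessThan_Suc by (simp only: mult.commute[of "y k"])
    qed
    have "(\<Sum>i<k. - x i *\<^sub>R unit_vec i) = - (\<Sum>i<k. x i *\<^sub>R unit_vec i)"
      by (simp add: sum_negf)
    then have "Q (- (\<Sum>i<k. x i *\<^sub>R unit_vec i)) \<le> - (\<Sum>i<k. Q (unit_vec i) * x i)"
      using up[of "\<lambda>i. - x i"] by (simp add: sum_negf)
    then show ?thesis
      using up[of x] tri[of "\<Sum>i<k. x i *\<^sub>R unit_vec i" "- (\<Sum>i<k. x i *\<^sub>R unit_vec i)"] hom[of 0 0]
      by simp
  qed
  let ?a = "\<lambda>i. Q (unit_vec i)"
  have eq: "Q (pad n x) = (\<Sum>i<n. ?a i * x i)" for x
  proof -
    have "pad n x = (\<Sum>i<n. pad n x i *\<^sub>R unit_vec i)" by (rule Rn_expand[OF pad_in_Rn])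
    also have "\<dots> = (\<Sum>i<n. x i *\<^sub>R unit_vec i)" by (intro sum.cong) (auto simp: pad_def)
    finally show ?thesis by (simp only: lin[of n x, OF order_refl])
  qed
  have "Q (- pad n x0) = (\<Sum>i<n. ?a i * (- x0) i)"
    using eq[of "- x0"] pad_scaleR[of n "- 1" x0] by (simp only: scaleR_minus1_left)
  then have "- Q (pad n x0) \<le> - P (pad n x0)"
    using Q(2)[of "- pad n x0"] Q0(3) eq[of x0] by (simp add: sum_negf)
  moreover have le: "Q x \<le> P x" for x using Q(2) Q0(2) order_trans by blast
  ultimately have "Q (pad n x0) = P (pad n x0)" by (simp add: order_antisym)
  then have "(\<Sum>i<n. ?a i * x0 i) = P x0"
    using eq seminorm_pad[OF P] by simp
  moreover have "(\<Sum>i<n. ?a i * x i) \<le> P x" for x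
    using le[of "pad n x"] eq[of x] seminorm_pad[OF P] by simp
  ultimately show ?thesis by (intro exI[of _ ?a]) auto
qed

section \<open>Concentration\<close>

definition mix :: "nat set \<Rightarrow> (nat \<Rightarrow> real) \<Rightarrow> (nat \<Rightarrow> real) \<Rightarrow> (nat \<Rightarrow> real)" where
  "mix A x y = (\<lambda>i. if i \<in> A then y i else x i)"

abbreviation pair_rotate :: "nat set \<Rightarrow> real \<Rightarrow>
    (nat \<Rightarrow> real) \<times> (nat \<Rightarrow> real) \<Rightarrow> (nat \<Rightarrow> real) \<times> (nat \<Rightarrow> real)" where
  "pair_rotate A t \<equiv> pair_map A (rot2 (cos t) (sin t))"

lemma pres2_rotation: "pres2 (rot2 (cos t) (sin t))"
  by (rule pres2_rot2) simp

lemma rotate_add: "pair_rotate A s (pair_rotate A t p) = pair_rotate A (s + t) p"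
  by (auto simp: pair_map_def rot2_def fun_eq_iff cos_add sin_add algebra_simps)

lemma measurable_rotate [measurable]: "pair_rotate A t \<in> gaussian_pair \<rightarrow>\<^sub>M gaussian_pair"
  by (rule measurable_pair_map[OF pres2_rotation])

lemma measurable_fst_rotate [measurable]: "(\<lambda>p. fst (pair_rotate A t p)) \<in> gaussian_pair \<rightarrow>\<^sub>M borel"
  using measurable_compose[OF measurable_rotate measurable_fst]
  by (simp add: measurable_cong_sets[OF refl sets_gaussian_seq])

text \<open>For a seminorm this is the Euclidean Lipschitz condition along the coordinates in
  \<open>A\<close>.\<close>

definition coord_lipschitz :: "nat set \<Rightarrow> real \<Rightarrow> ((nat \<Rightarrow> real) \<Rightarrow> real) \<Rightarrow> bool" where
  "coord_lipschitz A L P \<longleftrightarrow> (\<forall>v. (\<forall>i. i \<notin> A \<longrightarrow> v i = 0) \<longrightarrow> P v \<le> L * sqrt (\<Sum>i\<in>A. (v i)^2))"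

text \<open>The functional is tested on its own coefficient vector restricted to
  \<open>A\<close>.\<close>

lemma functional_norm_le:
  assumes A: "A \<subseteq> {..<n}" and L: "0 \<le> L" and lip: "coord_lipschitz A L P"
    and a: "\<And>x. (\<Sum>i<n. a i * x i) \<le> P x"
  shows "(\<Sum>i\<in>A. (a i)^2) \<le> L^2"
proof -
  let ?S = "\<Sum>i\<in>A. (a i)^2"
  let ?v = "\<lambda>i. if i \<in> A then a i else 0"
  have S0: "0 \<le> ?S" by (simp add: sum_nonneg)
  have "?S = (\<Sum>i<n. a i * ?v i)"
    using A by (simp add: sum.If_cases if_distrib Int_absorb1 power2_eq_square cong: if_cong)
  also have "\<dots> \<le> P ?v" by (rule a)
  also have "P ?v \<le> L * sqrt (\<Sum>i\<in>A. (?v i)^2)"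
    by (rule lip[unfolded coord_lipschitz_def, rule_format]) simp
  also have "\<dots> = L * sqrt ?S" by simp
  finally have le: "?S \<le> L * sqrt ?S" .
  have "sqrt ?S \<le> L"
  proof (cases "?S = 0")
    case False
    then have "0 < sqrt ?S" using S0 by simp
    moreover have "sqrt ?S * sqrt ?S \<le> L * sqrt ?S" using le S0 by simp
    ultimately show ?thesis by (rule mult_right_le_imp_le[rotated])
  qed (use L in simp)
  then have "(sqrt ?S)^2 \<le> L^2" using S0 by (intro power_mono) auto
  then show ?thesis using S0 by simp
qed

text \<open>Convexity between 0 and \<open>S\<close>. It moves the small factor \<open>k\<close> out
  of the exponent, so that a moment bound for \<open>exp S\<close> with a very large constant is
  still good enough.\<close>

lemma exp_interpolate:
  fixes k S :: real
  assumes "0 \<le> k" "k \<le> 1"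
  shows "exp (k * S) \<le> 1 + k * exp S"
proof -
  have "exp ((1 - k) *\<^sub>R 0 + k *\<^sub>R S) \<le> (1 - k) * exp 0 + k * exp S"
    using assms by (intro convex_onD[OF exp_convex]) auto
  then show ?thesis using assms by simp
qed

lemma one_minus_cos_le: "1 - cos h \<le> h^2 / 2" for h :: real
proof -
  have "1 - cos h = 2 * (sin (h/2))^2"
    using cos_double_sin[of "h/2"] by simp
  also have "\<dots> \<le> 2 * (h/2)^2"
    using abs_sin_x_le_abs_x[of "h/2"] abs_le_square_iff[of "sin (h/2)" "h/2"] by simp
  finally show ?thesis by (simp add: power2_eq_square)
qed

context
  fixes n P assumes P: "seminorm n P"
begin

text \<open>A functional \<open>a\<close> supporting \<open>P\<close> at \<open>x\<close> bounds the
  increment by a function affine in \<open>y\<close>. As \<open>a\<close> depends on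
  \<open>x\<close> alone, the integral over \<open>y\<close> is a Gaussian exponential moment, with
  variance at most \<open>(sin h)^2 * L^2\<close>. The remaining term, with
  \<open>1 - cos h\<close>, is of second order in \<open>h\<close> and is bounded crudely by all
  coordinates of \<open>x\<close>.\<close>

lemma nn_integral_rotation_step:
  assumes A: "A \<subseteq> {..<n}" and L: "0 \<le> L" and lip: "coord_lipschitz A L P"
    and m: "0 \<le> \<mu>"
  shows "(\<integral>\<^sup>+y. ennreal (exp (\<mu> * (P x - P (fst (pair_rotate A h (x, y)))))) \<partial>gaussian_seq)
      \<le> ennreal (exp (\<mu> * (1 - cos h) * L * (\<Sum>i<n. \<bar>x i\<bar>))) * ennreal (exp (\<mu>^2 * (sin h)^2 * L^2 / 2))"
proof -
  have [measurable]: "P \<in> borel_measurable borel" by (rule measurable_seminorm[OF P])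
  have fin: "finite A" using A finite_subset by blast
  obtain a where a: "\<And>z. (\<Sum>i<n. a i * z i) \<le> P z" "(\<Sum>i<n. a i * x i) = P x"
    using seminorm_supporting_functional[OF P, of x] by blast
  have aL: "(\<Sum>i\<in>A. (a i)^2) \<le> L^2" by (rule functional_norm_le[OF A L lip a(1)])
  have ai: "\<bar>a i\<bar> \<le> L" if "i \<in> A" for i
  proof -
    have "(a i)^2 \<le> (\<Sum>i\<in>A. (a i)^2)" using fin that by (intro member_le_sum) auto
    then have "(a i)^2 \<le> L^2" using aL by simp
    then show ?thesis using L abs_le_square_iff[of "a i" L] by simp
  qed
  have "(\<Sum>i\<in>A. a i * x i) \<le> (\<Sum>i\<in>A. L * \<bar>x i\<bar>)"
  proof (rule sum_mono)
    fix i assume "i \<in> A"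
    have "a i * x i \<le> \<bar>a i\<bar> * \<bar>x i\<bar>" by (metis abs_ge_self abs_mult)
    also have "\<dots> \<le> L * \<bar>x i\<bar>" using ai[OF \<open>i \<in> A\<close>] by (intro mult_right_mono) auto
    finally show "a i * x i \<le> L * \<bar>x i\<bar>" .
  qed
  also have "\<dots> \<le> (\<Sum>i<n. L * \<bar>x i\<bar>)" using A L by (intro sum_mono2) auto
  finally have ax: "(\<Sum>i\<in>A. a i * x i) \<le> L * (\<Sum>i<n. \<bar>x i\<bar>)" by (simp add: sum_distrib_left)
  have diff: "P x - P (fst (pair_rotate A h (x, y))) \<le> (1 - cos h) * (\<Sum>i\<in>A. a i * x i) - sin h * (\<Sum>i\<in>A. a i * y i)"
    for y
  proof -
    let ?u = "fst (pair_rotate A h (x, y))"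
    have "P x - P ?u \<le> (\<Sum>i<n. a i * x i) - (\<Sum>i<n. a i * ?u i)"
      using a(1)[of ?u] a(2) by simp
    also have "\<dots> = (\<Sum>i<n. if i \<in> A then a i * ((1 - cos h) * x i - sin h * y i) else 0)"
      unfolding sum_subtractf[symmetric]
      by (intro sum.cong) (auto simp: pair_map_def rot2_def algebra_simps)
    also have "\<dots> = (\<Sum>i\<in>A. a i * ((1 - cos h) * x i - sin h * y i))"
      using A by (simp add: sum.If_cases Int_absorb1)
    also have "\<dots> = (1 - cos h) * (\<Sum>i\<in>A. a i * x i) - sin h * (\<Sum>i\<in>A. a i * y i)"
      by (simp add: algebra_simps sum_subtractf sum.distrib sum_distrib_left)
    finally show ?thesis .
  qed
  have "(\<integral>\<^sup>+y. ennreal (exp (\<mu> * (P x - P (fst (pair_rotate A h (x, y)))))) \<partial>gaussian_seq)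
      \<le> (\<integral>\<^sup>+y. ennreal (exp (\<mu> * (1 - cos h) * L * (\<Sum>i<n. \<bar>x i\<bar>))) *
              ennreal (exp (\<Sum>i\<in>A. (- \<mu> * sin h * a i) * y i)) \<partial>gaussian_seq)"
  proof (rule nn_integral_mono)
    fix y
    have "\<mu> * (P x - P (fst (pair_rotate A h (x, y))))
        \<le> \<mu> * ((1 - cos h) * (L * (\<Sum>i<n. \<bar>x i\<bar>)) - sin h * (\<Sum>i\<in>A. a i * y i))"
      using diff[of y] ax mult_left_mono[OF ax, of "1 - cos h"] by (intro mult_left_mono m) auto
    also have "\<dots> = \<mu> * (1 - cos h) * L * (\<Sum>i<n. \<bar>x i\<bar>) + (\<Sum>i\<in>A. (- \<mu> * sin h * a i) * y i)"
    proof -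
      have "(\<Sum>i\<in>A. (- \<mu> * sin h * a i) * y i) = - \<mu> * sin h * (\<Sum>i\<in>A. a i * y i)"
        by (simp add: sum_distrib_left mult.assoc sum_negf)
      then show ?thesis by (simp only:) (simp add: algebra_simps)
    qed
    finally have "exp (\<mu> * (P x - P (fst (pair_rotate A h (x, y)))))
        \<le> exp (\<mu> * (1 - cos h) * L * (\<Sum>i<n. \<bar>x i\<bar>)) * exp (\<Sum>i\<in>A. (- \<mu> * sin h * a i) * y i)"
      by (simp only: exp_add[symmetric] exp_le_cancel_iff)
    then show "ennreal (exp (\<mu> * (P x - P (fst (pair_rotate A h (x, y))))))
        \<le> ennreal (exp (\<mu> * (1 - cos h) * L * (\<Sum>i<n. \<bar>x i\<bar>))) *
              ennreal (exp (\<Sum>i\<in>A. (- \<mu> * sin h * a i) * y i))"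
      by (subst ennreal_mult[symmetric]) (auto intro: ennreal_leI)
  qed
  also have "\<dots> = ennreal (exp (\<mu> * (1 - cos h) * L * (\<Sum>i<n. \<bar>x i\<bar>))) *
      (\<integral>\<^sup>+y. ennreal (exp (\<Sum>i\<in>A. (- \<mu> * sin h * a i) * y i)) \<partial>gaussian_seq)"
    by (rule nn_integral_cmult) measurable
  also have "(\<integral>\<^sup>+y. ennreal (exp (\<Sum>i\<in>A. (- \<mu> * sin h * a i) * y i)) \<partial>gaussian_seq)
      = ennreal (exp (\<Sum>i\<in>A. (- \<mu> * sin h * a i)^2 / 2))"
    by (rule nn_integral_exp_linear[OF fin])
  also have "(\<Sum>i\<in>A. (- \<mu> * sin h * a i)^2 / 2) = \<mu>^2 * (sin h)^2 / 2 * (\<Sum>i\<in>A. (a i)^2)"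
    by (simp add: power_mult_distrib sum_distrib_left)
  also have "ennreal (exp (\<mu> * (1 - cos h) * L * (\<Sum>i<n. \<bar>x i\<bar>))) * ennreal (exp (\<mu>^2 * (sin h)^2 / 2 * (\<Sum>i\<in>A. (a i)^2)))
      \<le> ennreal (exp (\<mu> * (1 - cos h) * L * (\<Sum>i<n. \<bar>x i\<bar>))) * ennreal (exp (\<mu>^2 * (sin h)^2 * L^2 / 2))"
    using mult_left_mono[OF aL, of "\<mu>^2 * (sin h)^2 / 2"]
    by (intro mult_left_mono ennreal_leI) (auto simp: mult_ac)
  finally show ?thesis .
qed

text \<open>Maurey and Pisier's rotation argument, with the path from \<open>x\<close> to \<open>mix A x y\<close> cut into
  \<open>N\<close> steps of equal law and a supporting functional in place of the gradient.\<close>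

lemma nn_integral_exp_mix:
  assumes A: "A \<subseteq> {..<n}" and L: "0 \<le> L" and lip: "coord_lipschitz A L P" and l0: "0 \<le> l"
  shows "(\<integral>\<^sup>+p. ennreal (exp (l * (P (fst p) - P (mix A (fst p) (snd p))))) \<partial>gaussian_pair)
      \<le> ennreal (2 * exp (2 * l^2 * L^2))"
proof -
  have [measurable]: "P \<in> borel_measurable borel" by (rule measurable_seminorm[OF P])
  have fin: "finite A" using A finite_subset by blast
  define K where "K = (2 * exp (1/2) :: real) ^ n"
  have K: "1 \<le> K" unfolding K_def by (rule one_le_power) (use one_le_exp_iff[of "1/2"] in linarith)
  \<comment> \<open>The number of steps may depend on \<open>n\<close> through \<open>K\<close>,
    since the final estimate does not contain \<open>N\<close>.\<close>
  obtain N :: nat where N: "1 + 2 * l * L * K \<le> real N" using real_arch_simple by blast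
  have LK: "0 \<le> 2 * l * L * K" using l0 L K by simp
  then have N1: "1 \<le> real N" using N by linarith
  then have Npos: "0 < N" by simp
  define h where "h = pi / (2 * real N)"
  have Nh: "real N * h = pi / 2" using Npos by (simp add: h_def)
  have pi4: "pi < 4" by (rule pi_less_4)
  \<comment> \<open>By Jensen, the exponential of \<open>l\<close> times a sum of \<open>N\<close>
    increments is at most the average of the exponentials of \<open>\<mu>\<close> times each
    increment.\<close>
  define \<mu> where "\<mu> = l * real N"
  have m: "0 \<le> \<mu>" using l0 by (simp add: \<mu>_def)
  define U where "U j p = fst (pair_rotate A (real j * h) p)" for j p
  have U0: "U 0 p = fst p" for p by (auto simp: U_def pair_map_def rot2_def)
  have UN: "U N p = mix A (fst p) (snd p)" for p
    unfolding U_def Nh by (auto simp: pair_map_def rot2_def mix_def fun_eq_iff)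
  have [measurable]: "U j \<in> gaussian_pair \<rightarrow>\<^sub>M borel" for j
    unfolding U_def by measurable
  define F where "F p = ennreal (exp (\<mu> * (P (fst p) - P (fst (pair_rotate A h p)))))" for p
  have [measurable]: "F \<in> borel_measurable gaussian_pair"
    unfolding F_def by measurable
  have Fstep: "F (pair_rotate A (real j * h) p) = ennreal (exp (\<mu> * (P (U j p) - P (U (Suc j) p))))" for j p
  proof -
    have "pair_rotate A h (pair_rotate A (real j * h) p) = pair_rotate A (real (Suc j) * h) p"
      unfolding rotate_add by (simp add: algebra_simps)
    then show ?thesis by (simp add: F_def U_def)
  qed
  define \<kappa> where "\<kappa> = \<mu> * (1 - cos h) * L"
  have k0: "0 \<le> \<kappa>" using m L by (simp add: \<kappa>_def)
  \<comment> \<open>Here \<open>\<mu>\<close> is of order \<open>N\<close> and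
    \<open>1 - cos h\<close> of order \<open>1/N^2\<close>, so their product is of order
    \<open>1/N\<close> and absorbs the dimension-dependent \<open>K\<close>.\<close>
  have kK: "\<kappa> * K \<le> 1"
  proof -
    have "\<mu> * (1 - cos h) \<le> \<mu> * (h^2/2)" by (intro mult_left_mono one_minus_cos_le m)
    also have "\<dots> = l * pi^2 / (8 * real N)"
      using Npos by (simp add: \<mu>_def h_def power2_eq_square field_simps)
    also have "\<dots> \<le> l * 16 / (8 * real N)"
    proof -
      have "pi^2 \<le> 4^2" using pi4 by (intro power_mono) auto
      then show ?thesis using l0 Npos by (intro divide_right_mono mult_left_mono) auto
    qed
    finally have "\<mu> * (1 - cos h) * (L * K) \<le> (2 * l / real N) * (L * K)"
      using L K by (intro mult_right_mono) auto
    also have "\<dots> = 2 * l * L * K / real N" by simp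
    also have "\<dots> \<le> 1" using N Npos by (simp add: divide_le_eq)
    finally show ?thesis by (simp add: \<kappa>_def mult.assoc)
  qed
  have k1: "\<kappa> \<le> 1" using kK K k0 mult_left_mono[OF K k0] by simp
  \<comment> \<open>The main term stays bounded as \<open>N\<close> grows:
    \<open>\<mu> * h = l * pi / 2\<close>, independently of \<open>N\<close>.\<close>
  have sinb: "\<mu>^2 * (sin h)^2 * L^2 / 2 \<le> 2 * l^2 * L^2"
  proof -
    have "(sin h)^2 \<le> h^2" using abs_sin_x_le_abs_x[of h] abs_le_square_iff[of "sin h" h] by simp
    then have "\<mu>^2 * (sin h)^2 \<le> \<mu>^2 * h^2" by (intro mult_left_mono) auto
    also have "\<dots> = l^2 * (real N * h)^2" by (simp add: \<mu>_def power_mult_distrib)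
    also have "\<dots> \<le> l^2 * 2^2"
      unfolding Nh using pi4 by (intro mult_left_mono power_mono) auto
    finally have "\<mu>^2 * (sin h)^2 * L^2 \<le> (l^2 * 2^2) * L^2" by (intro mult_right_mono) auto
    then show ?thesis by simp
  qed
  have intF: "(\<integral>\<^sup>+p. F p \<partial>gaussian_pair) \<le> ennreal (2 * exp (2 * l^2 * L^2))"
  proof -
    let ?e = "ennreal (exp (2 * l^2 * L^2))"
    have "(\<integral>\<^sup>+p. F p \<partial>gaussian_pair) = (\<integral>\<^sup>+x. \<integral>\<^sup>+y. F (x, y) \<partial>gaussian_seq \<partial>gaussian_seq)"
      by (rule nn_integral_gaussian_pair) measurable
    also have "\<dots> \<le> (\<integral>\<^sup>+x. (1 + ennreal \<kappa> * ennreal (exp (\<Sum>i<n. \<bar>x i\<bar>))) * ?e \<partial>gaussian_seq)"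
    proof (rule nn_integral_mono)
      fix x :: "nat \<Rightarrow> real"
      have "(\<integral>\<^sup>+y. F (x, y) \<partial>gaussian_seq)
          \<le> ennreal (exp (\<kappa> * (\<Sum>i<n. \<bar>x i\<bar>))) * ennreal (exp (\<mu>^2 * (sin h)^2 * L^2 / 2))"
        unfolding F_def \<kappa>_def fst_conv by (rule nn_integral_rotation_step[OF A L lip m])
      also have "\<dots> \<le> (1 + ennreal \<kappa> * ennreal (exp (\<Sum>i<n. \<bar>x i\<bar>))) * ?e"
      proof (rule mult_mono)
        have "ennreal (exp (\<kappa> * (\<Sum>i<n. \<bar>x i\<bar>))) \<le> ennreal (1 + \<kappa> * exp (\<Sum>i<n. \<bar>x i\<bar>))"
          by (intro ennreal_leI exp_interpolate k0 k1)
        also have "\<dots> = 1 + ennreal \<kappa> * ennreal (exp (\<Sum>i<n. \<bar>x i\<bar>))"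
          using k0 by (simp add: ennreal_plus ennreal_mult)
        finally show "ennreal (exp (\<kappa> * (\<Sum>i<n. \<bar>x i\<bar>))) \<le> 1 + ennreal \<kappa> * ennreal (exp (\<Sum>i<n. \<bar>x i\<bar>))" .
      qed (use sinb in \<open>auto intro: ennreal_leI\<close>)
      finally show "(\<integral>\<^sup>+y. F (x, y) \<partial>gaussian_seq) \<le> (1 + ennreal \<kappa> * ennreal (exp (\<Sum>i<n. \<bar>x i\<bar>))) * ?e" .
    qed
    also have "\<dots> = (\<integral>\<^sup>+x. 1 + ennreal \<kappa> * ennreal (exp (\<Sum>i<n. \<bar>x i\<bar>)) \<partial>gaussian_seq) * ?e"
      by (rule nn_integral_multc) measurable
    also have "(\<integral>\<^sup>+x. 1 + ennreal \<kappa> * ennreal (exp (\<Sum>i<n. \<bar>x i\<bar>)) \<partial>gaussian_seq)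
        = (\<integral>\<^sup>+x. 1 \<partial>gaussian_seq) + (\<integral>\<^sup>+x. ennreal \<kappa> * ennreal (exp (\<Sum>i<n. \<bar>x i\<bar>)) \<partial>gaussian_seq)"
      by (rule nn_integral_add) measurable
    also have "(\<integral>\<^sup>+x. ennreal \<kappa> * ennreal (exp (\<Sum>i<n. \<bar>x i\<bar>)) \<partial>gaussian_seq)
        = ennreal \<kappa> * (\<integral>\<^sup>+x. ennreal (exp (\<Sum>i<n. \<bar>x i\<bar>)) \<partial>gaussian_seq)"
      by (rule nn_integral_cmult) measurable
    also have "((\<integral>\<^sup>+x. 1 \<partial>gaussian_seq) + ennreal \<kappa> * (\<integral>\<^sup>+x. ennreal (exp (\<Sum>i<n. \<bar>x i\<bar>)) \<partial>gaussian_seq)) * ?e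
        \<le> (1 + ennreal \<kappa> * ennreal K) * ?e"
      using nn_integral_exp_abs_finite[of n] G.emeasure_space_1
      unfolding K_def by (intro mult_right_mono add_mono mult_left_mono) auto
    also have "\<dots> = ennreal ((1 + \<kappa> * K) * exp (2 * l^2 * L^2))"
      using k0 K by (simp add: ennreal_mult[symmetric] ennreal_plus[symmetric] del: ennreal_plus ennreal_1 flip: ennreal_1)
    also have "\<dots> \<le> ennreal (2 * exp (2 * l^2 * L^2))"
      using kK by (intro ennreal_leI mult_right_mono) auto
    finally show ?thesis .
  qed
  have "(\<integral>\<^sup>+p. ennreal (exp (l * (P (fst p) - P (mix A (fst p) (snd p))))) \<partial>gaussian_pair)
      \<le> (\<integral>\<^sup>+p. ennreal (1 / real N) * (\<Sum>j<N. F (pair_rotate A (real j * h) p)) \<partial>gaussian_pair)"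
  proof (rule nn_integral_mono)
    fix p :: "(nat \<Rightarrow> real) \<times> (nat \<Rightarrow> real)"
    let ?d = "\<lambda>j. P (U j p) - P (U (Suc j) p)"
    have "P (fst p) - P (mix A (fst p) (snd p)) = (\<Sum>j<N. ?d j)"
      using sum_lessThan_telescope'[of "\<lambda>j. P (U j p)" N] by (simp add: U0 UN)
    then have "l * (P (fst p) - P (mix A (fst p) (snd p))) = (\<Sum>j<N. (1 / real N) *\<^sub>R (\<mu> * ?d j))"
      using Npos by (simp add: \<mu>_def sum_distrib_left)
    then have "exp (l * (P (fst p) - P (mix A (fst p) (snd p)))) = exp (\<Sum>j<N. (1 / real N) *\<^sub>R (\<mu> * ?d j))"
      by (simp only:)
    also have "\<dots> \<le> (\<Sum>j<N. (1 / real N) * exp (\<mu> * ?d j))"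
      using Npos by (intro convex_on_sum[OF _ _ exp_convex]) auto
    finally have "ennreal (exp (l * (P (fst p) - P (mix A (fst p) (snd p)))))
        \<le> ennreal (\<Sum>j<N. (1 / real N) * exp (\<mu> * ?d j))" by (rule ennreal_leI)
    also have "\<dots> = (\<Sum>j<N. ennreal ((1 / real N) * exp (\<mu> * ?d j)))"
      by (subst sum_ennreal) auto
    also have "\<dots> = ennreal (1 / real N) * (\<Sum>j<N. F (pair_rotate A (real j * h) p))"
      unfolding Fstep sum_distrib_left by (intro sum.cong refl ennreal_mult) auto
    finally show "ennreal (exp (l * (P (fst p) - P (mix A (fst p) (snd p)))))
        \<le> ennreal (1 / real N) * (\<Sum>j<N. F (pair_rotate A (real j * h) p))" .
  qed
  also have "\<dots> = ennreal (1 / real N) * (\<integral>\<^sup>+p. (\<Sum>j<N. F (pair_rotate A (real j * h) p)) \<partial>gaussian_pair)"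
    by (rule nn_integral_cmult) measurable
  also have "(\<integral>\<^sup>+p. (\<Sum>j<N. F (pair_rotate A (real j * h) p)) \<partial>gaussian_pair)
      = (\<Sum>j<N. \<integral>\<^sup>+p. F (pair_rotate A (real j * h) p) \<partial>gaussian_pair)"
    by (rule nn_integral_sum) measurable
  also have "\<dots> = (\<Sum>j<N. \<integral>\<^sup>+p. F p \<partial>gaussian_pair)"
    by (intro sum.cong refl nn_integral_pair_map pres2_rotation fin) measurable
  also have "\<dots> = of_nat N * (\<integral>\<^sup>+p. F p \<partial>gaussian_pair)" by simp
  also have "ennreal (1 / real N) * (of_nat N * (\<integral>\<^sup>+p. F p \<partial>gaussian_pair)) = (\<integral>\<^sup>+p. F p \<partial>gaussian_pair)"
  proof -
    have "ennreal (1 / real N) * of_nat N = ennreal (1 / real N * real N)"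
      by (simp add: ennreal_mult ennreal_of_nat_eq_real_of_nat del: times_divide_eq_left)
    then show ?thesis using Npos by (simp add: mult.assoc[symmetric])
  qed
  also note intF
  finally show ?thesis .
qed

end

lemma measure_pair_map:
  assumes R: "pres2 R" and A: "finite A" and [measurable]: "S \<in> sets gaussian_pair"
  shows "measure gaussian_pair {p. pair_map A R p \<in> S} = measure gaussian_pair S"
proof -
  have [measurable]: "pair_map A R \<in> gaussian_pair \<rightarrow>\<^sub>M gaussian_pair"
    by (rule measurable_pair_map[OF R])
  have S: "{p. pair_map A R p \<in> S} \<in> sets gaussian_pair"
    using measurable_sets[OF measurable_pair_map[OF R] assms(3), of A] space_gaussian_pair
    by (simp add: vimage_def)
  have "emeasure gaussian_pair {p. pair_map A R p \<in> S} = (\<integral>\<^sup>+p. indicator S (pair_map A R p) \<partial>gaussian_pair)"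
  proof -
    have "(\<integral>\<^sup>+p. indicator S (pair_map A R p) \<partial>gaussian_pair)
        = (\<integral>\<^sup>+p. indicator {p. pair_map A R p \<in> S} p \<partial>gaussian_pair)"
      by (intro nn_integral_cong) (simp add: indicator_def)
    then show ?thesis using S by (simp only: nn_integral_indicator)
  qed
  also have "\<dots> = (\<integral>\<^sup>+p. indicator S p \<partial>gaussian_pair)"
    by (rule nn_integral_pair_map[OF R A]) measurable
  also have "\<dots> = emeasure gaussian_pair S"
    by (rule nn_integral_indicator) (rule assms(3))
  finally show ?thesis by (simp add: measure_def)
qed

lemma measurable_mix [measurable]:
  assumes [measurable]: "f \<in> M \<rightarrow>\<^sub>M borel" "g \<in> M \<rightarrow>\<^sub>M borel"
  shows "(\<lambda>w. mix A (f w) (g w)) \<in> M \<rightarrow>\<^sub>M borel"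
  unfolding mix_def by (rule measurable_seq_lambda) measurable

lemma measurable_uminus_seq [measurable]:
  assumes [measurable]: "f \<in> M \<rightarrow>\<^sub>M borel"
  shows "(\<lambda>w. - f w :: nat \<Rightarrow> real) \<in> M \<rightarrow>\<^sub>M borel"
  by (rule measurable_seq_lambda) (simp only: uminus_apply, measurable)

lemma gaussian_pair_setI:
  "Measurable.pred gaussian_pair Q \<Longrightarrow> {p. Q p} \<in> sets gaussian_pair"
  by (simp add: pred_def space_gaussian_pair)

lemma gaussian_seq_setI:
  "Measurable.pred borel Q \<Longrightarrow> {x. Q x} \<in> sets gaussian_seq"
  by (simp add: pred_def)

lemma sin_ge_half:
  fixes x :: real
  assumes "0 \<le> x" "x \<le> pi / 2"
  shows "x / 2 \<le> sin x"
proof -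
  have "\<bar>sin x - (\<Sum>m<3. sin_coeff m * x ^ m)\<bar> \<le> inverse (fact 3) * \<bar>x\<bar> ^ 3"
    by (rule Maclaurin_sin_bound)
  then have "\<bar>sin x - x\<bar> \<le> x^3 / 6"
    using assms by (simp add: sin_coeff_def numeral_3_eq_3 fact_numeral)
  moreover have "x^3 / 6 \<le> x / 2"
  proof -
    have "pi \<le> 16/5" using pi_approx(2) by simp
    then have "x \<le> 8/5" using assms(2) by linarith
    then have "x * x \<le> (8/5) * (8/5)" using assms(1) by (intro mult_mono) auto
    then have "x * x * x \<le> 3 * x" using assms(1) by (intro mult_right_mono) auto
    then show ?thesis by (simp add: power3_eq_cube)
  qed
  ultimately show ?thesis by linarith
qed

section \<open>Deviation and small-ball estimates\<close>

context
  fixes n P assumes P: "seminorm n P"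
begin

lemma mix_tail:
  assumes A: "A \<subseteq> {..<n}" and L: "0 < L" and lip: "coord_lipschitz A L P" and r: "0 \<le> r"
  shows "measure gaussian_pair {p. r * L < P (fst p) - P (mix A (fst p) (snd p))} \<le> 2 * exp (- (r^2) / 8)"
    (is "measure _ ?S \<le> _")
proof -
  have [measurable]: "P \<in> borel_measurable borel" by (rule measurable_seminorm[OF P])
  \<comment> \<open>This is the minimizer of the Chernoff exponent
    \<open>- l * r * L + 2 * l^2 * L^2\<close>.\<close>
  define l where "l = r / (4 * L)"
  have l0: "0 \<le> l" using r L by (simp add: l_def)
  let ?d = "\<lambda>p. P (fst p) - P (mix A (fst p) (snd p))"
  let ?c = "exp (- l * r * L)"
  have S: "?S \<in> sets gaussian_pair" by (rule gaussian_pair_setI) measurable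
  have "emeasure gaussian_pair ?S = (\<integral>\<^sup>+p. indicator ?S p \<partial>gaussian_pair)"
    using S by simp
  also have "\<dots> \<le> (\<integral>\<^sup>+p. ennreal ?c * ennreal (exp (l * ?d p)) \<partial>gaussian_pair)"
  proof (rule nn_integral_mono)
    fix p
    show "indicator ?S p \<le> ennreal ?c * ennreal (exp (l * ?d p))"
    proof (cases "p \<in> ?S")
      case True
      then have "l * (r * L) \<le> l * ?d p" using l0 by (intro mult_left_mono) auto
      then have "1 \<le> exp (- l * r * L + l * ?d p)" by simp
      then have "1 \<le> ?c * exp (l * ?d p)" by (simp only: exp_add)
      then have "ennreal 1 \<le> ennreal (?c * exp (l * ?d p))" by (rule ennreal_leI)
      then show ?thesis using True by (simp add: ennreal_mult)
    qed simp
  qed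
  also have "\<dots> = ennreal ?c * (\<integral>\<^sup>+p. ennreal (exp (l * ?d p)) \<partial>gaussian_pair)"
    by (rule nn_integral_cmult) measurable
  also have "\<dots> \<le> ennreal ?c * ennreal (2 * exp (2 * l^2 * L^2))"
    by (intro mult_left_mono nn_integral_exp_mix[OF P A _ lip l0]) (use L in auto)
  also have "\<dots> = ennreal (2 * exp (- l * r * L + 2 * l^2 * L^2))"
    by (simp only: ennreal_mult[symmetric] exp_ge_zero exp_add) (simp add: mult_ac ennreal_mult[symmetric])
  also have "- l * r * L + 2 * l^2 * L^2 = - (r^2) / 8"
    using L by (simp add: l_def power2_eq_square field_simps)
  finally show ?thesis by (simp add: GG.emeasure_eq_measure)
qed

text \<open>The lower tail follows from the upper one by exchanging the two copies on
  \<open>A\<close>, and the statement for \<open>- snd p\<close> from the sign symmetry of the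
  second copy. Both signs are needed because the approximating norm is a maximum over
  \<open>z\<close> and \<open>- z\<close>.\<close>

lemma mix_deviation:
  assumes A: "A \<subseteq> {..<n}" and L: "0 < L" and lip: "coord_lipschitz A L P" and r: "0 \<le> r"
  shows "measure gaussian_pair {p. r * L < \<bar>P (fst p) - P (mix A (fst p) (snd p))\<bar>} \<le> 4 * exp (- (r^2) / 8)"
    and "measure gaussian_pair {p. r * L < \<bar>P (fst p) - P (mix A (fst p) (- snd p))\<bar>} \<le> 4 * exp (- (r^2) / 8)"
proof -
  have [measurable]: "P \<in> borel_measurable borel" by (rule measurable_seminorm[OF P])
  have fin: "finite A" using A finite_subset by blast
  let ?S = "{p. r * L < P (fst p) - P (mix A (fst p) (snd p))}"
  let ?T = "{p. r * L < P (mix A (fst p) (snd p)) - P (fst p)}"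
  let ?V = "{p. r * L < \<bar>P (fst p) - P (mix A (fst p) (snd p))\<bar>}"
  let ?W = "{p. r * L < \<bar>P (fst p) - P (mix A (fst p) (- snd p))\<bar>}"
  have S1: "?S \<in> sets gaussian_pair" by (rule gaussian_pair_setI) measurable
  have S2: "?T \<in> sets gaussian_pair" by (rule gaussian_pair_setI) measurable
  have S3: "?V \<in> sets gaussian_pair" by (rule gaussian_pair_setI) measurable
  note S = S1 S2 S3
  have "?T = {p. pair_map A (\<lambda>(a, b). (b, a)) p \<in> ?S}"
  proof -
    have "fst (pair_map A (\<lambda>(a, b). (b, a)) p) = mix A (fst p) (snd p)"
      "mix A (fst (pair_map A (\<lambda>(a, b). (b, a)) p)) (snd (pair_map A (\<lambda>(a, b). (b, a)) p)) = fst p" for p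
      by (auto simp: pair_map_def mix_def fun_eq_iff)
    then show ?thesis by auto
  qed
  then have T: "measure gaussian_pair ?T = measure gaussian_pair ?S"
    using measure_pair_map[OF pres2_swap fin S(1)] by simp
  have "?V \<subseteq> ?S \<union> ?T" by auto
  then have "measure gaussian_pair ?V \<le> measure gaussian_pair (?S \<union> ?T)"
    using S by (intro GG.finite_measure_mono) auto
  also have "\<dots> \<le> measure gaussian_pair ?S + measure gaussian_pair ?T"
    by (rule measure_Un_le[OF S1 S2])
  finally show V: "measure gaussian_pair ?V \<le> 4 * exp (- (r^2) / 8)"
    using T mix_tail[OF A L lip r] by simp
  have "?W = {p. pair_map A (\<lambda>(a, b). (a, - b)) p \<in> ?V}"
  proof -
    have "fst (pair_map A (\<lambda>(a, b). (a, - b)) p) = fst p"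
      "mix A (fst p) (snd (pair_map A (\<lambda>(a, b). (a, - b)) p)) = mix A (fst p) (- snd p)" for p
      by (auto simp: pair_map_def mix_def fun_eq_iff)
    then show ?thesis by auto
  qed
  then show "measure gaussian_pair ?W \<le> 4 * exp (- (r^2) / 8)"
    using measure_pair_map[OF pres2_neg fin S(3)] V by simp
qed

text \<open>Among \<open>N\<close> equally spaced directions in the plane of two independent copies, at most one can be
  short while the orthogonal direction is long.\<close>

lemma small_ball:
  assumes M: "0 < M" and t: "0 \<le> t" "4 * t * real N < 3"
  shows "real N * (measure gaussian_seq {x. P x \<le> t * M} * measure gaussian_seq {x. M \<le> P x}) \<le> 1"
proof -
  have [measurable]: "P \<in> borel_measurable borel" by (rule measurable_seminorm[OF P])
  let ?A = "{..<n}"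
  let ?X = "{x. P x \<le> t * M}" and ?Y = "{x. M \<le> P x}"
  let ?S = "?X \<times> ?Y"
  have X: "?X \<in> sets gaussian_seq" by (rule gaussian_seq_setI) measurable
  have Y: "?Y \<in> sets gaussian_seq" by (rule gaussian_seq_setI) measurable
  note XY = X Y
  have S: "?S \<in> sets gaussian_pair" using XY by auto
  define a where "a j = real j * (pi / real N)" for j
  define E where "E j = {p. pair_rotate ?A (a j) p \<in> ?S}" for j
  have Es: "E j \<in> sets gaussian_pair" for j
    using measurable_sets[OF measurable_rotate S, of ?A "a j"]
    unfolding E_def by (simp add: vimage_def space_gaussian_pair)
  have mE: "measure gaussian_pair (E j) = measure gaussian_seq ?X * measure gaussian_seq ?Y" for j
  proof -
    have "measure gaussian_pair (E j) = measure gaussian_pair ?S"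
      unfolding E_def by (rule measure_pair_map[OF pres2_rotation _ S]) simp
    also have "\<dots> = measure gaussian_seq ?X * measure gaussian_seq ?Y"
      using G.emeasure_pair_measure_Times[OF XY]
      by (simp add: measure_def enn2real_mult)
    finally show ?thesis .
  qed
  \<comment> \<open>If the events occurred at two angles with difference \<open>b\<close>, then
    \<open>cos b *\<^sub>R u + sin b *\<^sub>R v\<close> would be short along with \<open>u\<close>,
    while \<open>v\<close> is long; this gives \<open>\<bar>sin b\<bar> \<le> 2 * t\<close>. But
    \<open>b\<close> has distance at least \<open>pi/N\<close> from 0 and from \<open>pi\<close>, so
    \<open>sin b\<close> is at least \<open>pi/(2N)\<close>, contradicting
    \<open>4 * t * N < 3\<close>.\<close>
  have disj: "E j \<inter> E k = {}" if jk: "j < k" "k < N" for j k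
  proof (rule ccontr)
    assume "E j \<inter> E k \<noteq> {}"
    then obtain p where p: "p \<in> E j" "p \<in> E k" by blast
    define u v w where "u = fst (pair_rotate ?A (a j) p)" and "v = snd (pair_rotate ?A (a j) p)"
      and "w = fst (pair_rotate ?A (a k) p)"
    define b where "b = a k - a j"
    have Pu: "P u \<le> t * M" and Pv: "M \<le> P v" and Pw: "P w \<le> t * M"
      using p by (auto simp: E_def u_def v_def w_def mem_Times_iff)
    have w: "w = fst (pair_rotate ?A b (u, v))"
      using rotate_add[of ?A b "a j" p] by (simp add: w_def u_def v_def b_def)
    have "pad n w = pad n (cos b *\<^sub>R u + sin b *\<^sub>R v)"
      unfolding w by (auto simp: pad_def pair_map_def rot2_def fun_eq_iff)
    then have "P (pad n w) = P (pad n (cos b *\<^sub>R u + sin b *\<^sub>R v))" by (rule arg_cong)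
    then have Pw': "P w = P (cos b *\<^sub>R u + sin b *\<^sub>R v)"
      by (simp only: seminorm_pad[OF P])
    have "sin b *\<^sub>R v = (cos b *\<^sub>R u + sin b *\<^sub>R v) - cos b *\<^sub>R u" by (rule add_diff_cancel_left'[symmetric])
    then have "P (sin b *\<^sub>R v) \<le> P w + P (cos b *\<^sub>R u)"
      using seminorm_diff[OF P, of "cos b *\<^sub>R u + sin b *\<^sub>R v" "cos b *\<^sub>R u"] Pw' by (simp only:)
    then have 1: "\<bar>sin b\<bar> * P v \<le> t * M + \<bar>cos b\<bar> * P u"
      using Pw by (simp only: seminorm_scaleR[OF P])
    have "\<bar>cos b\<bar> * P u \<le> 1 * (t * M)"
      using Pu t M by (intro mult_mono) (auto simp: seminorm_nonneg[OF P])
    moreover have "\<bar>sin b\<bar> * M \<le> \<bar>sin b\<bar> * P v" using Pv by (intro mult_left_mono) auto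
    ultimately have "\<bar>sin b\<bar> * M \<le> (2 * t) * M" using 1 by simp
    then have s2t: "\<bar>sin b\<bar> \<le> 2 * t" using M by simp
    have N: "0 < real N" using jk by simp
    have b: "b = real (k - j) * (pi / real N)"
      using jk by (simp add: b_def a_def of_nat_diff algebra_simps)
    have b1: "pi / real N \<le> b"
      using jk N mult_right_mono[of 1 "real (k - j)" "pi / real N"] by (simp add: b)
    have "real (k - j) + 1 \<le> real N" using jk by linarith
    then have "(real (k - j) + 1) * (pi / real N) \<le> real N * (pi / real N)"
      using N by (intro mult_right_mono) auto
    then have b2: "b + pi / real N \<le> pi" using N by (simp add: b algebra_simps)
    have piN: "0 < pi / real N" using N by simp
    have "pi / real N / 2 \<le> sin b"
    proof (cases "b \<le> pi / 2")
      case True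
      have "b / 2 \<le> sin b" using True b1 piN by (intro sin_ge_half) linarith+
      moreover have "pi / real N / 2 \<le> b / 2" using b1 by (intro divide_right_mono) auto
      ultimately show ?thesis by (rule order_trans[rotated])
    next
      case False
      then have "(pi - b) / 2 \<le> sin (pi - b)" using b2 piN by (intro sin_ge_half) auto
      moreover have "pi / real N / 2 \<le> (pi - b) / 2" using b2 by (intro divide_right_mono) auto
      ultimately have "pi / real N / 2 \<le> sin (pi - b)" by (rule order_trans[rotated])
      then show ?thesis by simp
    qed
    then have "pi / real N / 2 \<le> 2 * t" using s2t by linarith
    then have "pi \<le> 4 * t * real N" using N by (simp add: field_simps)
    then show False using t pi_gt3 by linarith
  qed
  have "disjoint_family_on E {..<N}"
    unfolding disjoint_family_on_def
  proof (intro ballI impI)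
    fix j k assume "j \<in> {..<N}" "k \<in> {..<N}" "j \<noteq> k"
    then show "E j \<inter> E k = {}"
      using disj[of j k] disj[of k j] by (cases "j < k") auto
  qed
  then have "measure gaussian_pair (\<Union>j\<in>{..<N}. E j) = (\<Sum>j<N. measure gaussian_pair (E j))"
    using Es by (intro GG.finite_measure_finite_Union) auto
  then have "(\<Sum>j<N. measure gaussian_pair (E j)) \<le> 1"
    using GG.prob_le_1[of "\<Union>j\<in>{..<N}. E j"] by (simp only:)
  then show ?thesis by (simp add: mE)
qed

end

section \<open>Normal tails and slabs\<close>

definition normal_tail :: "real \<Rightarrow> real" where
  "normal_tail s = measure N01 {s<..}"

text \<open>The density on an interval of length one is at least its value at the right end, and
  \<open>sqrt (2 * pi) \<le> 3\<close>.\<close>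

lemma normal_tail_ge:
  assumes s: "0 \<le> s"
  shows "exp (- ((s + 1)^2) / 2) / 3 \<le> normal_tail s"
proof -
  let ?d = "std_normal_density (s + 1)"
  have "sqrt (2 * pi) \<le> sqrt 9" using pi_less_4 by (intro real_sqrt_le_mono) auto
  then have "sqrt (2 * pi) \<le> 3" using real_sqrt_abs[of 3] by simp
  then have "exp (- ((s + 1)^2) / 2) * (1 / 3) \<le> exp (- ((s + 1)^2) / 2) * (1 / sqrt (2 * pi))"
    by (intro mult_left_mono frac_le) auto
  then have 1: "exp (- ((s + 1)^2) / 2) / 3 \<le> ?d" by (simp add: std_normal_density_def)
  have "ennreal ?d = ennreal ?d * emeasure lborel {s<..s+1}" by simp
  also have "\<dots> = (\<integral>\<^sup>+x. ennreal ?d * indicator {s<..s+1} x \<partial>lborel)"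
    by (rule nn_integral_cmult_indicator[symmetric]) simp
  also have "\<dots> \<le> (\<integral>\<^sup>+x. ennreal (std_normal_density x) * indicator {s<..} x \<partial>lborel)"
  proof (rule nn_integral_mono)
    fix x
    show "ennreal ?d * indicator {s<..s+1} x \<le> ennreal (std_normal_density x) * indicator {s<..} x"
    proof (cases "x \<in> {s<..s+1}")
      case True
      then have "x^2 \<le> (s + 1)^2" using s by (intro power_mono) auto
      then have "?d \<le> std_normal_density x"
        by (auto simp: std_normal_density_def intro!: mult_left_mono divide_right_mono)
      then show ?thesis using True by (auto intro: ennreal_leI)
    qed simp
  qed
  also have "\<dots> = emeasure N01 {s<..}" by (subst emeasure_density) auto
  finally have "?d \<le> normal_tail s"
    by (simp add: N01.emeasure_eq_measure normal_tail_def)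
  then show ?thesis using 1 by linarith
qed

lemma N01_reflect: "measure N01 {-s..} = measure N01 {..s}"
proof -
  have "emeasure N01 {-s..} = (\<integral>\<^sup>+a. \<integral>\<^sup>+b. indicator {-s..} (snd (a, b)) \<partial>N01 \<partial>N01)"
    using N01.emeasure_space_1 by simp
  also have "\<dots> = (\<integral>\<^sup>+a. \<integral>\<^sup>+b. indicator {-s..} (snd ((\<lambda>(a, b). (a, - b)) (a, b))) \<partial>N01 \<partial>N01)"
  proof -
    have inv: "(\<integral>\<^sup>+a. \<integral>\<^sup>+b. f ((\<lambda>(a, b). (a, - b)) (a, b)) \<partial>N01 \<partial>N01) = (\<integral>\<^sup>+a. \<integral>\<^sup>+b. f (a, b) \<partial>N01 \<partial>N01)"
      if "f \<in> borel_measurable (borel \<Otimes>\<^sub>M borel)" for f :: "real \<times> real \<Rightarrow> ennreal"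
      using pres2_neg that unfolding pres2_def by blast
    show ?thesis by (rule inv[symmetric]) measurable
  qed
  also have "\<dots> = (\<integral>\<^sup>+a. \<integral>\<^sup>+b. indicator {..s} b \<partial>N01 \<partial>N01)"
    by (intro nn_integral_cong) (auto simp: indicator_def)
  also have "\<dots> = emeasure N01 {..s}"
    using N01.emeasure_space_1 by simp
  finally show ?thesis by (simp add: measure_def)
qed

text \<open>The bound has to be uniform in the shift \<open>b\<close>, which depends on the other
  coordinates. According to the sign of \<open>b\<close> the slab lies in one of two half-lines of
  equal measure.\<close>

lemma N01_slab_le:
  assumes s: "0 \<le> s" and d: "0 < \<delta>" "\<delta> \<le> d"
  shows "emeasure N01 {t. \<bar>b + d * t\<bar> \<le> s} \<le> ennreal (1 - normal_tail (s / \<delta>))"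
proof -
  let ?c = "s / \<delta>"
  have le: "s / d \<le> ?c" using s d by (intro divide_left_mono) auto
  have "measure N01 {t. \<bar>b + d * t\<bar> \<le> s} \<le> measure N01 {..?c}"
  proof (cases "0 \<le> b")
    case True
    have "{t. \<bar>b + d * t\<bar> \<le> s} \<subseteq> {..?c}"
    proof
      fix t assume "t \<in> {t. \<bar>b + d * t\<bar> \<le> s}"
      then have "t * d \<le> s" using True by (simp add: mult.commute)
      then have "t \<le> s / d" using d by (simp add: pos_le_divide_eq)
      then show "t \<in> {..?c}" using le by simp
    qed
    then show ?thesis by (intro N01.finite_measure_mono) auto
  next
    case False
    have "{t. \<bar>b + d * t\<bar> \<le> s} \<subseteq> {- ?c..}"
    proof
      fix t assume "t \<in> {t. \<bar>b + d * t\<bar> \<le> s}"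
      then have "(- t) * d \<le> s" using False by (simp add: mult.commute)
      then have "- t \<le> s / d" using d by (simp only: pos_le_divide_eq)
      then show "t \<in> {- ?c..}" using le by simp
    qed
    then have "measure N01 {t. \<bar>b + d * t\<bar> \<le> s} \<le> measure N01 {- ?c..}"
      by (intro N01.finite_measure_mono) auto
    then show ?thesis by (simp add: N01_reflect)
  qed
  also have "measure N01 {..?c} = 1 - normal_tail ?c"
  proof -
    have "UNIV - {..?c} = {?c<..}" by auto
    then show ?thesis using N01.prob_compl[of "{..?c}"] by (simp add: normal_tail_def)
  qed
  finally show ?thesis by (simp add: N01.emeasure_eq_measure ennreal_leI)
qed

text \<open>Conditioning on the earlier coordinates, each slab condition has probability at most that
  of a one-sided event for a single Gaussian.\<close>

lemma triangular_slabs: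
  assumes s: "0 \<le> s" and d: "0 < \<delta>" and jm: "j + m \<le> n"
    and tri: "\<And>k i. k \<in> {j..<j+m} \<Longrightarrow> k < i \<Longrightarrow> a k i = 0"
    and diag: "\<And>k. k \<in> {j..<j+m} \<Longrightarrow> \<delta> \<le> a k k"
  shows "measure gaussian_seq {x. \<forall>k\<in>{j..<j+m}. \<bar>\<Sum>i<n. a k i * x i\<bar> \<le> s} \<le> (1 - normal_tail (s / \<delta>)) ^ m"
  using jm tri diag
proof (induction m)
  case 0
  then show ?case by simp
next
  case (Suc m)
  define S where "S m = {x. \<forall>k\<in>{j..<j+m}. \<bar>\<Sum>i<n. a k i * x i\<bar> \<le> s}" for m
  let ?q = "1 - normal_tail (s / \<delta>)"
  have q0: "0 \<le> ?q" by (simp add: normal_tail_def)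
  let ?k = "j + m"
  have k: "?k \<in> {j..<j + Suc m}" "?k < n" using Suc.prems(1) by auto
  have sets: "S m \<in> sets borel" for m
    unfolding S_def using gaussian_seq_setI[of "\<lambda>x. \<forall>k\<in>{j..<j+m}. \<bar>\<Sum>i<n. a k i * x i\<bar> \<le> s"] by simp
  have IH: "measure gaussian_seq (S m) \<le> ?q ^ m"
    unfolding S_def using Suc.prems by (intro Suc.IH) auto
  define b where "b x = (\<Sum>i\<in>{..<n} - {?k}. a ?k i * x i)" for x :: "nat \<Rightarrow> real"
  \<comment> \<open>By triangularity the earlier functionals ignore coordinate \<open>j + m\<close>,
    so refreshing it affects only the last slab, whose shift \<open>b x\<close> is then a constant
    for the inner integral.\<close>
  have upd: "x(?k := t) \<in> S (Suc m) \<longleftrightarrow> x \<in> S m \<and> \<bar>b x + a ?k ?k * t\<bar> \<le> s" for x t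
  proof -
    have "(\<Sum>i<n. a i' i * (x(?k := t)) i) = (\<Sum>i<n. a i' i * x i)" if "i' \<in> {j..<j+m}" for i'
      using that Suc.prems(2)[of i' ?k] by (intro sum.cong) auto
    moreover have "(\<Sum>i<n. a ?k i * (x(?k := t)) i) = b x + a ?k ?k * t"
    proof -
      have "(\<Sum>i<n. a ?k i * (x(?k := t)) i)
          = a ?k ?k * (x(?k := t)) ?k + (\<Sum>i\<in>{..<n} - {?k}. a ?k i * (x(?k := t)) i)"
        using k by (intro sum.remove) auto
      also have "(\<Sum>i\<in>{..<n} - {?k}. a ?k i * (x(?k := t)) i) = b x"
        unfolding b_def by (intro sum.cong) auto
      finally show ?thesis by simp
    qed
    moreover have "{j..<j + Suc m} = insert ?k {j..<j+m}" by auto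
    ultimately show ?thesis by (auto simp: S_def simp del: fun_upd_apply)
  qed
  have [measurable]: "S m \<in> sets borel" "S (Suc m) \<in> sets borel" by (rule sets)+
  have "emeasure gaussian_seq (S (Suc m)) = (\<integral>\<^sup>+x. indicator (S (Suc m)) x \<partial>gaussian_seq)"
    by (simp add: sets)
  also have "\<dots> = (\<integral>\<^sup>+x. \<integral>\<^sup>+t. indicator (S (Suc m)) (x(?k := t)) \<partial>N01 \<partial>gaussian_seq)"
    by (rule nn_integral_gaussian_seq_upd) measurable
  also have "\<dots> \<le> (\<integral>\<^sup>+x. indicator (S m) x * ennreal ?q \<partial>gaussian_seq)"
  proof (rule nn_integral_mono)
    fix x
    have "(\<integral>\<^sup>+t. indicator (S (Suc m)) (x(?k := t)) \<partial>N01)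
        = (\<integral>\<^sup>+t. indicator (S m) x * indicator {t. \<bar>b x + a ?k ?k * t\<bar> \<le> s} t \<partial>N01)"
      by (intro nn_integral_cong) (simp add: indicator_def upd del: fun_upd_apply)
    also have "\<dots> = indicator (S m) x * emeasure N01 {t. \<bar>b x + a ?k ?k * t\<bar> \<le> s}"
      by (rule nn_integral_cmult_indicator) simp
    also have "\<dots> \<le> indicator (S m) x * ennreal ?q"
      using Suc.prems(3)[OF k(1)] by (intro mult_left_mono N01_slab_le s d) auto
    finally show "(\<integral>\<^sup>+t. indicator (S (Suc m)) (x(?k := t)) \<partial>N01) \<le> indicator (S m) x * ennreal ?q" .
  qed
  also have "\<dots> = emeasure gaussian_seq (S m) * ennreal ?q"
    by (subst nn_integral_multc) (auto simp: sets)
  also have "\<dots> \<le> ennreal (?q ^ m) * ennreal ?q"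
    using IH by (intro mult_right_mono) (auto simp: G.emeasure_eq_measure intro: ennreal_leI)
  also have "\<dots> = ennreal (?q ^ Suc m)"
    using q0 by (simp add: ennreal_mult[symmetric] mult.commute)
  finally show ?case
    using q0 by (simp add: G.emeasure_eq_measure S_def)
qed

section \<open>Choosing the directions\<close>

text \<open>An orthogonal change of coordinates \<open>T\<close> together with its inverse, which is
  also its transpose. Invariance of the law is a clause of the definition because all instances
  arise by composing planar rotations, under which it is inherited.\<close>

definition gauss_iso :: "nat \<Rightarrow> ((nat \<Rightarrow> real) \<Rightarrow> (nat \<Rightarrow> real)) \<Rightarrow> ((nat \<Rightarrow> real) \<Rightarrow> (nat \<Rightarrow> real)) \<Rightarrow> bool" where
  "gauss_iso n T S \<longleftrightarrow> linear T \<and> linear S \<and> (\<forall>x. T (S x) = x) \<and> (\<forall>x. S (T x) = x) \<and>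
     (\<forall>x y. dot n (T x) y = dot n x (S y)) \<and>
     (\<forall>x. pad n (T x) = T (pad n x)) \<and> (\<forall>x. pad n (S x) = S (pad n x)) \<and>
     T \<in> borel \<rightarrow>\<^sub>M borel \<and> S \<in> borel \<rightarrow>\<^sub>M borel \<and>
     (\<forall>f::(nat \<Rightarrow> real) \<Rightarrow> ennreal. f \<in> borel_measurable borel \<longrightarrow>
       (\<integral>\<^sup>+x. f (T x) \<partial>gaussian_seq) = (\<integral>\<^sup>+x. f x \<partial>gaussian_seq)) \<and>
     (\<forall>f::(nat \<Rightarrow> real) \<Rightarrow> ennreal. f \<in> borel_measurable borel \<longrightarrow>
       (\<integral>\<^sup>+x. f (S x) \<partial>gaussian_seq) = (\<integral>\<^sup>+x. f x \<partial>gaussian_seq))"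

lemma gauss_isoD:
  assumes "gauss_iso n T S"
  shows "linear T" "linear S" "T (S x) = x" "S (T x) = x" "dot n (T x) y = dot n x (S y)"
    "pad n (T x) = T (pad n x)" "pad n (S x) = S (pad n x)" "T \<in> borel \<rightarrow>\<^sub>M borel" "S \<in> borel \<rightarrow>\<^sub>M borel"
    "f \<in> borel_measurable borel \<Longrightarrow> (\<integral>\<^sup>+x. f (T x) \<partial>gaussian_seq) = (\<integral>\<^sup>+x. f x \<partial>gaussian_seq)"
    "f \<in> borel_measurable borel \<Longrightarrow> (\<integral>\<^sup>+x. f (S x) \<partial>gaussian_seq) = (\<integral>\<^sup>+x. f x \<partial>gaussian_seq)"
  using assms unfolding gauss_iso_def by blast+

lemma gauss_isoI:
  assumes "linear T" "linear S" "\<And>x. T (S x) = x" "\<And>x. S (T x) = x" "\<And>x y. dot n (T x) y = dot n x (S y)"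
    "\<And>x. pad n (T x) = T (pad n x)" "\<And>x. pad n (S x) = S (pad n x)" "T \<in> borel \<rightarrow>\<^sub>M borel" "S \<in> borel \<rightarrow>\<^sub>M borel"
    "\<And>f. f \<in> borel_measurable borel \<Longrightarrow> (\<integral>\<^sup>+x. f (T x) \<partial>gaussian_seq) = (\<integral>\<^sup>+x. f x \<partial>gaussian_seq)"
    "\<And>f. f \<in> borel_measurable borel \<Longrightarrow> (\<integral>\<^sup>+x. f (S x) \<partial>gaussian_seq) = (\<integral>\<^sup>+x. f x \<partial>gaussian_seq)"
  shows "gauss_iso n T S"
  unfolding gauss_iso_def by (intro conjI allI impI assms)

lemma gauss_iso_sym:
  assumes "gauss_iso n T S"
  shows "gauss_iso n S T"
proof (rule gauss_isoI)
  show "dot n (S x) y = dot n x (T y)" for x y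
    using gauss_isoD(5)[OF assms, of y x] by (simp add: dot_commute)
qed (use gauss_isoD[OF assms] in auto)

lemma gauss_iso_id: "gauss_iso n id id"
  by (rule gauss_isoI) (auto simp: linear_id)

lemma gauss_iso_comp:
  assumes 1: "gauss_iso n T S" and 2: "gauss_iso n T' S'"
  shows "gauss_iso n (T \<circ> T') (S' \<circ> S)"
proof (rule gauss_isoI)
  fix f :: "(nat \<Rightarrow> real) \<Rightarrow> ennreal" assume f: "f \<in> borel_measurable borel"
  have "(\<lambda>x. f (T x)) \<in> borel_measurable borel"
    by (rule measurable_compose[OF gauss_isoD(8)[OF 1] f])
  then show "(\<integral>\<^sup>+x. f ((T \<circ> T') x) \<partial>gaussian_seq) = (\<integral>\<^sup>+x. f x \<partial>gaussian_seq)"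
    using gauss_isoD(10)[OF 2, of "\<lambda>x. f (T x)"] gauss_isoD(10)[OF 1 f] by simp
  have "(\<lambda>x. f (S' x)) \<in> borel_measurable borel"
    by (rule measurable_compose[OF gauss_isoD(9)[OF 2] f])
  then show "(\<integral>\<^sup>+x. f ((S' \<circ> S) x) \<partial>gaussian_seq) = (\<integral>\<^sup>+x. f x \<partial>gaussian_seq)"
    using gauss_isoD(11)[OF 1, of "\<lambda>x. f (S' x)"] gauss_isoD(11)[OF 2 f] by simp
qed (use gauss_isoD[OF 1] gauss_isoD[OF 2] in
    \<open>auto intro!: linear_compose measurable_comp[of _ borel borel]\<close>)

lemma linear_upd2_rot2: "linear (upd2 i j (rot2 c s))"
  by (rule linearI) (auto simp: upd2_def rot2_def fun_eq_iff algebra_simps)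

lemma gauss_iso_givens:
  assumes ij: "i \<noteq> j" "i < n" "j < n" and cs: "c^2 + s^2 = 1"
  shows "gauss_iso n (upd2 i j (rot2 c s)) (upd2 i j (rot2 c (- s)))"
proof -
  have cs': "c^2 + (- s)^2 = 1" using cs by simp
  have cc: "c * (c * a) + s * (s * a) = a" for a
  proof -
    have "c * (c * a) + s * (s * a) = (c^2 + s^2) * a" by (simp add: power2_eq_square algebra_simps)
    then show ?thesis using cs by simp
  qed
  have inv: "upd2 i j (rot2 c s) (upd2 i j (rot2 c (- s)) x) = x" 
    and inv': "upd2 i j (rot2 c (- s)) (upd2 i j (rot2 c s) x) = x" for x
    using ij(1) cc[of "x i"] cc[of "x j"] by (auto simp: upd2_def rot2_def fun_eq_iff algebra_simps)
  have dot: "dot n (upd2 i j (rot2 c s) x) y = dot n x (upd2 i j (rot2 c (- s)) y)" for x y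
  proof -
    have split: "dot n u v = u i * v i + u j * v j + (\<Sum>k\<in>{..<n} - {i} - {j}. u k * v k)" for u v
      unfolding dot_def using ij by (subst sum.remove[of _ i], simp, simp, subst sum.remove[of _ j]) auto
    have "(\<Sum>k\<in>{..<n} - {i} - {j}. upd2 i j (rot2 c s) x k * y k)
        = (\<Sum>k\<in>{..<n} - {i} - {j}. x k * upd2 i j (rot2 c (- s)) y k)"
      by (intro sum.cong) (auto simp: upd2_def)
    then show ?thesis
      unfolding split using ij(1) by (simp add: upd2_def rot2_def algebra_simps)
  qed
  have pad: "pad n (upd2 i j R x) = upd2 i j R (pad n x)" for R x
    using ij by (auto simp: pad_def upd2_def fun_eq_iff)
  show ?thesis
    by (rule gauss_isoI) (fact linear_upd2_rot2 inv inv' dot pad measurable_upd2[OF pres2_rot2[OF cs]]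
      measurable_upd2[OF pres2_rot2[OF cs']] nn_integral_upd2[OF pres2_rot2[OF cs] _ ij(1)]
      nn_integral_upd2[OF pres2_rot2[OF cs'] _ ij(1)])+
qed

text \<open>Planar rotations in the planes \<open>(m, l)\<close> for increasing \<open>l > m\<close>
  collect everything of \<open>y\<close> beyond coordinate \<open>m\<close> in that coordinate. They
  leave the coordinates below \<open>m\<close> alone, which keeps the functionals chosen before
  intact.\<close>

lemma givens_elimination:
  assumes "m < n"
  shows "\<exists>T S. gauss_iso n T S \<and> (\<forall>x. \<forall>k<m. T x k = x k \<and> S x k = x k) \<and> (\<forall>j. m < j \<longrightarrow> j < n \<longrightarrow> T y j = 0)"
proof -
  have "\<exists>T S. gauss_iso n T S \<and> (\<forall>x. \<forall>k<m. T x k = x k \<and> S x k = x k) \<and> (\<forall>j. m < j \<longrightarrow> j < l \<longrightarrow> T y j = 0)"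
    if "l \<le> n" for l
    using that
  proof (induction l)
    case 0
    then show ?case by (intro exI[of _ id] conjI gauss_iso_id) auto
  next
    case (Suc l)
    then obtain T S where TS0: "gauss_iso n T S \<and> (\<forall>x. \<forall>k<m. T x k = x k \<and> S x k = x k) \<and>
        (\<forall>j. m < j \<longrightarrow> j < l \<longrightarrow> T y j = 0)"
      using Suc_leD[OF Suc.prems] by blast
    then have TS: "gauss_iso n T S" "\<And>x k. k < m \<Longrightarrow> T x k = x k" "\<And>x k. k < m \<Longrightarrow> S x k = x k"
      "\<And>j. m < j \<Longrightarrow> j < l \<Longrightarrow> T y j = 0"
      by auto
    show ?case
    proof (cases "l \<le> m")
      case True
      have "T y j = 0" if "m < j" "j < Suc l" for j using that True by simp
      then show ?thesis using TS by blast
    next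
      case False
      define a b where "a = T y m" and "b = T y l"
      define r where "r = sqrt (a^2 + b^2)"
      \<comment> \<open>The unit vector along \<open>(a, b)\<close>; when both entries vanish
        already, the identity.\<close>
      obtain c s where cs: "c^2 + s^2 = 1" "c * b - s * a = 0"
      proof (cases "a^2 + b^2 = 0")
        case True
        then have "a = 0" "b = 0" by (auto simp: sum_power2_eq_zero_iff)
        then show ?thesis using that[of 1 0] by simp
      next
        case False
        then have r: "r^2 = a^2 + b^2" "r \<noteq> 0" by (auto simp: r_def)
        have "(a/r)^2 + (b/r)^2 = (a^2 + b^2) / r^2" by (simp add: power_divide add_divide_distrib)
        also have "\<dots> = 1" unfolding r(1)[symmetric] using r(2) by simp
        finally show ?thesis using that[of "a/r" "b/r"] by simp
      qed
      let ?G = "upd2 m l (rot2 c s)" and ?H = "upd2 m l (rot2 c (- s))"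
      have iso: "gauss_iso n (?G \<circ> T) (S \<circ> ?H)"
        using False Suc.prems assms cs(1) by (intro gauss_iso_comp gauss_iso_givens TS(1)) auto
      have fixed: "(?G \<circ> T) x k = x k" "(S \<circ> ?H) x k = x k" if "k < m" for x k
        using that False TS(2,3) by (auto simp: upd2_def)
      have "(?G \<circ> T) y j = 0" if "m < j" "j < Suc l" for j
      proof (cases "j = l")
        case True
        then show ?thesis using cs(2) by (simp add: upd2_def rot2_def a_def b_def)
      next
        case False
        then show ?thesis using that TS(4)[of j] by (simp add: upd2_def)
      qed
      then show ?thesis using iso fixed by blast
    qed
  qed
  then show ?thesis by blast
qed

lemma seminorm_comp_gauss_iso:
  assumes "seminorm n P" "gauss_iso n T S"
  shows "seminorm n (\<lambda>x. P (T x))"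
proof -
  have "linear T" "\<And>x. T (pad n x) = pad n (T x)" using gauss_isoD[OF assms(2)] by simp_all
  then show ?thesis
    using assms(1) by (simp add: seminorm_def linear_add linear_scale)
qed

text \<open>In the coordinates given by \<open>T\<close> the directions chosen so far are the first
  \<open>m\<close> axes, and the supporting functionals are the rows of a lower triangular
  matrix.\<close>

definition greedy :: "nat \<Rightarrow> ((nat \<Rightarrow> real) \<Rightarrow> real) \<Rightarrow> real \<Rightarrow> nat \<Rightarrow>
    ((nat \<Rightarrow> real) \<Rightarrow> (nat \<Rightarrow> real)) \<Rightarrow> ((nat \<Rightarrow> real) \<Rightarrow> (nat \<Rightarrow> real)) \<Rightarrow> (nat \<Rightarrow> nat \<Rightarrow> real) \<Rightarrow> bool" where
  "greedy n P \<delta> m T S a \<longleftrightarrow> gauss_iso n T S \<and>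
     (\<forall>k<m. (\<forall>i>k. a k i = 0) \<and> \<delta> \<le> \<bar>a k k\<bar> \<and> (\<forall>x. dot n (a k) x \<le> P (T x)))"

text \<open>The vector \<open>v\<close> violating the Lipschitz bound lies in the orthogonal
  complement of the chosen directions. By Cauchy--Schwarz a functional supporting the norm at
  \<open>v\<close> has a component longer than \<open>\<delta>\<close> there, and a rotation of the
  complement puts this component on axis \<open>m\<close>.\<close>

lemma greedy_step:
  assumes P: "seminorm n P" and d: "0 < \<delta>" and g: "greedy n P \<delta> m T S a" and mn: "m < n"
    and nl: "\<not> coord_lipschitz {m..<n} \<delta> (\<lambda>x. P (T x))"
  shows "\<exists>T S a. greedy n P \<delta> (Suc m) T S a"
proof -
  have iso: "gauss_iso n T S" using g by (simp add: greedy_def)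
  let ?I = "{m..<n}"
  obtain v where v: "\<And>i. i \<notin> ?I \<Longrightarrow> v i = 0" and big: "\<delta> * sqrt (\<Sum>i\<in>?I. (v i)^2) < P (T v)"
    using nl unfolding coord_lipschitz_def by (auto simp: not_le)
  obtain y0 where y0: "\<And>x. (\<Sum>i<n. y0 i * x i) \<le> P (T x)" "(\<Sum>i<n. y0 i * v i) = P (T v)"
    using seminorm_supporting_functional[OF seminorm_comp_gauss_iso[OF P iso], of v] by blast
  define y where "y = pad n y0"
  have yd: "dot n y x = (\<Sum>i<n. y0 i * x i)" for x
    unfolding dot_def by (intro sum.cong) (auto simp: y_def pad_def)
  obtain G H where GH0: "gauss_iso n G H \<and> (\<forall>x. \<forall>k<m. G x k = x k \<and> H x k = x k) \<and>
      (\<forall>j. m < j \<longrightarrow> j < n \<longrightarrow> G y j = 0)"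
    using givens_elimination[OF mn, of y] by blast
  then have GH: "gauss_iso n G H" "\<And>x k. k < m \<Longrightarrow> G x k = x k" "\<And>x k. k < m \<Longrightarrow> H x k = x k"
    "\<And>j. m < j \<Longrightarrow> j < n \<Longrightarrow> G y j = 0"
    by auto
  have Gy0: "G y i = 0" if "m < i" for i
  proof (cases "i < n")
    case False
    have "pad n (G y) = G y" using gauss_isoD(6)[OF GH(1), of y] by (simp add: y_def)
    then have "G y i = pad n (G y) i" by simp
    then show ?thesis using False by (simp add: pad_def)
  qed (use GH(4) that in auto)
  \<comment> \<open>\<open>G\<close> preserves the Euclidean norm of \<open>y\<close> and its first
    \<open>m\<close> coordinates, hence the norm of the rest, which afterwards consists of the
    single entry \<open>G y m\<close>.\<close>
  have "\<delta>^2 \<le> (G y m)^2"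
  proof -
    have split: "dot n u u = (\<Sum>i<m. (u i)^2) + (\<Sum>i\<in>?I. (u i)^2)" for u
      unfolding dot_def using mn
      by (simp add: power2_eq_square lessThan_atLeast0 sum.atLeastLessThan_concat[of 0 m n "\<lambda>i. u i * u i", symmetric] del: sum.op_ivl_Suc)
    have "dot n (G y) (G y) = dot n y y" by (simp only: gauss_isoD(4,5)[OF GH(1)])
    moreover have "(\<Sum>i<m. (G y i)^2) = (\<Sum>i<m. (y i)^2)" using GH(2) by simp
    moreover have "(\<Sum>i\<in>?I. (G y i)^2) = (G y m)^2"
    proof -
      have "(\<Sum>i\<in>?I. (G y i)^2) = (\<Sum>i\<in>{m}. (G y i)^2)"
        using mn Gy0 by (intro sum.mono_neutral_right) auto
      then show ?thesis by simp
    qed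
    ultimately have eq: "(G y m)^2 = (\<Sum>i\<in>?I. (y i)^2)" unfolding split by linarith
    have "P (T v) = (\<Sum>i<n. y i * v i)" using yd[of v] y0(2) by (simp add: dot_def)
    also have "\<dots> = (\<Sum>i\<in>?I. y i * v i)"
      using v by (intro sum.mono_neutral_right) auto
    finally have Pv: "P (T v) = (\<Sum>i\<in>?I. y i * v i)" .
    have pos: "0 \<le> \<delta> * sqrt (\<Sum>i\<in>?I. (v i)^2)" using d by (simp add: sum_nonneg)
    have "\<delta>^2 * (\<Sum>i\<in>?I. (v i)^2) = (\<delta> * sqrt (\<Sum>i\<in>?I. (v i)^2))^2"
      by (simp add: power_mult_distrib sum_nonneg)
    also have "\<dots> < (P (T v))^2" using big pos by (intro power_strict_mono) auto
    also have "\<dots> \<le> (\<Sum>i\<in>?I. (y i)^2) * (\<Sum>i\<in>?I. (v i)^2)"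
      unfolding Pv by (rule Cauchy_Schwarz_ineq_sum)
    finally have "\<delta>^2 * (\<Sum>i\<in>?I. (v i)^2) < (\<Sum>i\<in>?I. (y i)^2) * (\<Sum>i\<in>?I. (v i)^2)" .
    then have "\<delta>^2 < (\<Sum>i\<in>?I. (y i)^2)"
      by (rule mult_right_less_imp_less) (simp add: sum_nonneg)
    then show ?thesis using eq by simp
  qed
  then have diag: "\<delta> \<le> \<bar>G y m\<bar>" using d abs_le_square_iff[of \<delta> "G y m"] by simp
  define a' where "a' k = (if k = m then G y else a k)" for k
  have "greedy n P \<delta> (Suc m) (T \<circ> H) (G \<circ> S) a'"
    unfolding greedy_def
  proof (intro conjI allI impI)
    show "gauss_iso n (T \<circ> H) (G \<circ> S)"
      by (rule gauss_iso_comp[OF iso gauss_iso_sym[OF GH(1)]])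
    fix k assume k: "k < Suc m"
    show "a' k i = 0" if "k < i" for i
      using k that Gy0 g by (auto simp: a'_def greedy_def less_Suc_eq)
    show "\<delta> \<le> \<bar>a' k k\<bar>"
      using k diag g by (auto simp: a'_def greedy_def less_Suc_eq)
    show "dot n (a' k) x \<le> P ((T \<circ> H) x)" for x
    proof (cases "k = m")
      case True
      have "dot n (G y) x = dot n y (H x)" by (rule gauss_isoD(5)[OF GH(1)])
      also have "\<dots> \<le> P (T (H x))" unfolding yd by (rule y0(1))
      finally show ?thesis using True by (simp add: a'_def)
    next
      case False
      then have km: "k < m" using k by simp
      \<comment> \<open>An earlier row involves only coordinates up to \<open>k < m\<close>, and
        \<open>H\<close> fixes those.\<close>
      have eqi: "a k i * x i = a k i * H x i" for i
        using g km GH(3)[of i x] by (cases "k < i") (auto simp: greedy_def)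
      have "dot n (a k) x = dot n (a k) (H x)"
        unfolding dot_def by (rule sum.cong) (rule refl, rule eqi)
      also have "\<dots> \<le> P (T (H x))" using g km by (simp add: greedy_def)
      finally show ?thesis using False by (simp add: a'_def)
    qed
  qed
  then show ?thesis by blast
qed

text \<open>A maximal \<open>m\<close> cannot be extended, so \<open>greedy_step\<close> yields the
  Lipschitz bound; at \<open>m = n\<close> only the zero vector remains. Existence alone uses
  \<open>m \<le> n\<close>; the bound free of \<open>n\<close> is
  \<open>greedy_length\<close>.\<close>

lemma greedy_exists:
  assumes P: "seminorm n P" and d: "0 < \<delta>"
  obtains m T S a where "m \<le> n" "greedy n P \<delta> m T S a" "coord_lipschitz {m..<n} \<delta> (\<lambda>x. P (T x))"
proof -
  define Z where "Z = {m. m \<le> n \<and> (\<exists>T S a. greedy n P \<delta> m T S a)}"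
  have "finite Z" by (rule finite_subset[of _ "{..n}"]) (auto simp: Z_def)
  moreover have "0 \<in> Z" using gauss_iso_id by (auto simp: Z_def greedy_def)
  ultimately have M: "Max Z \<in> Z" "\<And>m. m \<in> Z \<Longrightarrow> m \<le> Max Z"
    using Max_in[of Z] Max_ge[of Z] by blast+
  define m where "m = Max Z"
  obtain T S a where g: "m \<le> n" "greedy n P \<delta> m T S a" using M(1) by (auto simp: Z_def m_def)
  have "coord_lipschitz {m..<n} \<delta> (\<lambda>x. P (T x))"
  proof (cases "m = n")
    case True
    have "P (T v) \<le> 0" if "\<forall>i. v i = 0" for v
    proof -
      have "v = 0" using that by (simp add: fun_eq_iff)
      moreover have "linear T" using g gauss_isoD(1) unfolding greedy_def by blast
      ultimately have "T v = 0" using linear_0 by blast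
      then show ?thesis using seminorm_zero[OF P] by simp
    qed
    then show ?thesis using True by (simp add: coord_lipschitz_def)
  next
    case False
    show ?thesis
    proof (rule ccontr)
      assume "\<not> coord_lipschitz {m..<n} \<delta> (\<lambda>x. P (T x))"
      then have "\<exists>T S a. greedy n P \<delta> (Suc m) T S a"
        using greedy_step[OF P d g(2)] False g(1) by simp
      then have "Suc m \<in> Z" using False g(1) by (simp add: Z_def)
      then show False using M(2)[of "Suc m"] by (simp add: m_def)
    qed
  qed
  then show ?thesis using that g by blast
qed

section \<open>The approximating norm\<close>

definition restr :: "nat set \<Rightarrow> (nat \<Rightarrow> real) \<Rightarrow> (nat \<Rightarrow> real)" where
  "restr A x = (\<lambda>i. if i \<in> A then x i else 0)"

lemma measurable_restr [measurable]:
  assumes [measurable]: "f \<in> M \<rightarrow>\<^sub>M borel"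
  shows "(\<lambda>w. restr A (f w)) \<in> M \<rightarrow>\<^sub>M borel"
  unfolding restr_def by (rule measurable_seq_lambda) measurable

definition l2_on :: "nat set \<Rightarrow> (nat \<Rightarrow> real) \<Rightarrow> real" where
  "l2_on F x = sqrt (\<Sum>i\<in>F. (x i)^2)"

lemma l2_on_nonneg: "0 \<le> l2_on F x"
  by (simp add: l2_on_def sum_nonneg)

lemma seminorm_l2_on:
  assumes "F \<subseteq> {..<n}"
  shows "seminorm n (l2_on F)"
  unfolding seminorm_def
proof (intro conjI allI)
  show "l2_on F (x + y) \<le> l2_on F x + l2_on F y" for x y
    using L2_set_triangle_ineq[of x y F] by (simp add: l2_on_def L2_set_def)
  show "l2_on F (c *\<^sub>R x) = \<bar>c\<bar> * l2_on F x" for c x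
    by (simp add: l2_on_def power_mult_distrib sum_distrib_left[symmetric] real_sqrt_mult)
  show "l2_on F (pad n x) = l2_on F x" for x
  proof -
    have "(\<Sum>i\<in>F. (pad n x i)^2) = (\<Sum>i\<in>F. (x i)^2)"
      using assms by (intro sum.cong) (auto simp: pad_def)
    then show ?thesis by (simp add: l2_on_def)
  qed
qed

text \<open>The factor \<open>l2_on F x / c\<close> restores homogeneity. The maximum over both signs of \<open>z\<close> makes the
  result even, and monotone in that factor, which the triangle inequality needs.\<close>

definition frozen_norm :: "((nat \<Rightarrow> real) \<Rightarrow> real) \<Rightarrow> nat \<Rightarrow> nat set \<Rightarrow> (nat \<Rightarrow> real) \<Rightarrow> real \<Rightarrow> (nat \<Rightarrow> real) \<Rightarrow> real" where
  "frozen_norm P m F z c x = max (P (restr {..<m} x + (l2_on F x / c) *\<^sub>R z))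
     (P (restr {..<m} x - (l2_on F x / c) *\<^sub>R z))"

context
  fixes n P assumes P: "seminorm n P"
begin

text \<open>Convexity of \<open>P\<close> on the segment between the two end points. In the triangle
  inequality it compensates for the factor of \<open>x + y\<close> being merely at most the sum of
  the two factors.\<close>

lemma seminorm_between:
  assumes "\<bar>\<sigma>\<bar> \<le> \<tau>"
  shows "P (u + \<sigma> *\<^sub>R z) \<le> max (P (u + \<tau> *\<^sub>R z)) (P (u - \<tau> *\<^sub>R z))"
proof (cases "\<tau> = 0")
  case True
  then have "\<sigma> = 0" using assms by simp
  then show ?thesis using True by simp
next
  case False
  then have t: "0 < \<tau>" using assms by linarith
  define \<alpha> where "\<alpha> = (\<sigma> + \<tau>) / (2 * \<tau>)"
  have a: "0 \<le> \<alpha>" "\<alpha> \<le> 1" using assms t by (auto simp: \<alpha>_def field_simps)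
  have "\<alpha> * \<tau> - (1 - \<alpha>) * \<tau> = \<sigma>" using t by (simp add: \<alpha>_def field_simps)
  then have conv: "u i + \<sigma> * z i = \<alpha> * (u i + \<tau> * z i) + (1 - \<alpha>) * (u i - \<tau> * z i)" for i
  proof -
    have "\<alpha> * (u i + \<tau> * z i) + (1 - \<alpha>) * (u i - \<tau> * z i) = u i + (\<alpha> * \<tau> - (1 - \<alpha>) * \<tau>) * z i"
      by (simp add: algebra_simps)
    then show ?thesis using \<open>\<alpha> * \<tau> - (1 - \<alpha>) * \<tau> = \<sigma>\<close> by (simp only:)
  qed
  then have "u + \<sigma> *\<^sub>R z = \<alpha> *\<^sub>R (u + \<tau> *\<^sub>R z) + (1 - \<alpha>) *\<^sub>R (u - \<tau> *\<^sub>R z)"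
    by (simp add: fun_eq_iff)
  then have "P (u + \<sigma> *\<^sub>R z) = P (\<alpha> *\<^sub>R (u + \<tau> *\<^sub>R z) + (1 - \<alpha>) *\<^sub>R (u - \<tau> *\<^sub>R z))" by (rule arg_cong)
  also have "\<dots> \<le> P (\<alpha> *\<^sub>R (u + \<tau> *\<^sub>R z)) + P ((1 - \<alpha>) *\<^sub>R (u - \<tau> *\<^sub>R z))"
    by (rule seminorm_triangle[OF P])
  also have "\<dots> = \<alpha> * P (u + \<tau> *\<^sub>R z) + (1 - \<alpha>) * P (u - \<tau> *\<^sub>R z)"
    using a by (simp add: seminorm_scaleR[OF P])
  also have "\<dots> \<le> max (P (u + \<tau> *\<^sub>R z)) (P (u - \<tau> *\<^sub>R z))"
    using a by (intro convex_bound_le) auto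
  finally show ?thesis .
qed

lemma frozen_norm_triangle:
  assumes F: "F \<subseteq> {..<n}" and c: "0 < c"
  shows "frozen_norm P m F z c (x + y) \<le> frozen_norm P m F z c x + frozen_norm P m F z c y"
proof -
  let ?R = "restr {..<m}" and ?t = "\<lambda>x. l2_on F x / c"
  let ?s = "?t x + ?t y"
  have "l2_on F (x + y) \<le> l2_on F x + l2_on F y"
    by (rule seminorm_triangle[OF seminorm_l2_on[OF F]])
  then have "?t (x + y) \<le> ?s"
    using c by (simp add: divide_right_mono add_divide_distrib[symmetric])
  then have t: "\<bar>?t (x + y)\<bar> \<le> ?s" "\<bar>- ?t (x + y)\<bar> \<le> ?s" using c by (auto simp: l2_on_nonneg)
  have 1: "?R (x + y) + ?s *\<^sub>R z = (?R x + ?t x *\<^sub>R z) + (?R y + ?t y *\<^sub>R z)"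
    by (auto simp: restr_def fun_eq_iff algebra_simps)
  have 2: "?R (x + y) - ?s *\<^sub>R z = (?R x - ?t x *\<^sub>R z) + (?R y - ?t y *\<^sub>R z)"
    by (auto simp: restr_def fun_eq_iff algebra_simps)
  have "P (?R (x + y) + ?s *\<^sub>R z) \<le> frozen_norm P m F z c x + frozen_norm P m F z c y"
    unfolding 1 frozen_norm_def by (rule order_trans[OF seminorm_triangle[OF P] add_mono]) auto
  moreover have "P (?R (x + y) - ?s *\<^sub>R z) \<le> frozen_norm P m F z c x + frozen_norm P m F z c y"
    unfolding 2 frozen_norm_def by (rule order_trans[OF seminorm_triangle[OF P] add_mono]) auto
  ultimately have "max (P (?R (x + y) + ?s *\<^sub>R z)) (P (?R (x + y) - ?s *\<^sub>R z))
      \<le> frozen_norm P m F z c x + frozen_norm P m F z c y" by simp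
  moreover have "frozen_norm P m F z c (x + y)
      \<le> max (P (?R (x + y) + ?s *\<^sub>R z)) (P (?R (x + y) - ?s *\<^sub>R z))"
    using seminorm_between[OF t(1), of "?R (x + y)" z] seminorm_between[OF t(2), of "?R (x + y)" z]
    unfolding frozen_norm_def[of P m F z c "x + y"] by (simp only: max.bounded_iff scaleR_minus_left add_uminus_conv_diff simp_thms)
  ultimately show ?thesis by linarith
qed

lemma frozen_norm_scaleR:
  assumes F: "F \<subseteq> {..<n}"
  shows "frozen_norm P m F z c (a *\<^sub>R x) = \<bar>a\<bar> * frozen_norm P m F z c x"
proof -
  let ?R = "restr {..<m}" and ?t = "\<lambda>x. l2_on F x / c"
  have t: "?t (a *\<^sub>R x) = \<bar>a\<bar> * ?t x"
    using seminorm_scaleR[OF seminorm_l2_on[OF F], of a x] by simp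
  have "frozen_norm P m F z c (a *\<^sub>R x) = max (\<bar>a\<bar> * P (?R x + ?t x *\<^sub>R z)) (\<bar>a\<bar> * P (?R x - ?t x *\<^sub>R z))"
  proof (cases "0 \<le> a")
    case True
    have "?R (a *\<^sub>R x) + ?t (a *\<^sub>R x) *\<^sub>R z = a *\<^sub>R (?R x + ?t x *\<^sub>R z)"
      "?R (a *\<^sub>R x) - ?t (a *\<^sub>R x) *\<^sub>R z = a *\<^sub>R (?R x - ?t x *\<^sub>R z)"
      unfolding t using True by (auto simp: restr_def fun_eq_iff algebra_simps)
    then show ?thesis
      unfolding frozen_norm_def by (simp only: seminorm_scaleR[OF P])
  next
    case False
    have "?R (a *\<^sub>R x) + ?t (a *\<^sub>R x) *\<^sub>R z = a *\<^sub>R (?R x - ?t x *\<^sub>R z)"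
      "?R (a *\<^sub>R x) - ?t (a *\<^sub>R x) *\<^sub>R z = a *\<^sub>R (?R x + ?t x *\<^sub>R z)"
      unfolding t using False by (auto simp: restr_def fun_eq_iff algebra_simps)
    then show ?thesis
      unfolding frozen_norm_def by (simp only: seminorm_scaleR[OF P] max.commute)
  qed
  also have "\<dots> = \<bar>a\<bar> * frozen_norm P m F z c x"
    unfolding frozen_norm_def by (simp add: max_mult_distrib_left)
  finally show ?thesis .
qed

lemma frozen_norm_nonneg: "0 \<le> frozen_norm P m F z c x"
  unfolding frozen_norm_def using seminorm_nonneg[OF P] by (simp add: le_max_iff_disj)

text \<open>If both vectors under the maximum have seminorm zero, so do their sum and their
  difference, which are twice the unfrozen part and twice the multiple of \<open>z\<close>.\<close>

lemma frozen_norm_eq_0D: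
  assumes "frozen_norm P m F z c x = 0"
    and def: "\<And>v. P v = 0 \<Longrightarrow> pad n v = 0" and z: "P z \<noteq> 0" and c: "c \<noteq> 0"
    and m: "m \<le> n" and F: "finite F"
  shows "\<forall>i\<in>{..<m} \<union> F. x i = 0"
proof -
  let ?u = "restr {..<m} x" and ?t = "l2_on F x / c"
  have le: "P (?u + ?t *\<^sub>R z) \<le> 0" "P (?u - ?t *\<^sub>R z) \<le> 0"
    using assms(1) by (auto simp: frozen_norm_def max_def split: if_splits)
  have "P (2 *\<^sub>R ?u) \<le> P (?u + ?t *\<^sub>R z) + P (?u - ?t *\<^sub>R z)"
    using seminorm_triangle[OF P, of "?u + ?t *\<^sub>R z" "?u - ?t *\<^sub>R z"] by (simp add: scaleR_2)
  then have "2 * P ?u \<le> 0" using le by (simp add: seminorm_scaleR[OF P])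
  then have "P ?u = 0" using seminorm_nonneg[OF P, of ?u] by simp
  then have "pad n ?u = 0" by (rule def)
  then have u: "x i = 0" if "i < m" for i
  proof -
    have "pad n ?u i = 0 i" using \<open>pad n ?u = 0\<close> by (rule fun_cong)
    then show ?thesis using that m by (simp add: pad_def restr_def)
  qed
  have "2 * (\<bar>?t\<bar> * P z) = P ((2 * ?t) *\<^sub>R z)" by (simp add: seminorm_scaleR[OF P] abs_mult)
  also have "(2 * ?t) *\<^sub>R z = (?u + ?t *\<^sub>R z) - (?u - ?t *\<^sub>R z)"
    by (simp add: fun_eq_iff)
  also have "P \<dots> \<le> P (?u + ?t *\<^sub>R z) + P (?u - ?t *\<^sub>R z)" by (rule seminorm_diff[OF P])
  finally have "\<bar>?t\<bar> * P z \<le> 0" using le by linarith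
  moreover have "0 < P z" using z seminorm_nonneg[OF P, of z] by simp
  ultimately have "?t = 0" by (simp add: mult_le_0_iff)
  then have "l2_on F x = 0" using c by simp
  then have "\<forall>i\<in>F. (x i)^2 = 0" using F by (simp add: l2_on_def sum_nonneg_eq_0_iff)
  then show ?thesis using u by auto
qed

lemma measurable_frozen_norm [measurable]: "frozen_norm P m F z c \<in> borel_measurable borel"
proof -
  have [measurable]: "P \<in> borel_measurable borel" by (rule measurable_seminorm[OF P])
  have [measurable]: "l2_on F \<in> borel_measurable borel" unfolding l2_on_def by measurable
  have [measurable]: "(\<lambda>x. restr {..<m} x + (l2_on F x / c) *\<^sub>R z) \<in> borel \<rightarrow>\<^sub>M borel"
    by (rule measurable_seq_lambda) (simp only: plus_fun_apply scaleR_fun_apply, measurable)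
  have [measurable]: "(\<lambda>x. restr {..<m} x - (l2_on F x / c) *\<^sub>R z) \<in> borel \<rightarrow>\<^sub>M borel"
    by (rule measurable_seq_lambda) (simp only: minus_apply scaleR_fun_apply, measurable)
  show ?thesis unfolding frozen_norm_def by measurable
qed

lemma frozen_norm_close:
  assumes "\<bar>P x - P (restr {..<m} x + z)\<bar> \<le> d" "\<bar>P x - P (restr {..<m} x - z)\<bar> \<le> d"
    and "\<bar>l2_on F x / c - 1\<bar> * P z \<le> e"
  shows "\<bar>P x - frozen_norm P m F z c x\<bar> \<le> d + e"
proof -
  let ?u = "restr {..<m} x" and ?t = "l2_on F x / c"
  have "\<bar>P (?u + ?t *\<^sub>R z) - P (?u + z)\<bar> \<le> P ((?u + ?t *\<^sub>R z) - (?u + z))" by (rule seminorm_abs_diff[OF P])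
  also have "(?u + ?t *\<^sub>R z) - (?u + z) = (?t - 1) *\<^sub>R z" by (simp add: fun_eq_iff algebra_simps)
  finally have 1: "\<bar>P (?u + ?t *\<^sub>R z) - P (?u + z)\<bar> \<le> e" using assms(3) by (simp only: seminorm_scaleR[OF P])
  have "\<bar>P (?u - ?t *\<^sub>R z) - P (?u - z)\<bar> \<le> P ((?u - ?t *\<^sub>R z) - (?u - z))" by (rule seminorm_abs_diff[OF P])
  also have "(?u - ?t *\<^sub>R z) - (?u - z) = (1 - ?t) *\<^sub>R z" by (simp add: fun_eq_iff algebra_simps)
  finally have 2: "\<bar>P (?u - ?t *\<^sub>R z) - P (?u - z)\<bar> \<le> e"
    using assms(3) by (simp only: seminorm_scaleR[OF P] abs_minus_commute)
  have "\<bar>P x - P (?u + ?t *\<^sub>R z)\<bar> \<le> d + e" "\<bar>P x - P (?u - ?t *\<^sub>R z)\<bar> \<le> d + e"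
    using 1 2 assms(1,2) by linarith+
  then show ?thesis unfolding frozen_norm_def by (simp add: max_def)
qed

end

section \<open>Quantiles and the approximation estimate\<close>

lemma ratio_close:
  fixes p f \<epsilon> :: real
  assumes "0 < p" "\<bar>p - f\<bar> \<le> (\<epsilon>/2) * p" "0 < \<epsilon>" "\<epsilon> < 1/2"
  shows "1 - \<epsilon> \<le> p / f \<and> p / f \<le> 1 + \<epsilon>"
proof -
  have f1: "(1 - \<epsilon>/2) * p \<le> f" and f2: "f \<le> (1 + \<epsilon>/2) * p"
    using assms(2)[unfolded abs_le_iff] by (auto simp: algebra_simps)
  have "0 < (1 - \<epsilon>/2) * p" using assms by simp
  then have f0: "0 < f" using f1 by linarith
  have "(1 - \<epsilon>) * f \<le> (1 - \<epsilon>) * ((1 + \<epsilon>/2) * p)" using f2 assms by (intro mult_left_mono) auto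
  also have "\<dots> = ((1 - \<epsilon>) * (1 + \<epsilon>/2)) * p" by simp
  also have "\<dots> \<le> 1 * p"
    using assms by (intro mult_right_mono) (auto simp: algebra_simps)
  finally have 1: "(1 - \<epsilon>) * f \<le> p" by simp
  have e2: "\<epsilon> * \<epsilon> \<le> \<epsilon> * 1" using assms by (intro mult_left_mono) auto
  have "1 * p \<le> ((1 + \<epsilon>) * (1 - \<epsilon>/2)) * p"
    using assms e2 by (intro mult_right_mono) (auto simp: algebra_simps)
  also have "\<dots> = (1 + \<epsilon>) * ((1 - \<epsilon>/2) * p)" by simp
  also have "\<dots> \<le> (1 + \<epsilon>) * f" using f1 assms by (intro mult_left_mono) auto
  finally have "p \<le> (1 + \<epsilon>) * f" by simp
  with 1 f0 show ?thesis by (simp add: pos_le_divide_eq pos_divide_le_eq)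
qed

text \<open>A dyadic search: the first level \<open>s * 2 ^ j\<close> reached with probability 7/8
  is \<open>2 * M\<close>, and the failure of the level before it says that \<open>M\<close> is
  exceeded with probability above 1/8.\<close>

lemma quantile_exists:
  assumes P: "seminorm n P" and n: "1 \<le> n" and pos: "0 < P (unit_vec (n - 1))"
  obtains M where "0 < M" "7/8 \<le> measure gaussian_seq {x. P x \<le> 2 * M}"
    "1/8 \<le> measure gaussian_seq {x. M \<le> P x}"
proof -
  have [measurable]: "P \<in> borel_measurable borel" by (rule measurable_seminorm[OF P])
  let ?f = "\<lambda>t. measure gaussian_seq {x. P x \<le> t}"
  have sets: "{x. P x \<le> t} \<in> sets gaussian_seq" for t by (rule gaussian_seq_setI) measurable
  let ?j = "n - 1"
  define d where "d = P (unit_vec ?j)"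
  obtain a where a: "\<And>x. (\<Sum>i<n. a i * x i) \<le> P x" "(\<Sum>i<n. a i * unit_vec ?j i) = d"
    using seminorm_supporting_functional[OF P, of "unit_vec ?j"] unfolding d_def by blast
  have "(\<Sum>i<n. a i * unit_vec ?j i) = a ?j"
    using n by (simp add: unit_vec_def if_distrib cong: if_cong)
  then have ad: "a ?j = d" using a(2) by simp
  have abs: "\<bar>\<Sum>i<n. a i * x i\<bar> \<le> P x" for x
  proof -
    have "(\<Sum>i<n. a i * (- x) i) \<le> P (- x)" by (rule a(1))
    then have "- (\<Sum>i<n. a i * x i) \<le> P x" using seminorm_minus[OF P, of x] by (simp add: sum_negf)
    then show ?thesis using a(1)[of x] by (simp add: abs_le_iff)
  qed
  \<comment> \<open>The starting level must fail, so a normal tail above 1/8 is needed; the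
    threshold 1/10 already leaves a little more. Using the last coordinate makes the single
    functional trivially triangular.\<close>
  define s where "s = d / 10"
  have s0: "0 < s" "0 < d" using pos by (auto simp: s_def d_def)
  define b where "b k i = (if i < n then a i else 0)" for k i :: nat
  have "measure gaussian_seq {x. \<forall>k\<in>{?j..<?j+1}. \<bar>\<Sum>i<n. b k i * x i\<bar> \<le> s} \<le> (1 - normal_tail (s / d)) ^ 1"
  proof (rule triangular_slabs)
    fix k assume "k \<in> {?j..<?j+1}"
    then have "k = ?j" by auto
    then show "d \<le> b k k" "\<And>i. k < i \<Longrightarrow> b k i = 0" using n ad by (auto simp: b_def)
  qed (use s0 n in auto)
  moreover have "{x. P x \<le> s} \<subseteq> {x. \<forall>k\<in>{?j..<?j+1}. \<bar>\<Sum>i<n. b k i * x i\<bar> \<le> s}"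
    using abs order_trans by (auto simp: b_def)
  moreover have "{x. \<forall>k\<in>{?j..<?j+1}. \<bar>\<Sum>i<n. b k i * x i\<bar> \<le> s} \<in> sets gaussian_seq"
    by (rule gaussian_seq_setI) measurable
  ultimately have "?f s \<le> 1 - normal_tail (s / d)"
    using G.finite_measure_mono[of "{x. P x \<le> s}" "{x. \<forall>k\<in>{?j..<?j+1}. \<bar>\<Sum>i<n. b k i * x i\<bar> \<le> s}"] by simp
  moreover have "1/8 < normal_tail (s / d)"
  proof -
    have "1 + (- ((1/10 + 1)^2) / 2) \<le> exp (- ((1/10 + 1)^2) / 2 :: real)" by (rule exp_ge_add_one_self)
    then show ?thesis using normal_tail_ge[of "1/10"] s0 by (simp add: s_def power2_eq_square)
  qed
  ultimately have fs: "?f s < 7/8" by linarith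
  have ex: "\<exists>j. 7/8 \<le> ?f (s * 2 ^ j)"
  proof -
    let ?A = "\<lambda>j::nat. {x. P x \<le> s * 2 ^ j}"
    have "incseq ?A"
    proof (rule incseq_SucI, rule subsetI)
      fix j x assume "x \<in> ?A j"
      moreover have "s * 2 ^ j \<le> s * 2 ^ Suc j" using s0 by simp
      ultimately show "x \<in> ?A (Suc j)" using order_trans by blast
    qed
    moreover have "range ?A \<subseteq> sets gaussian_seq" using sets by auto
    ultimately have "(\<lambda>j. measure gaussian_seq (?A j)) \<longlonglongrightarrow> measure gaussian_seq (\<Union>j. ?A j)"
      by (intro G.finite_Lim_measure_incseq)
    moreover have "(\<Union>j. ?A j) = UNIV"
    proof -
      have "\<exists>j. P x \<le> s * 2 ^ j" for x
      proof -
        obtain j where "P x / s < 2 ^ j" using real_arch_pow[of 2 "P x / s"] by auto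
        then show ?thesis using s0 by (intro exI[of _ j]) (simp add: field_simps)
      qed
      then show ?thesis by auto
    qed
    ultimately have "(\<lambda>j. ?f (s * 2 ^ j)) \<longlonglongrightarrow> 1" using G.prob_space by simp
    then have "eventually (\<lambda>j. 7/8 < ?f (s * 2 ^ j)) sequentially"
      by (rule order_tendstoD) simp
    then obtain N where N: "\<forall>j\<ge>N. 7/8 < ?f (s * 2 ^ j)" unfolding eventually_sequentially by blast
    then have "7/8 < ?f (s * 2 ^ N)" by blast
    then show ?thesis by (intro exI[of _ N]) linarith
  qed
  \<comment> \<open>The least such \<open>j\<close> is positive by the choice of \<open>s\<close>,
    so it has a predecessor.\<close>
  define j where "j = (LEAST j. 7/8 \<le> ?f (s * 2 ^ j))"
  have j: "7/8 \<le> ?f (s * 2 ^ j)" unfolding j_def using ex by (rule LeastI_ex)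
  have "j \<noteq> 0" using j fs by (intro notI) simp
  then obtain i where i: "j = Suc i" by (cases j) auto
  have "\<not> 7/8 \<le> ?f (s * 2 ^ i)" using not_less_Least[of i "\<lambda>j. 7/8 \<le> ?f (s * 2 ^ j)"] i by (simp add: j_def)
  moreover have "1 - ?f (s * 2 ^ i) \<le> measure gaussian_seq {x. s * 2 ^ i \<le> P x}"
  proof -
    have "1 - ?f (s * 2 ^ i) = measure gaussian_seq (UNIV - {x. P x \<le> s * 2 ^ i})"
      using G.prob_compl[OF sets] by simp
    also have "\<dots> \<le> measure gaussian_seq {x. s * 2 ^ i \<le> P x}"
    proof (rule G.finite_measure_mono)
      show "{x. s * 2 ^ i \<le> P x} \<in> G.events" by (rule gaussian_seq_setI) measurable
    qed auto
    finally show ?thesis .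
  qed
  ultimately have "1/8 \<le> measure gaussian_seq {x. s * 2 ^ i \<le> P x}" by linarith
  moreover have "2 * (s * 2 ^ i) = s * 2 ^ j" by (simp add: i)
  ultimately show ?thesis using j s0(1) by (intro that[of "s * 2 ^ i"]) (simp_all only: mult_pos_pos zero_less_power zero_less_numeral)
qed

lemma prob_le_quantile_fraction:
  assumes P: "seminorm n P" and e: "0 < \<epsilon>" "\<epsilon> < 1/2" and M: "0 < M"
    and q: "1/8 \<le> measure gaussian_seq {x. M \<le> P x}"
  shows "measure gaussian_seq {x. P x \<le> \<epsilon>/32 * M} \<le> \<epsilon>/2"
proof -
  \<comment> \<open>With \<open>t = \<epsilon>/32\<close> this gives
    \<open>4 * t * N \<le> 2 + \<epsilon>/8 < 3\<close>, and dividing by \<open>N\<close> and by the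
    probability 1/8 of long vectors leaves \<open>\<epsilon>/2\<close>.\<close>
  define N where "N = nat \<lceil>16/\<epsilon>\<rceil>"
  have N: "16/\<epsilon> \<le> real N" "real N \<le> 16/\<epsilon> + 1" using e by (auto simp: N_def)
  let ?f = "measure gaussian_seq {x. P x \<le> \<epsilon>/32 * M}"
  have "4 * (\<epsilon>/32) * real N \<le> 4 * (\<epsilon>/32) * (16/\<epsilon> + 1)" using N e by (intro mult_left_mono) auto
  also have "\<dots> = 2 + \<epsilon>/8" using e by (simp add: field_simps)
  also have "\<dots> < 3" using e by simp
  finally have "real N * (?f * measure gaussian_seq {x. M \<le> P x}) \<le> 1"
    using e by (intro small_ball[OF P M]) auto
  moreover have "16/\<epsilon> * (?f * (1/8)) \<le> real N * (?f * measure gaussian_seq {x. M \<le> P x})"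
    using N q e by (intro mult_mono) auto
  ultimately have "16/\<epsilon> * (?f * (1/8)) \<le> 1" by linarith
  then show ?thesis using e by (simp add: field_simps)
qed

text \<open>A rational form of geometric decay. It serves twice: to see that \<open>k\<close> extra
  coordinates suffice and to bound the number of chosen directions.\<close>

lemma power_one_minus_le:
  fixes q :: real
  assumes "0 \<le> q" "q \<le> 1"
  shows "(1 + real m * q) * (1 - q) ^ m \<le> 1"
proof -
  have "(1 + real m * q) * (1 - q) ^ m \<le> (1 + q) ^ m * (1 - q) ^ m"
    using assms Bernoulli_inequality[of q m] by (intro mult_right_mono) auto
  also have "\<dots> = (1 - q^2) ^ m"
    by (simp add: power_mult_distrib[symmetric] power2_eq_square algebra_simps)
  also have "\<dots> \<le> 1" using assms by (intro power_le_one) (auto simp: power2_eq_square mult_le_one)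
  finally show ?thesis .
qed

text \<open>By Fubini one fixed \<open>y\<close> works for most \<open>x\<close>: replacing the
  coordinates from \<open>m\<close> on by those of \<open>y\<close> or of \<open>- y\<close> changes
  \<open>P\<close> little, and the Euclidean norm over the extra coordinates is close to that of
  \<open>y\<close>. What remains is to exclude the \<open>x\<close> with small
  \<open>P x\<close>.\<close>

lemma frozen_norm_approximates:
  assumes P: "seminorm n P" and def: "\<And>v. P v = 0 \<Longrightarrow> pad n v = 0"
    and e: "0 < \<epsilon>" "\<epsilon> < 1/2" and M: "0 < M"
    and q1: "1/8 \<le> measure gaussian_seq {x. M \<le> P x}"
    and q2: "7/8 \<le> measure gaussian_seq {x. P x \<le> 2 * M}"
    and r: "1 \<le> r" "12 * exp (- (r^2) / 8) \<le> \<epsilon> / 64"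
    and d: "\<delta> = \<epsilon>^2 / (160 * r)"
    and mk: "m + k \<le> n" and k: "7 \<le> real k * normal_tail (2 / \<delta>)"
    and lip: "coord_lipschitz {m..<n} (\<delta> * M) P"
  shows "\<exists>z c. 0 < c \<and> P z \<noteq> 0 \<and>
    1 - \<epsilon> \<le> measure gaussian_seq {x. 1 - \<epsilon> \<le> P x / frozen_norm P m {m..<m+k} z c x \<and>
      P x / frozen_norm P m {m..<m+k} z c x \<le> 1 + \<epsilon>}"
proof -
  let ?A = "{m..<n}" and ?F = "{m..<m+k}"
  let ?\<rho> = "l2_on ?F"
  have d0: "0 < \<delta>" using e r by (simp add: d)
  have rd: "r * \<delta> = \<epsilon>^2 / 160" using r by (simp add: d)
  have ee: "\<epsilon>^2 \<le> 1" using e by (intro power_le_one) auto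
  have An: "?A \<subseteq> {..<n}" "?F \<subseteq> {..<n}" "?F \<subseteq> ?A" using mk by auto
  have rho: "seminorm n ?\<rho>" by (rule seminorm_l2_on[OF An(2)])
  have [measurable]: "P \<in> borel_measurable borel" "?\<rho> \<in> borel_measurable borel"
    by (rule measurable_seminorm[OF P], rule measurable_seminorm[OF rho])
  have lip_rho: "coord_lipschitz ?A 1 ?\<rho>"
    unfolding coord_lipschitz_def l2_on_def
    using An(3) by (auto intro!: sum_mono2)
  define B1 where "B1 = {p. r * (\<delta> * M) < \<bar>P (fst p) - P (mix ?A (fst p) (snd p))\<bar>}"
  define B2 where "B2 = {p. r * (\<delta> * M) < \<bar>P (fst p) - P (mix ?A (fst p) (- snd p))\<bar>}"
  define B3 where "B3 = {p. r * 1 < \<bar>?\<rho> (fst p) - ?\<rho> (mix ?A (fst p) (snd p))\<bar>}"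
  define B where "B = B1 \<union> B2 \<union> B3"
  have B1: "B1 \<in> sets gaussian_pair" unfolding B1_def by (rule gaussian_pair_setI) measurable
  have B2: "B2 \<in> sets gaussian_pair" unfolding B2_def by (rule gaussian_pair_setI) measurable
  have B3: "B3 \<in> sets gaussian_pair" unfolding B3_def by (rule gaussian_pair_setI) measurable
  have Bs: "B \<in> sets gaussian_pair" unfolding B_def using B1 B2 B3 by auto
  have L: "0 < \<delta> * M" and r0: "0 \<le> r" using d0 M r by auto
  have "measure gaussian_pair B \<le> measure gaussian_pair B1 + measure gaussian_pair B2 + measure gaussian_pair B3"
    unfolding B_def using measure_Un_le[OF B1 B2] measure_Un_le[OF sets.Un[OF B1 B2] B3] by linarith
  also have "\<dots> \<le> 12 * exp (- (r^2) / 8)"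
    using mix_deviation[OF P An(1) L lip r0] mix_deviation(1)[OF rho An(1) _ lip_rho r0]
    by (simp add: B1_def B2_def B3_def)
  finally have Bm: "measure gaussian_pair B \<le> \<epsilon> / 64" using r by simp
  \<comment> \<open>The deviation \<open>r\<close> of the Euclidean norm is absolute, so that norm
    must be at least \<open>2 / \<delta>\<close> to make the relative error at most
    \<open>r * \<delta> / 2\<close>. Crudely, a smaller norm puts all \<open>k\<close> coordinates
    into a slab, which has probability at most 1/8 by the choice of \<open>k\<close>.\<close>
  define Y where "Y = {y. ?\<rho> y < 2 / \<delta>}"
  have Ys: "Y \<in> sets gaussian_seq" unfolding Y_def by (rule gaussian_seq_setI) measurable
  have Ym: "measure gaussian_seq Y \<le> 1/8"
  proof -
    let ?a = "\<lambda>k i. if i = k then 1 else 0 :: real"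
    let ?S = "{x. \<forall>k'\<in>{m..<m+k}. \<bar>\<Sum>i<n. ?a k' i * x i\<bar> \<le> 2 / \<delta>}"
    let ?t = "normal_tail (2 / \<delta>)"
    have sS: "?S \<in> sets gaussian_seq" by (rule gaussian_seq_setI) measurable
    have "Y \<subseteq> ?S"
    proof (intro subsetI CollectI ballI)
      fix x k' assume x: "x \<in> Y" and k': "k' \<in> {m..<m+k}"
      have "(x k')^2 \<le> (\<Sum>i\<in>?F. (x i)^2)" using k' by (intro member_le_sum) auto
      then have "\<bar>x k'\<bar> \<le> ?\<rho> x" by (simp add: l2_on_def real_le_rsqrt)
      moreover have "(\<Sum>i<n. ?a k' i * x i) = x k'"
        using k' mk by (simp add: if_distrib[of "\<lambda>c. c * _"] cong: if_cong)
      ultimately show "\<bar>\<Sum>i<n. ?a k' i * x i\<bar> \<le> 2 / \<delta>" using x by (simp add: Y_def)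
    qed
    then have "measure gaussian_seq Y \<le> measure gaussian_seq ?S" by (rule G.finite_measure_mono[OF _ sS])
    also have "\<dots> \<le> (1 - normal_tail (2 / \<delta> / 1)) ^ k"
      by (rule triangular_slabs) (use d0 mk in auto)
    finally have 1: "measure gaussian_seq Y \<le> (1 - ?t) ^ k" by simp
    have t: "0 \<le> ?t" "?t \<le> 1" by (auto simp: normal_tail_def)
    have "8 * (1 - ?t) ^ k \<le> (1 + real k * ?t) * (1 - ?t) ^ k"
      using k t by (intro mult_right_mono) auto
    also have "\<dots> \<le> 1" by (rule power_one_minus_le[OF t])
    finally show ?thesis using 1 by linarith
  qed
  have sec: "{x. (x, y) \<in> B} \<in> sets gaussian_seq" for y
    using measurable_sets[OF _ Bs, of "\<lambda>x. (x, y)" gaussian_seq] by (simp add: vimage_def)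
  \<comment> \<open>Otherwise \<open>B\<close> would have measure at least
    \<open>7/8 * \<epsilon>/2\<close>, far above \<open>\<epsilon>/64\<close>.\<close>
  obtain y where y: "y \<notin> Y" "measure gaussian_seq {x. (x, y) \<in> B} < \<epsilon>/2"
  proof (rule ccontr)
    assume "\<not> thesis"
    then have all: "\<epsilon>/2 \<le> measure gaussian_seq {x. (x, y) \<in> B}" if "y \<notin> Y" for y
      using that \<open>(\<And>y. y \<notin> Y \<Longrightarrow> measure gaussian_seq {x. (x, y) \<in> B} < \<epsilon>/2 \<Longrightarrow> thesis)\<close>
      by (meson not_le)
    have "ennreal (\<epsilon>/2 * (7/8)) \<le> ennreal (\<epsilon>/2) * emeasure gaussian_seq (UNIV - Y)"
    proof -
      have "7/8 \<le> measure gaussian_seq (UNIV - Y)" using G.prob_compl[OF Ys] Ym by simp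
      then have "\<epsilon>/2 * (7/8) \<le> \<epsilon>/2 * measure gaussian_seq (UNIV - Y)"
        using e by (intro mult_left_mono) auto
      then show ?thesis
        using e by (simp add: G.emeasure_eq_measure ennreal_mult[symmetric] ennreal_leI)
    qed
    also have "\<dots> = (\<integral>\<^sup>+y. ennreal (\<epsilon>/2) * indicator (UNIV - Y) y \<partial>gaussian_seq)"
      by (rule nn_integral_cmult_indicator[symmetric]) (use Ys in auto)
    also have "\<dots> \<le> (\<integral>\<^sup>+y. emeasure gaussian_seq ((\<lambda>x. (x, y)) -` B) \<partial>gaussian_seq)"
    proof (rule nn_integral_mono)
      fix y
      show "ennreal (\<epsilon>/2) * indicator (UNIV - Y) y \<le> emeasure gaussian_seq ((\<lambda>x. (x, y)) -` B)"
        using all[of y] by (auto simp: indicator_def vimage_def G.emeasure_eq_measure intro!: ennreal_leI)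
    qed
    also have "\<dots> = emeasure gaussian_pair B" by (rule GG.emeasure_pair_measure_alt2[OF Bs, symmetric])
    also have "\<dots> \<le> ennreal (\<epsilon>/64)" using Bm by (simp add: GG.emeasure_eq_measure ennreal_leI)
    finally show False using e by (simp add: ennreal_le_iff)
  qed
  define z where "z = restr ?A y"
  define c where "c = ?\<rho> y"
  have c: "2 / \<delta> \<le> c" using y(1) by (simp add: Y_def c_def)
  have c0: "0 < c" using c d0 by (meson divide_pos_pos less_le_trans zero_less_numeral)
  have mixP: "P (mix ?A x y) = P (restr {..<m} x + z)" "P (mix ?A x (- y)) = P (restr {..<m} x - z)" for x
  proof -
    have "pad n (mix ?A x y) = pad n (restr {..<m} x + z)"
      by (auto simp: pad_def mix_def restr_def z_def fun_eq_iff)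
    then have "P (pad n (mix ?A x y)) = P (pad n (restr {..<m} x + z))" by (rule arg_cong)
    then show "P (mix ?A x y) = P (restr {..<m} x + z)" by (simp only: seminorm_pad[OF P])
    have "pad n (mix ?A x (- y)) = pad n (restr {..<m} x - z)"
      by (auto simp: pad_def mix_def restr_def z_def fun_eq_iff)
    then have "P (pad n (mix ?A x (- y))) = P (pad n (restr {..<m} x - z))" by (rule arg_cong)
    then show "P (mix ?A x (- y)) = P (restr {..<m} x - z)" by (simp only: seminorm_pad[OF P])
  qed
  \<comment> \<open>The extra coordinates lie in \<open>?A\<close>, so all of them come from
    \<open>y\<close>.\<close>
  have mixr: "?\<rho> (mix ?A x y) = c" for x
    unfolding c_def l2_on_def using mk by (intro arg_cong[where f = sqrt] sum.cong) (auto simp: mix_def)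
  have good: "\<bar>P x - P (restr {..<m} x + z)\<bar> \<le> r * (\<delta> * M)" "\<bar>P x - P (restr {..<m} x - z)\<bar> \<le> r * (\<delta> * M)"
      "\<bar>?\<rho> x - c\<bar> \<le> r" if "(x, y) \<notin> B" for x
    using that by (auto simp: B_def B1_def B2_def B3_def mixP mixr not_less)
  have rdM: "r * (\<delta> * M) = \<epsilon>^2 / 160 * M" using rd by (simp add: mult.assoc[symmetric])
  have rdM1: "r * (\<delta> * M) \<le> M"
  proof -
    have "\<epsilon>^2 / 160 * M \<le> 1 * M" using ee M by (intro mult_right_mono) auto
    then show ?thesis unfolding rdM by simp
  qed
  \<comment> \<open>Some \<open>x\<close> with \<open>P x \<le> 2 * M\<close> is good for
    \<open>y\<close>, since 7/8 exceeds \<open>\<epsilon>/2\<close>; and \<open>z\<close> is half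
    the difference of two vectors whose seminorms are close to \<open>P x\<close>.\<close>
  have Pz: "P z \<le> 3 * M"
  proof -
    let ?X = "{x. P x \<le> 2 * M}"
    have sX: "?X \<in> sets gaussian_seq" by (rule gaussian_seq_setI) measurable
    obtain x where x: "P x \<le> 2 * M" "(x, y) \<notin> B"
    proof (rule ccontr)
      assume "\<not> thesis"
      then have "?X \<subseteq> {x. (x, y) \<in> B}"
        using \<open>(\<And>x. P x \<le> 2 * M \<Longrightarrow> (x, y) \<notin> B \<Longrightarrow> thesis)\<close> by blast
      then have "measure gaussian_seq ?X \<le> measure gaussian_seq {x. (x, y) \<in> B}"
        by (rule G.finite_measure_mono[OF _ sec])
      then show False using q2 y(2) e by linarith
    qed
    let ?u = "restr {..<m} x"
    have "2 *\<^sub>R z = (?u + z) - (?u - z)" by (simp add: scaleR_2)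
    then have "P (2 *\<^sub>R z) \<le> P (?u + z) + P (?u - z)"
      using seminorm_diff[OF P, of "?u + z" "?u - z"] by (simp only:)
    then have "2 * P z \<le> P (?u + z) + P (?u - z)" by (simp add: seminorm_scaleR[OF P])
    then show ?thesis using good(1,2)[OF x(2)] x(1) rdM1 unfolding abs_le_iff by linarith
  qed
  have Pz0: "P z \<noteq> 0"
  proof
    assume "P z = 0"
    then have pz: "pad n z = 0" by (rule def)
    have "y i = 0" if "i \<in> ?F" for i
    proof -
      have "pad n z i = 0 i" using pz by (rule fun_cong)
      then show ?thesis using that mk by (simp add: pad_def z_def restr_def)
    qed
    then have "c = 0" by (simp add: c_def l2_on_def)
    then show False using c0 by simp
  qed
  let ?\<Phi> = "frozen_norm P m ?F z c"
  let ?G = "{x. 1 - \<epsilon> \<le> P x / ?\<Phi> x \<and> P x / ?\<Phi> x \<le> 1 + \<epsilon>}"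
  let ?S = "{x. P x \<le> \<epsilon>/32 * M}"
  have [measurable]: "?\<Phi> \<in> borel_measurable borel" by (rule measurable_frozen_norm[OF P])
  have sG: "?G \<in> sets gaussian_seq" by (rule gaussian_seq_setI) measurable
  have sS: "?S \<in> sets gaussian_seq" by (rule gaussian_seq_setI) measurable
  have "UNIV - ?G \<subseteq> {x. (x, y) \<in> B} \<union> ?S"
  proof (rule ccontr)
    assume "\<not> ?thesis"
    then obtain x where x: "x \<notin> ?G" "(x, y) \<notin> B" "\<epsilon>/32 * M < P x" by force
    have "\<bar>?\<rho> x / c - 1\<bar> = \<bar>?\<rho> x - c\<bar> / c" using c0 by (simp add: field_simps abs_divide[symmetric])
    also have "\<dots> \<le> r / (2 / \<delta>)" using good(3)[OF x(2)] c d0 r0 by (intro frac_le) auto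
    finally have "\<bar>?\<rho> x / c - 1\<bar> * P z \<le> (r * \<delta> / 2) * (3 * M)"
      using Pz seminorm_nonneg[OF P, of z] r0 d0 by (intro mult_mono) auto
    then have "\<bar>P x - ?\<Phi> x\<bar> \<le> r * (\<delta> * M) + (r * \<delta> / 2) * (3 * M)"
      by (intro frozen_norm_close[OF P] good[OF x(2)])
    \<comment> \<open>This fixes the 160 in \<open>\<delta>\<close>: the total is
      \<open>5/2 * r * \<delta> * M\<close>, and \<open>5/2 * 1/160 = 1/64\<close>.\<close>
    also have "\<dots> = (\<epsilon>/2) * (\<epsilon>/32 * M)" unfolding rd rdM by (simp add: power2_eq_square)
    also have "\<dots> \<le> (\<epsilon>/2) * P x" using x(3) e by (intro mult_left_mono) auto
    finally have "\<bar>P x - ?\<Phi> x\<bar> \<le> (\<epsilon>/2) * P x" .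
    moreover have "0 < \<epsilon>/32 * M" using e M by simp
    then have "0 < P x" using x(3) by linarith
    ultimately have "x \<in> ?G" using ratio_close e by blast
    then show False using x(1) by simp
  qed
  then have "measure gaussian_seq (UNIV - ?G) \<le> measure gaussian_seq ({x. (x, y) \<in> B} \<union> ?S)"
    by (rule G.finite_measure_mono) (use sec sS in auto)
  also have "\<dots> \<le> measure gaussian_seq {x. (x, y) \<in> B} + measure gaussian_seq ?S"
    by (rule measure_Un_le[OF sec sS])
  also have "\<dots> \<le> \<epsilon>/2 + \<epsilon>/2"
    using y(2) prob_le_quantile_fraction[OF P e M q1] by (intro add_mono) auto
  finally have "1 - \<epsilon> \<le> measure gaussian_seq ?G" using G.prob_compl[OF sG] by simp
  then show ?thesis using c0 Pz0 by blast
qed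

section \<open>Transfer to \<open>std_gaussian\<close> and to junta norms\<close>

lemma measurable_pad: "pad n \<in> borel \<rightarrow>\<^sub>M borel"
  unfolding pad_def by (rule measurable_seq_lambda) measurable

lemma std_gaussian_eq_distr:
  "std_gaussian n = distr gaussian_seq (restrict_space borel (Rn n)) (pad n)"
proof -
  let ?I = "{..<n}"
  have 1: "PiM ?I (\<lambda>_. N01) = distr (PiM UNIV (\<lambda>_. N01)) (PiM ?I (\<lambda>_. N01)) (\<lambda>x. restrict x ?I)"
    by (rule gprod.distr_PiM_restrict_finite[symmetric]) auto
  have "std_gaussian n = distr (distr (PiM UNIV (\<lambda>_. N01)) (PiM ?I (\<lambda>_. N01)) (\<lambda>x. restrict x ?I))
      (restrict_space borel (Rn n)) (\<lambda>x i. if i < n then x i else 0)"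
    unfolding std_gaussian_def by (subst 1) (rule refl)
  also have "\<dots> = distr (PiM UNIV (\<lambda>_. N01)) (restrict_space borel (Rn n))
      ((\<lambda>x i. if i < n then x i else 0) \<circ> (\<lambda>x. restrict x ?I))"
    by (intro distr_distr measurable_zero_pad measurable_restrict_subset) auto
  also have "(\<lambda>x i. if i < n then x i else 0) \<circ> (\<lambda>x. restrict x ?I) = pad n"
    by (auto simp: pad_def fun_eq_iff)
  finally show ?thesis by (simp add: gaussian_seq_def)
qed

lemma measure_std_gaussian:
  assumes A: "A \<in> sets borel"
  shows "measure (std_gaussian n) (A \<inter> Rn n) = measure gaussian_seq {x. pad n x \<in> A}"
proof -
  have "pad n \<in> gaussian_seq \<rightarrow>\<^sub>M borel" using measurable_pad by simp
  then have "pad n \<in> gaussian_seq \<rightarrow>\<^sub>M restrict_space borel (Rn n)"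
    by (intro measurable_restrict_space2) auto
  moreover have "A \<inter> Rn n \<in> sets (restrict_space borel (Rn n))"
    using A by (auto simp: sets_restrict_space)
  ultimately show ?thesis
    unfolding std_gaussian_eq_distr by (subst measure_distr) (auto simp: vimage_def)
qed

lemma measure_gauss_iso:
  assumes TS: "gauss_iso n T S" and A: "A \<in> sets borel"
  shows "measure gaussian_seq {x. T x \<in> A} = measure gaussian_seq A"
proof -
  have s: "{x. T x \<in> A} \<in> sets gaussian_seq"
    using measurable_sets[OF gauss_isoD(8)[OF TS] A] by (simp add: vimage_def)
  have "emeasure gaussian_seq {x. T x \<in> A} = (\<integral>\<^sup>+x. indicator {x. T x \<in> A} x \<partial>gaussian_seq)"
    using s by (simp only: nn_integral_indicator)
  also have "\<dots> = (\<integral>\<^sup>+x. indicator A (T x) \<partial>gaussian_seq)"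
    by (intro nn_integral_cong) (simp add: indicator_def)
  also have "\<dots> = (\<integral>\<^sup>+x. indicator A x \<partial>gaussian_seq)"
    by (rule gauss_isoD(10)[OF TS]) (use A in simp)
  also have "\<dots> = emeasure gaussian_seq A" using A by simp
  finally show ?thesis by (simp add: measure_def)
qed

lemma gauss_iso_Rn: "gauss_iso n T S \<Longrightarrow> x \<in> Rn n \<Longrightarrow> T x \<in> Rn n"
  using pad_in_Rn[of n "T x"] by (simp only: gauss_isoD(6) pad_Rn)

text \<open>For \<open>k \<le> n\<close> this is the span of the images under \<open>T\<close> of
  the first \<open>k\<close> unit vectors. In terms of the inverse \<open>S\<close>, membership and
  orthogonality become conditions on coordinates.\<close>

definition rotated_coords :: "nat \<Rightarrow> nat \<Rightarrow> ((nat \<Rightarrow> real) \<Rightarrow> (nat \<Rightarrow> real)) \<Rightarrow> (nat \<Rightarrow> real) set" where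
  "rotated_coords n k S = {x \<in> Rn n. S x \<in> Rn k}"

context
  fixes n T S assumes TS: "gauss_iso n T S"
begin

lemma subspace_rotated_coords: "subspace (rotated_coords n k S)"
  using gauss_isoD(2)[OF TS] subspace_Rn
  by (auto simp: rotated_coords_def subspace_def linear_0 linear_add linear_scale)

lemma rotated_coords_Rn: "rotated_coords n k S \<subseteq> Rn n"
  by (auto simp: rotated_coords_def)

lemma dim_rotated_coords: "dim (rotated_coords n k S) \<le> k"
proof -
  let ?W = "T ` unit_vec ` {..<k}"
  have "rotated_coords n k S \<subseteq> span ?W"
  proof
    fix x assume "x \<in> rotated_coords n k S"
    then have "S x = (\<Sum>i<k. S x i *\<^sub>R unit_vec i)"
      by (intro Rn_expand) (simp add: rotated_coords_def)
    then have "T (S x) = T (\<Sum>i<k. S x i *\<^sub>R unit_vec i)" by (rule arg_cong)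
    then have "x = (\<Sum>i<k. S x i *\<^sub>R T (unit_vec i))"
      by (simp only: gauss_isoD(3)[OF TS] linear_sum[OF gauss_isoD(1)[OF TS]] linear_scale[OF gauss_isoD(1)[OF TS]])
    also have "\<dots> \<in> span ?W"
      by (intro span_sum span_scale span_base) auto
    finally show "x \<in> span ?W" .
  qed
  then have "dim (rotated_coords n k S) \<le> card ?W" by (rule dim_le_card) simp
  also have "\<dots> \<le> k"
    using card_image_le[of "unit_vec ` {..<k}" T] card_image_le[of "{..<k}" unit_vec] by simp
  finally show ?thesis .
qed

lemma orth_proj_rotated_coords:
  assumes k: "k \<le> n" and x: "x \<in> Rn n"
  shows "orth_proj n (rotated_coords n k S) x = T (restr {..<k} (S x))"
  unfolding orth_proj_def
proof (rule the1_equality[OF orth_proj_ex1[OF subspace_rotated_coords rotated_coords_Rn]])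
  let ?p = "T (restr {..<k} (S x))"
  have "restr {..<k} (S x) \<in> Rn n" using k by (auto simp: restr_def Rn_def)
  then have "?p \<in> Rn n" by (rule gauss_iso_Rn[OF TS])
  moreover have "S ?p \<in> Rn k" unfolding gauss_isoD(4)[OF TS] by (auto simp: restr_def Rn_def)
  ultimately have "?p \<in> rotated_coords n k S" by (simp add: rotated_coords_def)
  moreover have "dot n (x - ?p) z = 0" if z: "z \<in> rotated_coords n k S" for z
  proof -
    have "T (S x - restr {..<k} (S x)) = x - ?p"
      by (simp only: linear_diff[OF gauss_isoD(1)[OF TS]] gauss_isoD(3)[OF TS])
    then have "dot n (x - ?p) z = dot n (S x - restr {..<k} (S x)) (S z)"
      using gauss_isoD(5)[OF TS, of "S x - restr {..<k} (S x)" z] by (simp only:)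
    also have "\<dots> = 0"
      using z unfolding dot_def by (intro sum.neutral) (auto simp: rotated_coords_def restr_def Rn_def)
    finally show ?thesis .
  qed
  ultimately show "?p \<in> rotated_coords n k S \<and> (\<forall>z\<in>rotated_coords n k S. dot n (x - ?p) z = 0)" by blast
qed

end

text \<open>\<open>frozen_norm\<close> reads only the coordinates below \<open>m + k\<close>, so
  after rotation it factors through the orthogonal projection; it is definite on the subspace
  because \<open>P\<close> is definite and \<open>P z \<noteq> 0\<close>.\<close>

lemma junta_norm_frozen_norm:
  assumes TS: "gauss_iso n T S" and P: "seminorm n P" and def: "\<And>v. P v = 0 \<Longrightarrow> pad n v = 0"
    and mk: "m + k \<le> n" and c: "0 < c" and z: "P z \<noteq> 0"
  shows "junta_norm n (m + k) (\<lambda>x. frozen_norm P m {m..<m+k} z c (S x))"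
proof -
  let ?F = "{m..<m+k}"
  let ?\<Phi> = "frozen_norm P m ?F z c" and ?E = "rotated_coords n (m + k) S"
  have F: "?F \<subseteq> {..<n}" using mk by auto
  note lin = gauss_isoD(2)[OF TS]
  have "?\<Phi> (S x) = 0 \<longleftrightarrow> x = 0" if x: "x \<in> ?E" for x
  proof
    assume "?\<Phi> (S x) = 0"
    then have "\<forall>i\<in>{..<m} \<union> ?F. S x i = 0"
      using frozen_norm_eq_0D[OF P _ def z] c mk by auto
    then have "S x i = 0" for i
      using x by (cases "i < m + k") (auto simp: rotated_coords_def Rn_def)
    then have "S x = 0" by (simp add: fun_eq_iff)
    then show "x = 0" using gauss_isoD(3)[OF TS, of x] linear_0[OF gauss_isoD(1)[OF TS]] by (simp only:)
  next
    assume "x = 0"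
    then have "S x = 0 *\<^sub>R 0" using linear_0[OF lin] by simp
    then show "?\<Phi> (S x) = 0" using frozen_norm_scaleR[OF P F, of m z c 0 0] by simp
  qed
  then have norm: "is_norm_on ?E (\<lambda>x. ?\<Phi> (S x))"
    unfolding is_norm_on_def
    using frozen_norm_nonneg[OF P] frozen_norm_scaleR[OF P F] frozen_norm_triangle[OF P F c]
    by (simp add: linear_scale[OF lin] linear_add[OF lin])
  have proj: "?\<Phi> (S x) = ?\<Phi> (S (orth_proj n ?E x))" if "x \<in> Rn n" for x
  proof -
    have "?\<Phi> (restr {..<m+k} v) = ?\<Phi> v" for v
    proof -
      have "restr {..<m} (restr {..<m+k} v) = restr {..<m} v" by (auto simp: restr_def fun_eq_iff)
      moreover have "l2_on ?F (restr {..<m+k} v) = l2_on ?F v"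
        unfolding l2_on_def by (intro arg_cong[where f = sqrt] sum.cong) (auto simp: restr_def)
      ultimately show ?thesis by (simp only: frozen_norm_def)
    qed
    then show ?thesis
      unfolding orth_proj_rotated_coords[OF TS mk that] gauss_isoD(4)[OF TS] by simp
  qed
  show ?thesis
    unfolding junta_norm_def
    by (intro exI[of _ ?E] exI[of _ "\<lambda>x. ?\<Phi> (S x)"] conjI ballI subspace_rotated_coords[OF TS]
        rotated_coords_Rn[OF TS] dim_rotated_coords[OF TS] norm proj)
qed

lemma junta_norm_full:
  assumes "is_norm_on (Rn n) \<psi>"
  shows "junta_norm n n \<psi>"
proof -
  have "orth_proj n (Rn n) x = x" if x: "x \<in> Rn n" for x
    unfolding orth_proj_def
    by (rule the1_equality[OF orth_proj_ex1[OF subspace_Rn order_refl]]) (use x in \<open>simp add: dot_def\<close>)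
  then show ?thesis
    unfolding junta_norm_def using assms subspace_Rn dim_Rn by (intro exI[of _ "Rn n"] exI[of _ \<psi>]) simp
qed

text \<open>Staying below \<open>2 * M\<close> has probability at least 7/8 but forces all
  \<open>m\<close> triangular slab conditions, whose joint probability decays geometrically in
  \<open>m\<close>.\<close>

lemma greedy_length:
  assumes P: "seminorm n P" and M: "0 < M" and d: "0 < \<delta>" and mn: "m \<le> n"
    and g: "greedy n P (\<delta> * M) m T S a"
    and q: "7/8 \<le> measure gaussian_seq {x. P (T x) \<le> 2 * M}"
  shows "real m * normal_tail (2 / \<delta>) \<le> 1 / 7"
proof -
  have TS: "gauss_iso n T S" using g by (simp add: greedy_def)
  let ?Q = "\<lambda>x. P (T x)" and ?t = "normal_tail (2 / \<delta>)"
  have Q: "seminorm n ?Q" by (rule seminorm_comp_gauss_iso[OF P TS])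
  \<comment> \<open>\<open>greedy\<close> controls only the absolute value of the diagonal. Flipping
    the sign of a row makes it positive and does not change the symmetric slab.\<close>
  define b where "b k i = sgn (a k k) * a k i" for k i
  let ?S = "{x. \<forall>k\<in>{0..<0+m}. \<bar>\<Sum>i<n. b k i * x i\<bar> \<le> 2 * M}"
  have dM: "0 < \<delta> * M" using d M by simp
  have sS: "?S \<in> sets gaussian_seq" by (rule gaussian_seq_setI) measurable
  have "{x. ?Q x \<le> 2 * M} \<subseteq> ?S"
  proof (intro subsetI CollectI ballI)
    fix x k assume x: "x \<in> {x. ?Q x \<le> 2 * M}" and k: "k \<in> {0..<0+m}"
    have le: "dot n (a k) v \<le> ?Q v" for v using g k by (simp add: greedy_def)
    have "dot n (a k) (- x) = - dot n (a k) x" by (simp add: dot_def sum_negf)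
    then have "\<bar>dot n (a k) x\<bar> \<le> ?Q x"
      using le[of x] le[of "- x"] seminorm_minus[OF Q, of x] by (simp add: abs_le_iff)
    moreover have "(\<Sum>i<n. b k i * x i) = sgn (a k k) * dot n (a k) x"
      by (simp add: b_def dot_def sum_distrib_left mult.assoc)
    moreover have "\<bar>sgn (a k k) * dot n (a k) x\<bar> \<le> \<bar>dot n (a k) x\<bar>"
      by (simp add: abs_mult sgn_if)
    ultimately show "\<bar>\<Sum>i<n. b k i * x i\<bar> \<le> 2 * M" using x by simp
  qed
  then have "measure gaussian_seq {x. ?Q x \<le> 2 * M} \<le> measure gaussian_seq ?S"
    by (rule G.finite_measure_mono[OF _ sS])
  also have "\<dots> \<le> (1 - normal_tail (2 * M / (\<delta> * M))) ^ m"
  proof (rule triangular_slabs[OF _ dM])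
    fix k assume "k \<in> {0..<0+m}"
    then have "\<delta> * M \<le> \<bar>a k k\<bar>" "\<And>i. k < i \<Longrightarrow> a k i = 0" using g by (auto simp: greedy_def)
    moreover have "b k k = \<bar>a k k\<bar>" by (simp add: b_def sgn_if)
    ultimately show "\<delta> * M \<le> b k k" "\<And>i. k < i \<Longrightarrow> b k i = 0" by (auto simp: b_def)
  qed (use M mn in auto)
  also have "2 * M / (\<delta> * M) = 2 / \<delta>" using M by simp
  finally have 1: "7/8 \<le> (1 - ?t) ^ m" using q by linarith
  have t: "0 \<le> ?t" "?t \<le> 1" by (auto simp: normal_tail_def)
  have "(1 + real m * ?t) * (7/8) \<le> (1 + real m * ?t) * (1 - ?t) ^ m"
    using 1 t by (intro mult_left_mono) auto
  also have "\<dots> \<le> 1" by (rule power_one_minus_le[OF t])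
  finally show ?thesis by simp
qed

section \<open>Constants and the final assembly\<close>

lemma normal_tail_inverse_le:
  assumes d: "0 < \<delta>" "\<delta> \<le> 1"
  shows "9 / normal_tail (2 / \<delta>) \<le> exp (10 / \<delta>^2)" and "0 < normal_tail (2 / \<delta>)"
proof -
  let ?t = "normal_tail (2 / \<delta>)" and ?u = "1 / \<delta>"
  have u: "1 \<le> ?u" using d by simp
  have ge: "exp (- ((2 / \<delta> + 1)^2) / 2) / 3 \<le> ?t" using d by (intro normal_tail_ge) auto
  moreover have pos: "0 < exp (- ((2 / \<delta> + 1)^2) / 2) / 3" by simp
  ultimately show t0: "0 < ?t" by linarith
  have "9 / ?t \<le> 9 / (exp (- ((2 / \<delta> + 1)^2) / 2) / 3)" using ge pos t0 by (intro divide_left_mono) auto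
  also have "\<dots> = 27 * exp ((2 / \<delta> + 1)^2 / 2)" by (simp add: exp_minus field_simps)
  also have "\<dots> \<le> exp 5 * exp ((2 / \<delta> + 1)^2 / 2)"
  proof (rule mult_right_mono)
    have "2 ^ 5 \<le> (exp 1 :: real) ^ 5"
      using exp_ge_add_one_self[of "1::real"] by (intro power_mono) auto
    also have "\<dots> = exp 5" by (simp add: exp_of_nat_mult[symmetric])
    finally show "(27::real) \<le> exp 5" by simp
  qed simp
  also have "\<dots> = exp (5 + (2 * ?u + 1)^2 / 2)" by (simp add: exp_add)
  also have "\<dots> \<le> exp (10 * ?u^2)"
  proof -
    have "5 + (2 * v + 1)^2 / 2 \<le> 10 * v^2" if v: "1 \<le> v" for v :: real
    proof -
      have "(2 * v + 1)^2 \<le> (3 * v)^2" using v by (intro power_mono) auto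
      moreover have "1 \<le> v^2" using v by (rule one_le_power)
      ultimately show ?thesis by (simp add: power_mult_distrib)
    qed
    then show ?thesis using u by (simp only: exp_le_cancel_iff)
  qed
  also have "10 * ?u^2 = 10 / \<delta>^2" by (simp add: power_divide)
  finally show "9 / ?t \<le> exp (10 / \<delta>^2)" .
qed

lemma seminorm_of_norm:
  assumes N: "is_norm_on (Rn n) \<psi>"
  shows "seminorm n (\<lambda>x. \<psi> (pad n x))" and "\<psi> (pad n v) = 0 \<Longrightarrow> pad n v = 0"
proof -
  show "seminorm n (\<lambda>x. \<psi> (pad n x))"
    unfolding seminorm_def
  proof (intro conjI allI)
    show "\<psi> (pad n (x + y)) \<le> \<psi> (pad n x) + \<psi> (pad n y)" for x y
      unfolding pad_add using N by (simp add: is_norm_on_def)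
    show "\<psi> (pad n (c *\<^sub>R x)) = \<bar>c\<bar> * \<psi> (pad n x)" for c x
      unfolding pad_scaleR using N by (simp only: is_norm_on_def pad_in_Rn)
    show "\<psi> (pad n (pad n x)) = \<psi> (pad n x)" for x by simp
  qed
  show "\<psi> (pad n v) = 0 \<Longrightarrow> pad n v = 0" using N by (simp only: is_norm_on_def pad_in_Rn)
qed

theorem theorem3:
  shows "\<exists>C::real. C > 0 \<and>
    (\<forall>(n::nat) (\<epsilon>::real) (\<psi>::(nat \<Rightarrow> real) \<Rightarrow> real).
       n \<ge> 1 \<longrightarrow> 0 < \<epsilon> \<longrightarrow> \<epsilon> < 1/2 \<longrightarrow> is_norm_on (Rn n) \<psi> \<longrightarrow>
       (\<exists>(k::nat) (\<phi>::(nat \<Rightarrow> real) \<Rightarrow> real).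
          junta_norm n k \<phi> \<and>
          real k \<le> exp (C * (ln (1/\<epsilon>) / \<epsilon>^4)) \<and>
          measure (std_gaussian n)
            {g \<in> space (std_gaussian n). 1 - \<epsilon> \<le> \<psi> g / \<phi> g \<and> \<psi> g / \<phi> g \<le> 1 + \<epsilon>} \<ge> 1 - \<epsilon>))"
  \<comment> \<open>\<open>22528000 = 10 \<cdot> 160^2 \<cdot> 88\<close>, from \<open>10 / \<delta>^2\<close> with \<open>\<delta> = \<epsilon>^2 / (160 r)\<close> and \<open>r^2 = 88 ln (1/\<epsilon>)\<close>\<close>
proof (intro exI[of _ "22528000 :: real"] conjI allI impI)
  fix n :: nat and \<epsilon> :: real and \<psi> :: "(nat \<Rightarrow> real) \<Rightarrow> real"
  assume n: "1 \<le> n" and e: "0 < \<epsilon>" "\<epsilon> < 1/2" and N: "is_norm_on (Rn n) \<psi>"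
  define P where "P x = \<psi> (pad n x)" for x
  have P: "seminorm n P" and def: "\<And>v. P v = 0 \<Longrightarrow> pad n v = 0"
    using seminorm_of_norm[OF N] unfolding P_def by blast+
  have [measurable]: "P \<in> borel_measurable borel" by (rule measurable_seminorm[OF P])
  have "P (unit_vec (n - 1)) \<noteq> 0"
  proof
    assume "P (unit_vec (n - 1)) = 0"
    then have "pad n (unit_vec (n - 1)) = 0" by (rule def)
    then have "pad n (unit_vec (n - 1)) (n - 1) = 0 (n - 1)" by (rule fun_cong)
    then show False using n by (simp add: pad_def unit_vec_def)
  qed
  then have "0 < P (unit_vec (n - 1))" using seminorm_nonneg[OF P, of "unit_vec (n - 1)"] by simp
  then obtain M where M: "0 < M" and q2: "7/8 \<le> measure gaussian_seq {x. P x \<le> 2 * M}"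
    and q1: "1/8 \<le> measure gaussian_seq {x. M \<le> P x}"
    by (rule quantile_exists[OF P n])
  define l where "l = ln (1/\<epsilon>)"
  have l: "1/2 \<le> l"
  proof -
    have "ln 2 \<le> l" unfolding l_def using e by (intro ln_mono) (auto simp: field_simps)
    then show ?thesis using ln2_ge_two_thirds by linarith
  qed
  \<comment> \<open>As \<open>88 = 8 * 11\<close>, the tail \<open>exp (- (r^2) / 8)\<close> equals
    \<open>\<epsilon> ^ 11\<close>; ten of these factors are at most 1/2 each, which absorbs the
    constants 12 and 64.\<close>
  define r where "r = sqrt (88 * l)"
  have r2: "r^2 = 88 * l" using l by (simp add: r_def)
  have r1: "1 \<le> r" unfolding r_def using l by simp
  have rexp: "12 * exp (- (r^2) / 8) \<le> \<epsilon> / 64"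
  proof -
    have "exp (- (r^2) / 8) = exp (real 11 * ln \<epsilon>)" using e by (simp add: r2 l_def ln_div)
    also have "\<dots> = \<epsilon> ^ 11" using e by (simp only: exp_of_nat_mult exp_ln)
    also have "\<dots> = \<epsilon> * \<epsilon> ^ 10" by (simp add: power_Suc[symmetric])
    also have "\<dots> \<le> \<epsilon> * (1/2) ^ 10" using e by (intro mult_left_mono power_mono) auto
    finally show ?thesis using e by (simp add: power_divide)
  qed
  define \<delta> where "\<delta> = \<epsilon>^2 / (160 * r)"
  have d0: "0 < \<delta>" using e r1 by (simp add: \<delta>_def)
  have d1: "\<delta> \<le> 1"
  proof -
    have "\<epsilon>^2 \<le> 1" using e by (intro power_le_one) auto
    then show ?thesis using r1 by (simp add: \<delta>_def divide_le_eq)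
  qed
  define q where "q = normal_tail (2 / \<delta>)"
  have q0: "0 < q" and qexp: "9 / q \<le> exp (10 / \<delta>^2)"
    using normal_tail_inverse_le[OF d0 d1] by (auto simp: q_def)
  have qle: "q \<le> 1" by (simp add: q_def normal_tail_def)
  have Mpos: "0 < \<delta> * M" using d0 M by simp
  obtain m T S a where mn: "m \<le> n" and g: "greedy n P (\<delta> * M) m T S a"
    and lip: "coord_lipschitz {m..<n} (\<delta> * M) (\<lambda>x. P (T x))"
    by (rule greedy_exists[OF P Mpos])
  have TS: "gauss_iso n T S" using g by (simp add: greedy_def)
  have [measurable]: "T \<in> borel \<rightarrow>\<^sub>M borel" "S \<in> borel \<rightarrow>\<^sub>M borel" by (rule gauss_isoD(8,9)[OF TS])+
  have PT: "seminorm n (\<lambda>x. P (T x))" by (rule seminorm_comp_gauss_iso[OF P TS])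
  have defT: "pad n v = 0" if "P (T v) = 0" for v
  proof -
    have "T (pad n v) = 0" using def[OF that] gauss_isoD(6)[OF TS] by simp
    then show ?thesis using gauss_isoD(4)[OF TS, of "pad n v"] linear_0[OF gauss_isoD(2)[OF TS]] by (simp only:)
  qed
  have "{x. P x \<le> 2 * M} \<in> sets borel" "{x. M \<le> P x} \<in> sets borel" by measurable
  then have qT2: "7/8 \<le> measure gaussian_seq {x. P (T x) \<le> 2 * M}"
    and qT1: "1/8 \<le> measure gaussian_seq {x. M \<le> P (T x)}"
    using measure_gauss_iso[OF TS, of "{x. P x \<le> 2 * M}"] measure_gauss_iso[OF TS, of "{x. M \<le> P x}"] q1 q2
    by simp_all
  have mq: "real m * q \<le> 1/7" unfolding q_def by (rule greedy_length[OF P M d0 mn g qT2])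
  \<comment> \<open>With \<open>k * q \<ge> 7\<close> the factor \<open>1 + k * q\<close> is at
    least 8, hence the probability 1/8 in the choice of \<open>y\<close>.\<close>
  define k where "k = nat \<lceil>7 / q\<rceil>"
  have k: "7 / q \<le> real k" "real k \<le> 7 / q + 1" using q0 by (auto simp: k_def)
  have kq: "7 \<le> real k * normal_tail (2 / \<delta>)" using k(1) q0 by (simp add: q_def pos_divide_le_eq)
  have "real m \<le> 1 / q"
  proof -
    have "real m * q \<le> 1" using mq by simp
    then show ?thesis using q0 by (simp add: pos_le_divide_eq)
  qed
  moreover have "1 \<le> 1 / q" using q0 qle by simp
  \<comment> \<open>The nine parts are one for \<open>m\<close>, seven for \<open>k\<close> and one
    for rounding up.\<close>
  ultimately have "real (m + k) \<le> 9 / q" using k(2) by simp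
  also have "\<dots> \<le> exp (10 / \<delta>^2)" by (rule qexp)
  also have "10 / \<delta>^2 = 22528000 * (l / \<epsilon>^4)"
    using e r1 by (simp add: \<delta>_def power_divide power_mult_distrib r2 power_mult[symmetric])
  finally have bound: "real (m + k) \<le> exp (22528000 * (ln (1/\<epsilon>) / \<epsilon>^4))" by (simp add: l_def)
  \<comment> \<open>\<open>\<psi>\<close> is unconstrained off \<open>Rn n\<close>, so a Borel
    function \<open>f\<close> that agrees with \<open>\<phi>\<close> on \<open>Rn n\<close> provides
    measurability.\<close>
  have gauss: "measure (std_gaussian n) {g \<in> space (std_gaussian n). 1 - \<epsilon> \<le> \<psi> g / \<phi> g \<and> \<psi> g / \<phi> g \<le> 1 + \<epsilon>}
      = measure gaussian_seq {x. 1 - \<epsilon> \<le> P x / \<phi> (pad n x) \<and> P x / \<phi> (pad n x) \<le> 1 + \<epsilon>}"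
    if [measurable]: "f \<in> borel_measurable borel" and eq: "\<And>x. x \<in> Rn n \<Longrightarrow> \<phi> x = f x" for \<phi> f
  proof -
    let ?A = "{g. 1 - \<epsilon> \<le> P g / f g \<and> P g / f g \<le> 1 + \<epsilon>}"
    have A: "?A \<in> sets borel" by measurable
    have "{g \<in> space (std_gaussian n). 1 - \<epsilon> \<le> \<psi> g / \<phi> g \<and> \<psi> g / \<phi> g \<le> 1 + \<epsilon>} = ?A \<inter> Rn n"
      using eq by (auto simp: P_def pad_Rn)
    then show ?thesis
      using measure_std_gaussian[OF A, of n] eq by (simp add: P_def)
  qed
  show "\<exists>k \<phi>. junta_norm n k \<phi> \<and> real k \<le> exp (22528000 * (ln (1/\<epsilon>) / \<epsilon>^4)) \<and>
      1 - \<epsilon> \<le> measure (std_gaussian n)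
            {g \<in> space (std_gaussian n). 1 - \<epsilon> \<le> \<psi> g / \<phi> g \<and> \<psi> g / \<phi> g \<le> 1 + \<epsilon>}"
  proof (cases "m + k \<le> n")
    case True
    obtain z c where zc: "0 < c" "P (T z) \<noteq> 0" and pr: "1 - \<epsilon> \<le> measure gaussian_seq
        {x. 1 - \<epsilon> \<le> P (T x) / frozen_norm (\<lambda>x. P (T x)) m {m..<m+k} z c x \<and>
            P (T x) / frozen_norm (\<lambda>x. P (T x)) m {m..<m+k} z c x \<le> 1 + \<epsilon>}"
      using frozen_norm_approximates[OF PT defT e M qT1 qT2 r1 rexp \<delta>_def True kq lip] by blast
    let ?\<Phi> = "frozen_norm (\<lambda>x. P (T x)) m {m..<m+k} z c"
    have [measurable]: "?\<Phi> \<in> borel_measurable borel" by (rule measurable_frozen_norm[OF PT])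
    let ?\<phi> = "\<lambda>x. ?\<Phi> (S x)"
    let ?A = "{x. 1 - \<epsilon> \<le> P x / ?\<Phi> (S x) \<and> P x / ?\<Phi> (S x) \<le> 1 + \<epsilon>}"
    have A: "?A \<in> sets borel" by measurable
    have J: "junta_norm n (m + k) ?\<phi>"
      by (rule junta_norm_frozen_norm[OF TS PT defT True zc])
    have pad\<Phi>: "?\<Phi> (S (pad n x)) = ?\<Phi> (S x)" for x
    proof -
      let ?u = "S x"
      have "restr {..<m} (pad n ?u) = restr {..<m} ?u" using mn by (auto simp: restr_def pad_def fun_eq_iff)
      moreover have "l2_on {m..<m+k} (pad n ?u) = l2_on {m..<m+k} ?u"
        using True by (intro seminorm_pad[OF seminorm_l2_on]) auto
      ultimately have "?\<Phi> (pad n ?u) = ?\<Phi> ?u" by (simp only: frozen_norm_def)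
      then show ?thesis by (simp add: gauss_isoD(7)[OF TS])
    qed
    have "measure (std_gaussian n) {g \<in> space (std_gaussian n). 1 - \<epsilon> \<le> \<psi> g / ?\<phi> g \<and> \<psi> g / ?\<phi> g \<le> 1 + \<epsilon>}
        = measure gaussian_seq ?A"
      by (subst gauss[of ?\<phi> ?\<phi>]) (simp_all add: pad\<Phi>)
    \<comment> \<open>Substituting \<open>T x\<close> cancels \<open>S\<close> and returns to the
      rotated coordinates in which the estimate was proved.\<close>
    also have "\<dots> = measure gaussian_seq {x. T x \<in> ?A}" by (rule measure_gauss_iso[OF TS A, symmetric])
    also have "\<dots> \<ge> 1 - \<epsilon>" using pr by (simp add: gauss_isoD(4)[OF TS])
    finally show ?thesis using J bound by blast
  next
    case False
    \<comment> \<open>Now \<open>n < m + k\<close>, so \<open>\<psi>\<close> itself is a junta norm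
      within the allowed dimension.\<close>
    then have "real n \<le> exp (22528000 * (ln (1/\<epsilon>) / \<epsilon>^4))" using bound by linarith
    moreover have "1 - \<epsilon> \<le> measure (std_gaussian n) {g \<in> space (std_gaussian n). 1 - \<epsilon> \<le> \<psi> g / \<psi> g \<and> \<psi> g / \<psi> g \<le> 1 + \<epsilon>}"
    proof -
      \<comment> \<open>Since \<open>x / 0 = 0\<close>, the ratio of \<open>\<psi>\<close> to itself
        is 1 only where it does not vanish; the small-ball estimate covers the exception.\<close>
      let ?B = "{x. P x \<le> \<epsilon>/32 * M}"
      let ?A = "{x. 1 - \<epsilon> \<le> P x / P x \<and> P x / P x \<le> 1 + \<epsilon>}"
      have B: "?B \<in> sets gaussian_seq" by (rule gaussian_seq_setI) measurable
      have A: "?A \<in> sets gaussian_seq" by (rule gaussian_seq_setI) measurable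
      have "UNIV - ?B \<subseteq> ?A"
      proof
        fix x assume "x \<in> UNIV - ?B"
        then have "\<epsilon>/32 * M < P x" by simp
        moreover have "0 < \<epsilon>/32 * M" using e M by simp
        ultimately have "P x \<noteq> 0" by linarith
        then show "x \<in> ?A" using e by simp
      qed
      then have "measure gaussian_seq (UNIV - ?B) \<le> measure gaussian_seq ?A"
        by (rule G.finite_measure_mono[OF _ A])
      then have "1 - \<epsilon> \<le> measure gaussian_seq ?A"
        using G.prob_compl[OF B] prob_le_quantile_fraction[OF P e M q1] e by simp
      moreover have "measure (std_gaussian n) {g \<in> space (std_gaussian n). 1 - \<epsilon> \<le> \<psi> g / \<psi> g \<and> \<psi> g / \<psi> g \<le> 1 + \<epsilon>}
          = measure gaussian_seq ?A"
        by (subst gauss[of P \<psi>]) (auto simp: P_def pad_Rn)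
      ultimately show ?thesis by simp
    qed
    ultimately show ?thesis using junta_norm_full[OF N] by blast
  qed
qed simp

end
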